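(* Let $d$ be a positive integer, $\lambda>1$, and let $\omega(\boldsymbol z)=\prod_{j=1}^d(1-|z_j|^2)^{\lambda-2}$ on the polydisc $\mathbb D^d$. Let $\boldsymbol s:\mathbb C^d\to\mathbb C^d$ be the symmetrization map, $\mathbb G_d=\boldsymbol s(\mathbb D^d)$, and let $\widetilde\omega:\mathbb G_d\to(0,\infty)$ be the continuous function with $\omega=\widetilde\omega\circ\boldsymbol s$. The weighted Bergman kernel of $\mathbb A^2_{\widetilde\omega}(\mathbb G_d)$ is given by $$\mathcal B_{\widetilde\omega}\big(\boldsymbol s(\boldsymbol z),\boldsymbol s(\boldsymbol w)\big)=\frac{\det\big((1-z_i\overline{w_j})^{-\lambda}\big)_{i,j=1}^d}{\prod_{i<j}(z_i-z_j)(\overline{w_i}-\overline{w_j})},\qquad\boldsymbol z,\boldsymbol w\in\mathbb D^d.$$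
   Context: $\mathbb D^d=\{\boldsymbol z\in\mathbb C^d:|z_1|,\dots,|z_d|<1\}$. $\boldsymbol s=(s_1,\dots,s_d)$, where $s_k$ is the elementary symmetric polynomial of degree $k$ in $d$ variables; $\mathbb G_d$ is the symmetrized polydisc. For a bounded domain $\Omega\subseteq\mathbb C^d$ and a continuous weight $\nu:\Omega\to(0,\infty)$, the weighted Bergman space $\mathbb A^2_\nu(\Omega)$ is the Hilbert space of holomorphic functions $f$ on $\Omega$ with $\int_\Omega|f(\boldsymbol z)|^2\nu(\boldsymbol z)\,dV(\boldsymbol z)<\infty$, where $dV$ is the normalized Lebesgue measure on $\Omega$; its weighted Bergman kernel is its reproducing kernel. Here $\mathcal B_{\widetilde\omega}$ denotes the reproducing kernel of $\mathbb A^2_{\widetilde\omega}(\mathbb G_d)$. The numerator is divisible by the denominator (as a function holomorphic in $\boldsymbol z$ and antiholomorphic in $\boldsymbol w$), so the right side is well defined also at points where the denominator vanishes.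
   Formalization: With dV of total mass one the formula fails by a constant (d=1: true kernel is (λ-1) times it). Proved: the formula for dV = ((λ-1)/π)^d times Lebesgue measure, and, for dV = c times Lebesgue measure with any c>0, the formula multiplied by ((λ-1)/π)^d/c. *)

theory Defs
  imports "HOL-Analysis.Analysis"
begin

text \<open>
  Points of \<open>C^d\<close> are vectors of type \<open>complex^'d\<close>, with \<open>d = CARD('d)\<close>. The well-order on the
  finite index type plays the role of the usual order on \<open>{1,...,d}\<close>.
\<close>

definition polydisc :: "(complex^'d) set" where
  "polydisc = {z. \<forall>i. cmod (z $ i) < 1}"

definition index_rank :: "'d::{finite,wellorder} \<Rightarrow> nat" where
  "index_rank k = card {i. i \<le> k}"

definition elem_sym :: "nat \<Rightarrow> complex^'d \<Rightarrow> complex" where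
  "elem_sym k z = (\<Sum>I | card I = k. \<Prod>i\<in>I. z $ i)"

definition symmetrization :: "complex^'d::{finite,wellorder} \<Rightarrow> complex^'d::{finite,wellorder}" where
  "symmetrization z = (\<chi> k. elem_sym (index_rank k) z)"

definition symmetrized_polydisc :: "(complex^'d::{finite,wellorder}) set" where
  "symmetrized_polydisc = symmetrization ` polydisc"

text \<open>
  Holomorphy in several variables: the total derivative exists and is complex linear at every
  point of the (open) set.
\<close>

definition holomorphic_cn_on :: "(complex^'d \<Rightarrow> complex) \<Rightarrow> (complex^'d) set \<Rightarrow> bool" where
  "holomorphic_cn_on f \<Omega> \<longleftrightarrow>
     (\<forall>z\<in>\<Omega>. \<exists>a. (f has_derivative (\<lambda>h. \<Sum>i\<in>UNIV. a $ i * h $ i)) (at z))"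

definition sesquiholomorphic_on :: "(complex^'d \<Rightarrow> complex^'d \<Rightarrow> complex) \<Rightarrow> (complex^'d) set \<Rightarrow> bool" where
  "sesquiholomorphic_on F \<Omega> \<longleftrightarrow>
     (\<forall>w\<in>\<Omega>. holomorphic_cn_on (\<lambda>z. F z w) \<Omega>) \<and>
     (\<forall>z\<in>\<Omega>. holomorphic_cn_on (\<lambda>w. cnj (F z w)) \<Omega>)"

text \<open>
  \<open>Q\<close> is the quotient \<open>N / P\<close> in the class of functions holomorphic in the first and
  antiholomorphic in the second variable. If \<open>P\<close> is the product of a function of \<open>z\<close> and a function
  of \<open>w\<close> with nowhere dense zero sets, this determines \<open>Q\<close> on \<open>\<Omega> \<times> \<Omega>\<close>, including the zeros of \<open>P\<close>.
\<close>

definition is_quotient_on ::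
  "(complex^'d) set \<Rightarrow> (complex^'d \<Rightarrow> complex^'d \<Rightarrow> complex) \<Rightarrow> (complex^'d \<Rightarrow> complex^'d \<Rightarrow> complex)
     \<Rightarrow> (complex^'d \<Rightarrow> complex^'d \<Rightarrow> complex) \<Rightarrow> bool" where
  "is_quotient_on \<Omega> N P Q \<longleftrightarrow>
     sesquiholomorphic_on Q \<Omega> \<and> (\<forall>z\<in>\<Omega>. \<forall>w\<in>\<Omega>. N z w = Q z w * P z w)"

text \<open>
  Here \<open>dV\<close> is \<open>c\<close> times Lebesgue measure, the constant \<open>c > 0\<close> being the normalization of \<open>dV\<close>;
  the kernel scales with \<open>1 / c\<close>. Mass one on \<open>\<Omega>\<close> is \<open>c = 1 / measure lebesgue \<Omega>\<close>.
\<close>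

definition weighted_volume :: "real \<Rightarrow> (complex^'d) set \<Rightarrow> (complex^'d \<Rightarrow> real) \<Rightarrow> (complex^'d) measure" where
  "weighted_volume c \<Omega> \<nu> =
     density (scale_measure (ennreal c) (lebesgue_on \<Omega>)) (\<lambda>z. ennreal (\<nu> z))"

definition weighted_bergman_space :: "real \<Rightarrow> (complex^'d) set \<Rightarrow> (complex^'d \<Rightarrow> real) \<Rightarrow> (complex^'d \<Rightarrow> complex) set" where
  "weighted_bergman_space c \<Omega> \<nu> =
     {f. holomorphic_cn_on f \<Omega> \<and> integrable (weighted_volume c \<Omega> \<nu>) (\<lambda>z. (cmod (f z))\<^sup>2)}"

definition bergman_inner ::
  "real \<Rightarrow> (complex^'d) set \<Rightarrow> (complex^'d \<Rightarrow> real) \<Rightarrow> (complex^'d \<Rightarrow> complex) \<Rightarrow> (complex^'d \<Rightarrow> complex) \<Rightarrow> complex" where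
  "bergman_inner c \<Omega> \<nu> f g = (LINT z|weighted_volume c \<Omega> \<nu>. f z * cnj (g z))"

definition is_reproducing_kernel ::
  "real \<Rightarrow> (complex^'d) set \<Rightarrow> (complex^'d \<Rightarrow> real) \<Rightarrow> (complex^'d \<Rightarrow> complex^'d \<Rightarrow> complex) \<Rightarrow> bool" where
  "is_reproducing_kernel c \<Omega> \<nu> K \<longleftrightarrow>
     (\<forall>w\<in>\<Omega>. (\<lambda>z. K z w) \<in> weighted_bergman_space c \<Omega> \<nu>) \<and>
     (\<forall>w\<in>\<Omega>. \<forall>f\<in>weighted_bergman_space c \<Omega> \<nu>. f w = bergman_inner c \<Omega> \<nu> f (\<lambda>z. K z w))"

text \<open>A reproducing kernel is unique on \<open>\<Omega> \<times> \<Omega>\<close>; the value 0 elsewhere makes it a unique HOL function.\<close>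

definition weighted_bergman_kernel ::
  "real \<Rightarrow> (complex^'d) set \<Rightarrow> (complex^'d \<Rightarrow> real) \<Rightarrow> complex^'d \<Rightarrow> complex^'d \<Rightarrow> complex" where
  "weighted_bergman_kernel c \<Omega> \<nu> =
     (THE K. is_reproducing_kernel c \<Omega> \<nu> K \<and> (\<forall>z w. z \<notin> \<Omega> \<or> w \<notin> \<Omega> \<longrightarrow> K z w = 0))"

definition polydisc_weight :: "real \<Rightarrow> complex^'d \<Rightarrow> real" where
  "polydisc_weight lam z = (\<Prod>j\<in>UNIV. (1 - (cmod (z $ j))\<^sup>2) powr (lam - 2))"

text \<open>
  The factor that makes \<open>polydisc_weight lam\<close> times Lebesgue measure a probability measure on the
  polydisc: the integral of \<open>(1 - |z|^2) powr (lam - 2)\<close> over the unit disc is \<open>pi / (lam - 1)\<close>.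
  With this normalization the polydisc has the kernel \<open>\<Prod>j. (1 - z_j cnj w_j) powr (-lam)\<close>.
\<close>

definition polydisc_normalization :: "real \<Rightarrow> 'd::finite itself \<Rightarrow> real" where
  "polydisc_normalization lam _ = ((lam - 1) / pi) ^ CARD('d)"

text \<open>The base \<open>1 - z_i cnj w_j\<close> has positive real part on the polydisc, so \<open>powr\<close> is the principal branch.\<close>

definition power_kernel_det :: "real \<Rightarrow> complex^'d \<Rightarrow> complex^'d \<Rightarrow> complex" where
  "power_kernel_det lam z w = det (\<chi> i j. (1 - z $ i * cnj (w $ j)) powr (- complex_of_real lam))"

definition vandermonde_product :: "complex^'d::{finite,wellorder} \<Rightarrow> complex^'d::{finite,wellorder} \<Rightarrow> complex" where
  "vandermonde_product z w =
     (\<Prod>(i, j)\<in>{(i, j). i < j}. (z $ i - z $ j) * (cnj (w $ i) - cnj (w $ j)))"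

end

theory Submission
  imports Defs "HOL-Complex_Analysis.Cauchy_Integral_Formula"
    "HOL-Computational_Algebra.Fundamental_Theorem_Algebra"
begin

text \<open>
  Write \<open>V(z)\<close> for the Vandermonde determinant of the coordinates of \<open>z\<close>. The complex Jacobian
  determinant of the symmetrization map \<open>s\<close> is \<open>V(z)\<close> up to sign, and off the null set \<open>V = 0\<close> the
  map from the polydisc to its image is \<open>d!\<close> to one. The change of variables formula
  (\<open>integral_symmetrized_polydisc\<close>) therefore turns the inner product of \<open>f\<close> and \<open>g\<close> over the
  symmetrized polydisc into \<open>1 / d!\<close> times the inner product of \<open>V \<cdot> (f \<circ> s)\<close> and \<open>V \<cdot> (g \<circ> s)\<close> over
  the polydisc. The function \<open>h = V \<cdot> (f \<circ> s)\<close> changes sign under transpositions of the coordinates.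
  If \<open>h\<close> is paired with \<open>det ((1 - z_i cnj w_j) powr - lam)\<close> and the determinant is expanded over
  permutations \<open>p\<close>, then each of the \<open>d!\<close> terms is evaluated by the product kernel of the polydisc at
  the permuted point \<open>w \<circ> p\<close>, and all terms are equal to \<open>h(w)\<close>. Dividing by \<open>V(w)\<close> gives \<open>f(s(w))\<close>.
  So the quotient of the determinant by \<open>V(z) cnj (V(w))\<close> reproduces \<open>f\<close> wherever \<open>V(w)\<close> is nonzero
  (\<open>half_det_pairing_generic\<close>).

  It remains to see that this quotient is a holomorphic function on the symmetrized polydisc, also
  over the zeros of \<open>V\<close>, and that it reproduces at the points \<open>s(w)\<close> with \<open>V(w) = 0\<close>. Both follow
  from interpolation. Let \<open>p\<close> be a monic polynomial of degree \<open>d\<close> with all roots in the unit disc and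
  let \<open>\<phi>\<close> be holomorphic on the disc. The Cauchy integral of
  \<open>\<phi>(\<zeta>) (p(\<zeta>) - p(t)) / ((\<zeta> - t) p(\<zeta>))\<close> is a polynomial in \<open>t\<close> of degree less than \<open>d\<close> that agrees
  with \<open>\<phi>\<close> at the roots of \<open>p\<close>, and its coefficients depend holomorphically on those of \<open>p\<close>
  (\<open>interp_coeff_interpolates\<close>, \<open>complex_linear_deriv_interp_coeff\<close>). The coefficients of \<open>p\<close> are the
  coordinates of \<open>s(z)\<close> when the roots are the coordinates of \<open>z\<close>. Hence a matrix
  \<open>\<phi>_j(z_i)\<close> is the Vandermonde matrix times a matrix of holomorphic functions of \<open>s(z)\<close>. Applying this
  in the variable \<open>w\<close> and then in \<open>z\<close> factors the determinant as
  \<open>V(z) \<cdot> sym_kernel (s(z)) (s(w)) \<cdot> cnj (V(w))\<close> without any division. After the first step the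
  function \<open>half_det\<close> is bounded in \<open>z\<close> and continuous in \<open>s(w)\<close>, so that dominated convergence extends
  the reproducing formula from generic points to all points (\<open>half_det_pairing\<close>). Antiholomorphy in the
  second variable costs nothing: reproducing kernels are Hermitian.

  The product kernel of the polydisc is treated without power series. The weight is invariant under
  rotations, so the mean value property evaluates a weighted integral at the origin
  (\<open>weighted_mean_value\<close>); a Moebius automorphism moves an arbitrary point to the origin, and it
  transforms weight, kernel and Jacobian into each other (\<open>moebius_kernel\<close>, \<open>polydisc_reproducing\<close>).
  The constant is the integral of the weight.
\<close>

section \<open>Change of variables in complex coordinates\<close>

text \<open>
  A bijection between the standard bases induces an isometry that maps boxes to boxes of the same
  volume. It transports the real change of variables theorem, stated for \<open>real ^ 'm\<close>, to
  complex coordinate spaces.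
\<close>
lemma ex_measure_isometry:
  assumes "DIM('a::euclidean_space) = DIM('b::euclidean_space)"
  shows "\<exists>T::'a \<Rightarrow> 'b. linear T \<and> bij T \<and> (\<forall>x. norm (T x) = norm x) \<and> distr lborel borel T = lborel"
proof -
  obtain \<beta> :: "'a \<Rightarrow> 'b" where \<beta>: "bij_betw \<beta> Basis Basis"
    using assms finite_same_card_bij[of "Basis::'a set" "Basis::'b set"] by auto
  define T where "T = (\<lambda>x. \<Sum>b\<in>Basis. (x \<bullet> b) *\<^sub>R \<beta> b)"
  define \<beta>' where "\<beta>' = inv_into Basis \<beta>"
  have \<beta>': "bij_betw \<beta>' Basis Basis"
    unfolding \<beta>'_def using \<beta> by (rule bij_betw_inv_into)
  have lin: "linear T"
    unfolding T_def by (intro linear_compose_sum ballI) (auto intro!: linearI simp: inner_simps algebra_simps)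
  have comp: "T x \<bullet> \<beta> b = x \<bullet> b" if "b \<in> Basis" for x b
  proof -
    have "T x \<bullet> \<beta> b = (\<Sum>c\<in>Basis. (x \<bullet> c) * (\<beta> c \<bullet> \<beta> b))"
      by (simp add: T_def inner_sum_left)
    also have "\<dots> = (\<Sum>c\<in>Basis. if c = b then x \<bullet> c else 0)"
    proof (intro sum.cong refl)
      fix c :: 'a assume c: "c \<in> Basis"
      then have "\<beta> c \<in> Basis" "\<beta> b \<in> Basis" "\<beta> c = \<beta> b \<longleftrightarrow> c = b"
        using that \<beta> by (auto simp: bij_betw_def inj_on_def)
      then show "(x \<bullet> c) * (\<beta> c \<bullet> \<beta> b) = (if c = b then x \<bullet> c else 0)" by (simp add: inner_Basis)
    qed
    finally show ?thesis using that by simp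
  qed
  have comp': "T x \<bullet> c = x \<bullet> \<beta>' c" if "c \<in> Basis" for x c
    using comp[of "\<beta>' c" x] that \<beta> \<beta>' unfolding \<beta>'_def
    by (metis bij_betw_apply bij_betw_inv_into_right)
  have norm: "norm (T x) = norm x" for x
  proof -
    have "T x \<bullet> T x = (\<Sum>c\<in>Basis. (x \<bullet> \<beta>' c) * (x \<bullet> \<beta>' c))"
      by (subst euclidean_inner) (simp add: comp')
    also have "\<dots> = (\<Sum>b\<in>Basis. (x \<bullet> b) * (x \<bullet> b))"
      using sum.reindex_bij_betw[OF \<beta>'] by fast
    also have "\<dots> = x \<bullet> x" by (subst euclidean_inner[of x x]) simp
    finally show ?thesis by (simp add: norm_eq_sqrt_inner)
  qed
  have inj: "inj T"
    using lin norm by (metis linear_injective_0 norm_eq_zero)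
  have surj: "surj T"
  proof
    show "UNIV \<subseteq> range T"
    proof
      fix y :: 'b
      define x where "x = (\<Sum>b\<in>Basis. (y \<bullet> \<beta> b) *\<^sub>R b)"
      have "T x = y"
      proof (rule euclidean_eqI)
        fix c :: 'b assume c: "c \<in> Basis"
        then have "\<beta>' c \<in> Basis" using \<beta>' by (auto simp: bij_betw_def)
        moreover have "\<beta> (\<beta>' c) = c" using c \<beta> by (simp add: \<beta>'_def bij_betw_inv_into_right)
        ultimately show "T x \<bullet> c = y \<bullet> c" using c
          by (simp add: comp' x_def inner_sum_left inner_Basis if_distrib cong: if_cong)
      qed
      then show "y \<in> range T" by blast
    qed
  qed auto
  have [measurable]: "T \<in> borel \<rightarrow>\<^sub>M borel"
    using lin by (intro borel_measurable_continuous_onI linear_continuous_on) (simp add: linear_conv_bounded_linear)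
  have "lborel = distr lborel borel T"
  proof (rule lborel_eqI)
    fix l u :: 'b assume le: "\<And>b. b \<in> Basis \<Longrightarrow> l \<bullet> b \<le> u \<bullet> b"
    obtain l' u' where l': "T l' = l" and u': "T u' = u" using surj by (metis surjD)
    have vim: "T -` box l u = box l' u'"
    proof -
      have "(\<forall>c\<in>Basis. l \<bullet> c < T x \<bullet> c \<and> T x \<bullet> c < u \<bullet> c) \<longleftrightarrow> (\<forall>c\<in>Basis. l' \<bullet> \<beta>' c < x \<bullet> \<beta>' c \<and> x \<bullet> \<beta>' c < u' \<bullet> \<beta>' c)" for x
        by (intro ball_cong refl) (simp add: comp' flip: l' u')
      also have "\<dots> x \<longleftrightarrow> (\<forall>b\<in>Basis. l' \<bullet> b < x \<bullet> b \<and> x \<bullet> b < u' \<bullet> b)" for x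
        unfolding bij_betw_imp_surj_on[OF \<beta>', symmetric] by simp
      finally show ?thesis by (auto simp: box_def)
    qed
    have le': "l' \<bullet> b \<le> u' \<bullet> b" if "b \<in> Basis" for b
      using le[of "\<beta> b"] comp[OF that, of l'] comp[OF that, of u'] bij_betw_apply[OF \<beta> that] l' u' by simp
    have "emeasure (distr lborel borel T) (box l u) = emeasure lborel (box l' u')"
      by (simp add: emeasure_distr vim)
    also have "\<dots> = (\<Prod>b\<in>Basis. (u' - l') \<bullet> b)"
      using le' by (simp add: emeasure_lborel_box_eq)
    also have "(\<Prod>b\<in>Basis. (u' - l') \<bullet> b) = (\<Prod>b\<in>Basis. (u - l) \<bullet> \<beta> b)"
      by (intro prod.cong refl) (simp add: inner_diff_left comp flip: l' u')
    also have "\<dots> = (\<Prod>b\<in>Basis. (u - l) \<bullet> b)"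
      using prod.reindex_bij_betw[OF \<beta>] by fast
    finally show "emeasure (distr lborel borel T) (box l u) = (\<Prod>b\<in>Basis. (u - l) \<bullet> b)" .
  qed simp
  then have "distr lborel borel T = lborel" by simp
  moreover have "bij T" using inj surj by (rule bijI)
  ultimately show ?thesis using lin norm by (intro exI[of _ T]) simp
qed

lemma measure_isometry_inverse:
  fixes T :: "'a::euclidean_space \<Rightarrow> 'b::euclidean_space"
  assumes "linear T" "bij T" "distr lborel borel T = lborel"
  shows "linear (inv T)" "bij (inv T)" "distr lborel borel (inv T) = lborel"
proof -
  show lin: "linear (inv T)"
  proof -
    obtain g where g: "linear g" "g \<circ> T = id"
      using linear_injective_left_inverse[OF assms(1)] assms(2) by (auto simp: bij_def)
    then have "g (T x) = x" for x by (metis comp_apply id_apply)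
    then have "g y = inv T y" for y
      using surj_f_inv_f[OF bij_is_surj[OF assms(2)], of y] by metis
    then have "g = inv T" by blast
    with g(1) show ?thesis by simp
  qed
  show "bij (inv T)" using assms(2) by (rule bij_imp_bij_inv)
  have [measurable]: "T \<in> borel \<rightarrow>\<^sub>M borel" "inv T \<in> borel \<rightarrow>\<^sub>M borel"
    using assms(1) lin
    by (auto intro!: borel_measurable_continuous_onI linear_continuous_on simp: linear_conv_bounded_linear)
  have "distr lborel borel (inv T) = distr (distr lborel borel T) borel (inv T)" by (simp add: assms(3))
  also have "\<dots> = distr lborel borel (inv T \<circ> T)" by (subst distr_distr) auto
  also have "inv T \<circ> T = id" using assms(2) by (simp add: bij_is_inj)
  finally show "distr lborel borel (inv T) = lborel" by (simp add: id_def distr_id2)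
qed

lemma complete_measure_lebesgue: "complete_measure lebesgue"
  by unfold_locales

text \<open>
  Null sets correspond to null sets, so the statement for Borel sets passes to the completion.
\<close>
lemma lebesgue_distr_isometry:
  fixes T :: "'a::euclidean_space \<Rightarrow> 'b::euclidean_space"
  assumes "linear T" "distr lborel borel T = lborel"
  shows "T \<in> lebesgue \<rightarrow>\<^sub>M lebesgue" "distr lebesgue lebesgue T = lebesgue"
proof -
  have m: "T \<in> borel \<rightarrow>\<^sub>M borel"
    using assms(1) by (intro borel_measurable_continuous_onI linear_continuous_on) (simp add: linear_conv_bounded_linear)
  then have m': "T \<in> lebesgue \<rightarrow>\<^sub>M lborel" by (simp add: measurable_completion)
  have d: "distr lebesgue lborel T = lborel"
    using assms(2) m by (subst distr_completion) (auto cong: distr_cong)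
  show "T \<in> lebesgue \<rightarrow>\<^sub>M lebesgue"
    using complete_measure.measurable_completion2[OF complete_measure_lebesgue m'] d by auto
  show "distr lebesgue lebesgue T = lebesgue"
    using complete_measure.completion_distr_eq[OF complete_measure_lebesgue m'] d by simp
qed

lemma integral_isometry:
  fixes T :: "'a::euclidean_space \<Rightarrow> 'b::euclidean_space" and h :: "'b \<Rightarrow> 'c::euclidean_space"
  assumes T: "linear T" "bij T" "distr lborel borel T = lborel"
  shows "(\<lambda>x. h (T x)) absolutely_integrable_on S \<longleftrightarrow> h absolutely_integrable_on (T ` S)"
    and "h absolutely_integrable_on (T ` S) \<Longrightarrow> integral S (\<lambda>x. h (T x)) = integral (T ` S) h"
proof -
  note T' = measure_isometry_inverse[OF T]
  note M = lebesgue_distr_isometry[OF T(1,3)] lebesgue_distr_isometry[OF T'(1,3)]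
  have [simp]: "inv T (T x) = x" "T (inv T y) = y" for x y
    using T(2) by (simp_all add: bij_is_inj bij_is_surj surj_f_inv_f)
  have ind: "indicator S x = (indicator (T ` S) (T x) :: real)" for x
    using T(2) by (auto simp: indicator_def bij_def inj_def)
  have ind': "indicator S (inv T y) = (indicator (T ` S) y :: real)" for y
    using ind[of "inv T y"] by simp
  show eq: "(\<lambda>x. h (T x)) absolutely_integrable_on S \<longleftrightarrow> h absolutely_integrable_on (T ` S)"
  proof
    assume "(\<lambda>x. h (T x)) absolutely_integrable_on S"
    then have "integrable (distr lebesgue lebesgue (inv T)) (\<lambda>x. indicator S x *\<^sub>R h (T x))"
      by (simp add: M set_integrable_def)
    from integrable_distr[OF M(3) this] show "h absolutely_integrable_on (T ` S)"
      by (simp add: set_integrable_def o_def ind')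
  next
    assume "h absolutely_integrable_on (T ` S)"
    then have "integrable (distr lebesgue lebesgue T) (\<lambda>x. indicator (T ` S) x *\<^sub>R h x)"
      by (simp add: M set_integrable_def)
    from integrable_distr[OF M(1) this] show "(\<lambda>x. h (T x)) absolutely_integrable_on S"
      by (simp add: set_integrable_def o_def ind)
  qed
  assume h: "h absolutely_integrable_on (T ` S)"
  then have h': "integrable lebesgue (\<lambda>x. indicator (T ` S) x *\<^sub>R h x)" by (simp add: set_integrable_def)
  have "integral (T ` S) h = integral\<^sup>L (distr lebesgue lebesgue T) (\<lambda>x. indicator (T ` S) x *\<^sub>R h x)"
    using h by (simp add: M set_lebesgue_integral_eq_integral(2)[symmetric] set_lebesgue_integral_def)
  also have "\<dots> = integral\<^sup>L lebesgue (\<lambda>x. indicator (T ` S) (T x) *\<^sub>R h (T x))"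
    using h' by (subst integral_distr[OF M(1)]) (auto dest: borel_measurable_integrable)
  also have "\<dots> = integral S (\<lambda>x. h (T x))"
    using h eq by (simp add: set_lebesgue_integral_eq_integral(2)[symmetric] set_lebesgue_integral_def ind)
  finally show "integral S (\<lambda>x. h (T x)) = integral (T ` S) h" ..
qed

text \<open>
  The index type \<open>'d bit0\<close> has twice as many elements as \<open>'d\<close> and is finite and well-ordered.
\<close>
definition realify :: "complex^'d::finite \<Rightarrow> real^('d bit0)" where
  "realify = (SOME T. linear T \<and> bij T \<and> (\<forall>x. norm (T x) = norm x) \<and> distr lborel borel T = lborel)"

lemma realify:
  "linear (realify :: complex^'d::finite \<Rightarrow> _)" "bij (realify :: complex^'d \<Rightarrow> _)"
  "norm (realify (x :: complex^'d)) = norm x" "distr lborel borel (realify :: complex^'d \<Rightarrow> _) = lborel"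
  using someI_ex[OF ex_measure_isometry[where ?'a="complex^'d" and ?'b="real^('d bit0)"]]
  by (auto simp: realify_def)

definition real_jacobian :: "complex^'d::finite^'d \<Rightarrow> real" where
  "real_jacobian A = \<bar>det (matrix (\<lambda>y. realify (A *v inv realify y)))\<bar>"

text \<open>
  The real change of variables theorem for the conjugate of \<open>g\<close> under \<open>realify\<close>. The values of \<open>f\<close>
  are transported by a second isometry, from the complex numbers to \<open>real ^ 2\<close>.
\<close>
theorem has_absolute_integral_change_of_variables_complex:
  fixes f :: "complex^'d::finite \<Rightarrow> complex" and g :: "complex^'d \<Rightarrow> complex^'d"
  assumes S: "S \<in> sets lebesgue"
    and der: "\<And>x. x \<in> S \<Longrightarrow> (g has_derivative (\<lambda>h. A x *v h)) (at x within S)"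
    and inj: "inj_on g S"
  shows "(\<lambda>x. real_jacobian (A x) *\<^sub>R f (g x)) absolutely_integrable_on S \<and>
           integral S (\<lambda>x. real_jacobian (A x) *\<^sub>R f (g x)) = b
     \<longleftrightarrow> f absolutely_integrable_on (g ` S) \<and> integral (g ` S) f = b"
proof -
  let ?T = "realify :: complex^'d \<Rightarrow> _" and ?T' = "inv realify :: _ \<Rightarrow> complex^'d"
  have T: "linear ?T" "bij ?T" "distr lborel borel ?T = lborel" by (rule realify)+
  note T' = measure_isometry_inverse[OF T]
  have [simp]: "?T' (?T x) = x" "?T (?T' y) = y" for x y
    using T(2) by (simp_all add: bij_is_inj bij_is_surj surj_f_inv_f)
  obtain L :: "complex \<Rightarrow> real^2" where L: "linear L" "bij L" "distr lborel borel L = lborel"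
    using ex_measure_isometry[where ?'a=complex and ?'b="real^2"] by auto
  have L': "linear (inv L)" using measure_isometry_inverse(1)[OF L] .
  have [simp]: "inv L (L x) = x" for x using L(2) by (simp add: bij_is_inj)
  have LL: "bounded_linear L" "bounded_linear (inv L)" using L(1) L' by (simp_all add: linear_conv_bounded_linear)
  have iff_L: "(L \<circ> u) absolutely_integrable_on X \<and> integral X (L \<circ> u) = L c \<longleftrightarrow> u absolutely_integrable_on X \<and> integral X u = c"
    for u :: "complex^'d \<Rightarrow> complex" and X c
  proof
    assume a: "(L \<circ> u) absolutely_integrable_on X \<and> integral X (L \<circ> u) = L c"
    then have "(inv L \<circ> (L \<circ> u)) absolutely_integrable_on X"
      using absolutely_integrable_linear[OF _ LL(2)] by blast
    moreover have "integral X (inv L \<circ> (L \<circ> u)) = inv L (integral X (L \<circ> u))"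
      using a by (intro integral_linear[OF _ LL(2)]) (auto simp: absolutely_integrable_on_def)
    moreover have "inv L \<circ> (L \<circ> u) = u" by (simp add: o_def)
    ultimately show "u absolutely_integrable_on X \<and> integral X u = c" using a by simp
  next
    assume a: "u absolutely_integrable_on X \<and> integral X u = c"
    moreover have "integral X (L \<circ> u) = L (integral X u)"
      using a by (intro integral_linear[OF _ LL(1)]) (auto simp: absolutely_integrable_on_def)
    ultimately show "(L \<circ> u) absolutely_integrable_on X \<and> integral X (L \<circ> u) = L c"
      using absolutely_integrable_linear[OF _ LL(1)] by auto
  qed
  define G where "G = (\<lambda>y. ?T (g (?T' y)))"
  define F where "F = (\<lambda>y. L (f (?T' y)))"
  define G' where "G' = (\<lambda>y k. ?T (A (?T' y) *v ?T' k))"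
  have bl: "bounded_linear ?T" "bounded_linear ?T'" using T T' by (simp_all add: linear_conv_bounded_linear)
  have S': "?T ` S \<in> sets lebesgue"
  proof -
    have "?T ` S = ?T' -` S \<inter> space lebesgue"
      using bij_vimage_eq_inv_image[OF T'(2), of S] inv_inv_eq[OF T(2)] by simp
    with measurable_sets[OF lebesgue_distr_isometry(1)[OF T'(1,3)] S] show ?thesis by simp
  qed
  have der': "(G has_derivative G' y) (at y within ?T ` S)" if y: "y \<in> ?T ` S" for y
  proof -
    from y obtain x where x: "x \<in> S" "y = ?T x" by auto
    have im: "?T' ` ?T ` S = S" by (simp add: image_comp o_def)
    have 1: "(?T' has_derivative ?T') (at y within ?T ` S)"
      using bl(2) by (rule bounded_linear_imp_has_derivative)
    have 2: "(g has_derivative (\<lambda>h. A (?T' y) *v h)) (at (?T' y) within ?T' ` ?T ` S)"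
      unfolding im using der[OF x(1)] x by simp
    have 3: "((\<lambda>y. g (?T' y)) has_derivative (\<lambda>k. A (?T' y) *v ?T' k)) (at y within ?T ` S)"
      using diff_chain_within[OF 1 2] by (simp add: o_def)
    from bounded_linear.has_derivative[OF bl(1) this] show ?thesis
      unfolding G_def G'_def .
  qed
  have injG: "inj_on G (?T ` S)"
  proof (rule inj_onI)
    fix a b assume "a \<in> ?T ` S" "b \<in> ?T ` S" "G a = G b"
    then obtain x y where xy: "x \<in> S" "y \<in> S" "a = ?T x" "b = ?T y" "?T (g x) = ?T (g y)"
      by (auto simp: G_def)
    then have "g x = g y" using injD[OF bij_is_inj[OF T(2)]] by blast
    with inj xy show "a = b" by (auto dest: inj_onD)
  qed
  have GT: "G ` ?T ` S = ?T ` g ` S" by (simp add: G_def image_image)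
  have jac: "real_jacobian (A (?T' y)) = \<bar>det (matrix (G' y))\<bar>" for y
    by (simp add: real_jacobian_def G'_def)
  define H where "H = (\<lambda>y. \<bar>det (matrix (G' y))\<bar> *\<^sub>R F (G y))"
  have LH: "L \<circ> (\<lambda>x. real_jacobian (A x) *\<^sub>R f (g x)) = (\<lambda>x. H (?T x))"
    using L(1) by (simp add: linear_cmul H_def F_def G_def o_def flip: jac)
  have "(\<lambda>x. real_jacobian (A x) *\<^sub>R f (g x)) absolutely_integrable_on S \<and>
           integral S (\<lambda>x. real_jacobian (A x) *\<^sub>R f (g x)) = b \<longleftrightarrow>
        (\<lambda>x. H (?T x)) absolutely_integrable_on S \<and> integral S (\<lambda>x. H (?T x)) = L b"
    using iff_L[where u="\<lambda>x. real_jacobian (A x) *\<^sub>R f (g x)" and X=S and c=b] unfolding LH by simp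
  also have "\<dots> \<longleftrightarrow> H absolutely_integrable_on ?T ` S \<and> integral (?T ` S) H = L b"
    using integral_isometry[OF T, where h=H and S=S] by auto
  also have "\<dots> \<longleftrightarrow> F absolutely_integrable_on (?T ` g ` S) \<and> integral (?T ` g ` S) F = L b"
    using has_absolute_integral_change_of_variables[OF S' der' injG, where f=F and b="L b"] by (simp add: GT H_def)
  also have "\<dots> \<longleftrightarrow> (L \<circ> f) absolutely_integrable_on (g ` S) \<and> integral (g ` S) (L \<circ> f) = L b"
    using integral_isometry[OF T, where h=F and S="g ` S"] by (auto simp: F_def o_def)
  also have "\<dots> \<longleftrightarrow> f absolutely_integrable_on (g ` S) \<and> integral (g ` S) f = b"
    by (rule iff_L)
  finally show ?thesis .
qed

definition realify_matrix :: "complex^'d::finite^'d \<Rightarrow> real^('d bit0)^('d bit0)" where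
  "realify_matrix A = matrix (\<lambda>y. realify (A *v inv realify y))"

lemma real_jacobian_eq: "real_jacobian A = \<bar>det (realify_matrix A)\<bar>"
  by (simp add: real_jacobian_def realify_matrix_def)

lemma linear_realify_inv: "linear (inv realify :: _ \<Rightarrow> complex^'d::finite)"
  using measure_isometry_inverse(1)[OF realify(1,2,4)] .

lemma inv_realify [simp]: "inv realify (realify x) = x" "realify (inv realify y) = y"
proof -
  show "inv realify (realify x) = x" using realify(2) by (rule inv_f_f[OF bij_is_inj])
  show "realify (inv realify y) = y" using realify(2) by (rule surj_f_inv_f[OF bij_is_surj])
qed

lemma linear_matrix_complex: "linear (\<lambda>x. (A :: complex^'n^'m) *v x)"
  by (rule linearI) (simp_all add: vec_eq_iff matrix_vector_mult_def scaleR_sum_right distrib_left sum.distrib)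

lemma linear_realify_conj: "linear (\<lambda>y. realify ((A :: complex^'d::finite^'d) *v inv realify y))"
  using linear_compose[OF linear_compose[OF linear_realify_inv linear_matrix_complex[of A]] realify(1)]
  by (simp add: o_def)

lemma realify_matrix_mult: "realify_matrix (A ** B) = realify_matrix A ** realify_matrix B"
proof -
  have "matrix ((\<lambda>y. realify (A *v inv realify y)) \<circ> (\<lambda>y. realify (B *v inv realify y))) = realify_matrix A ** realify_matrix B"
    unfolding realify_matrix_def by (rule matrix_compose) (rule linear_realify_conj)+
  then show ?thesis by (simp add: realify_matrix_def o_def matrix_vector_mul_assoc)
qed

lemma real_jacobian_mult: "real_jacobian (A ** B) = real_jacobian A * real_jacobian B"
  by (simp add: real_jacobian_eq realify_matrix_mult det_mul abs_mult)

lemma real_jacobian_isometry: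
  assumes "\<And>x. norm (A *v x) = norm x"
  shows "real_jacobian A = 1"
proof -
  have "orthogonal_transformation (\<lambda>y. realify (A *v inv realify y))"
    unfolding orthogonal_transformation using linear_realify_conj[of A]
    by (simp add: realify(3) assms) (metis inv_realify(2) realify(3))
  then have "orthogonal_matrix (realify_matrix A)"
    by (simp add: orthogonal_transformation_matrix realify_matrix_def)
  then show ?thesis using det_orthogonal_matrix by (fastforce simp: real_jacobian_eq)
qed

definition diag_matrix :: "('d \<Rightarrow> complex) \<Rightarrow> complex^'d^'d" where
  "diag_matrix a = (\<chi> i j. if i = j then a i else 0)"

lemma diag_matrix_mult_vector: "diag_matrix a *v x = (\<chi> i. a i * x $ i)"
  by (simp add: vec_eq_iff diag_matrix_def matrix_vector_mult_def if_distrib if_distribR cong: if_cong)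

lemma diag_matrix_mult_left: "diag_matrix a ** M = (\<chi> i j. a i * M $ i $ j)"
  by (simp add: vec_eq_iff diag_matrix_def matrix_matrix_mult_def if_distrib if_distribR cong: if_cong)

lemma diag_matrix_mult_right: "M ** diag_matrix a = (\<chi> i j. M $ i $ j * a j)"
  by (simp add: vec_eq_iff diag_matrix_def matrix_matrix_mult_def if_distrib if_distribR cong: if_cong)

lemma diag_matrix_mult: "diag_matrix a ** diag_matrix b = diag_matrix (\<lambda>i. a i * b i)"
  by (simp add: diag_matrix_mult_left) (simp add: vec_eq_iff diag_matrix_def)

lemma norm_vec_complex: "norm (x :: complex^'d) = sqrt (\<Sum>i\<in>UNIV. (cmod (x $ i))\<^sup>2)"
  by (simp add: norm_vec_def L2_set_def)

lemma real_jacobian_scalar: "real_jacobian (mat (of_real a) :: complex^'d::finite^'d) = \<bar>a\<bar> ^ (2 * CARD('d))"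
proof -
  have "(mat (of_real a) :: complex^'d^'d) *v x = a *\<^sub>R x" for x
  proof -
    have "mat (of_real a) = (diag_matrix (\<lambda>_. of_real a) :: complex^'d^'d)"
      by (simp add: mat_def diag_matrix_def)
    moreover have "a *\<^sub>R x = (\<chi> i. of_real a * x $ i)"
    proof (rule vec_eq_iff[THEN iffD2], rule allI)
      fix i
      have "(a *\<^sub>R x) $ i = a *\<^sub>R (x $ i)" by (rule vector_scaleR_component)
      also have "\<dots> = of_real a * x $ i" by (rule scaleR_conv_of_real)
      finally show "(a *\<^sub>R x) $ i = (\<chi> i. of_real a * x $ i) $ i" by (simp only: vec_lambda_beta)
    qed
    ultimately show ?thesis by (simp add: diag_matrix_mult_vector)
  qed
  then have "realify_matrix (mat (of_real a) :: complex^'d^'d) = matrix (\<lambda>y. a *\<^sub>R y)"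
    by (simp add: realify_matrix_def linear_cmul[OF realify(1)])
  then have "real_jacobian (mat (of_real a) :: complex^'d^'d) = \<bar>det (matrix (\<lambda>y :: real^'d bit0. a *\<^sub>R y))\<bar>"
    by (simp add: real_jacobian_eq)
  also have "det (matrix (\<lambda>y :: real^'d bit0. a *\<^sub>R y)) = a ^ (2 * CARD('d))"
    by (subst det_diagonal) (auto simp: matrix_def axis_def)
  finally show ?thesis by (simp add: power_abs)
qed

definition permutation_matrix :: "('d \<Rightarrow> 'd) \<Rightarrow> complex^'d^'d" where
  "permutation_matrix p = (\<chi> i j. if j = p i then 1 else 0)"

lemma permutation_matrix_mult_vector: "permutation_matrix p *v x = (\<chi> i. x $ p i)"
  by (simp add: vec_eq_iff permutation_matrix_def matrix_vector_mult_def if_distrib if_distribR cong: if_cong)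

lemma real_jacobian_permutation:
  fixes p :: "'d::finite \<Rightarrow> 'd"
  assumes "bij p" shows "real_jacobian (permutation_matrix p) = 1"
proof (rule real_jacobian_isometry)
  fix x :: "complex^'d"
  show "norm (permutation_matrix p *v x) = norm x"
    using sum.reindex_bij_betw[OF assms, of "\<lambda>i. (cmod (x $ i))\<^sup>2"]
    by (simp add: norm_vec_complex permutation_matrix_mult_vector)
qed

text \<open>
  By multiplicativity it suffices to scale one coordinate by \<open>c\<close>. A number of modulus one is an isometry.
  For \<open>c \<ge> 0\<close> all coordinates give the same factor, because transpositions are isometries, and the
  \<open>d\<close>-th power of this factor belongs to the scalar matrix \<open>c\<close>, a real scaling in dimension \<open>2 d\<close>.
\<close>
lemma real_jacobian_diag:
  fixes a :: "'d::finite \<Rightarrow> complex"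
  shows "real_jacobian (diag_matrix a) = (\<Prod>i\<in>UNIV. (cmod (a i))\<^sup>2)"
proof -
  define D :: "'d \<Rightarrow> complex \<Rightarrow> complex^'d^'d" where "D = (\<lambda>i c. diag_matrix (\<lambda>r. if r = i then c else 1))"
  have prod: "real_jacobian (diag_matrix (\<lambda>r. if r \<in> I then b r else 1)) = (\<Prod>i\<in>I. real_jacobian (D i (b i)))"
    if "finite I" for I b
    using that
  proof induction
    case empty
    show ?case by (simp add: real_jacobian_isometry diag_matrix_mult_vector)
  next
    case (insert i I)
    have "diag_matrix (\<lambda>r. if r \<in> insert i I then b r else 1) = D i (b i) ** diag_matrix (\<lambda>r. if r \<in> I then b r else 1)"
      using insert.hyps unfolding D_def diag_matrix_mult by (intro arg_cong[where f=diag_matrix]) auto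
    with insert show ?case by (simp add: real_jacobian_mult)
  qed
  have swap: "real_jacobian (D i c) = real_jacobian (D j c)" for i j c
  proof -
    define p where "p = Transposition.transpose i j"
    have "bij p" by (simp add: p_def)
    have "D i c ** permutation_matrix p = permutation_matrix p ** D j c"
      unfolding D_def diag_matrix_mult_left diag_matrix_mult_right
      by (auto simp: vec_eq_iff permutation_matrix_def p_def Transposition.transpose_def)
    then have "real_jacobian (D i c) * real_jacobian (permutation_matrix p) = real_jacobian (permutation_matrix p) * real_jacobian (D j c)"
      by (metis real_jacobian_mult)
    then show ?thesis by (simp add: real_jacobian_permutation[OF \<open>bij p\<close>])
  qed
  have nonneg: "real_jacobian M \<ge> 0" for M :: "complex^'d^'d" by (simp add: real_jacobian_eq)
  have pos: "real_jacobian (D i (of_real c)) = c\<^sup>2" if "c \<ge> 0" for i c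
  proof -
    have "real_jacobian (D i (of_real c)) ^ CARD('d) = (\<Prod>j\<in>(UNIV :: 'd set). real_jacobian (D j (of_real c)))"
      using swap by (metis (no_types, lifting) prod.cong prod_constant)
    also have "\<dots> = real_jacobian (diag_matrix (\<lambda>r :: 'd. of_real c))"
      using prod[of UNIV "\<lambda>_. of_real c"] by simp
    also have "diag_matrix (\<lambda>r :: 'd. of_real c) = mat (of_real c)"
      by (simp add: diag_matrix_def mat_def)
    finally have "real_jacobian (D i (of_real c)) ^ CARD('d) = (c\<^sup>2) ^ CARD('d)"
      using that by (simp add: real_jacobian_scalar power_mult)
    then show ?thesis using nonneg by (simp add: power_eq_iff_eq_base)
  qed
  have unit: "real_jacobian (D i c) = 1" if "cmod c = 1" for i c
    by (rule real_jacobian_isometry)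
      (use that in \<open>auto simp: D_def diag_matrix_mult_vector norm_vec_complex norm_mult if_distrib if_distribR intro!: sum.cong\<close>)
  have "real_jacobian (D i c) = (cmod c)\<^sup>2" for i c
  proof -
    define u where "u = (if c = 0 then 1 else sgn c)"
    have "cmod u = 1" "of_real (cmod c) * u = c"
      by (simp_all add: u_def norm_sgn) (simp add: sgn_div_norm scaleR_conv_of_real)
    then have "D i c = D i (of_real (cmod c)) ** D i u"
      unfolding D_def diag_matrix_mult by (intro arg_cong[where f=diag_matrix]) auto
    then show ?thesis using unit[OF \<open>cmod u = 1\<close>] pos[of "cmod c"] by (simp add: real_jacobian_mult)
  qed
  with prod[of UNIV a] show ?thesis by simp
qed

lemma continuous_on_det: "continuous_on UNIV (\<lambda>x. det (F x :: real^'m^'m))" if "\<And>i j. continuous_on UNIV (\<lambda>x. F x $ i $ j)"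
  unfolding det_def by (intro continuous_intros that)

text \<open>
  Conjugation with the diagonal matrix of the powers \<open>s ^ r i\<close> leaves the Jacobian unchanged and
  multiplies the entry \<open>(i, j)\<close> by \<open>s ^ (r i - r j)\<close>. As \<open>s\<close> tends to 0, the conjugates tend to the
  identity matrix. The rank function \<open>r\<close> covers lower and upper triangular matrices at once.
\<close>
lemma real_jacobian_unitriangular:
  fixes L :: "complex^'d::finite^'d" and r :: "'d \<Rightarrow> nat"
  assumes tri: "\<And>i j. i \<noteq> j \<Longrightarrow> r i \<le> r j \<Longrightarrow> L $ i $ j = 0" and diag: "\<And>i. L $ i $ i = 1"
  shows "real_jacobian L = 1"
proof -
  define Ls :: "real \<Rightarrow> complex^'d^'d" where "Ls = (\<lambda>s. \<chi> i j. of_real s ^ (r i - r j) * L $ i $ j)"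
  have const: "real_jacobian (Ls s) = real_jacobian L" if "s > 0" for s
  proof -
    define D where "D = diag_matrix (\<lambda>i :: 'd. of_real s ^ r i)"
    have entry: "of_real s ^ r i * L $ i $ j = of_real s ^ (r i - r j) * L $ i $ j * of_real s ^ r j" for i j
      proof (cases "r j \<le> r i")
        case True
        then have "complex_of_real s ^ r i = of_real s ^ (r i - r j) * of_real s ^ r j"
          by (simp flip: power_add)
        then show ?thesis by simp
      next
        case False
        then have "i \<noteq> j" by auto
        with False show ?thesis by (simp add: tri)
      qed
    have "D ** L = Ls s ** D"
      unfolding D_def diag_matrix_mult_left diag_matrix_mult_right Ls_def
      unfolding vec_eq_iff vec_lambda_beta using entry by blast
    then have "real_jacobian D * real_jacobian L = real_jacobian (Ls s) * real_jacobian D"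
      by (metis real_jacobian_mult)
    moreover have "real_jacobian D \<noteq> 0" using that by (simp add: D_def real_jacobian_diag norm_power)
    ultimately show ?thesis by simp
  qed
  have "Ls 0 = mat 1"
  proof -
    have "Ls 0 $ i $ j = mat 1 $ i $ j" for i j
    proof (cases "i = j")
      case True
      then show ?thesis by (simp add: Ls_def mat_def diag)
    next
      case False
      then show ?thesis using tri[of i j] by (cases "r i \<le> r j") (simp_all add: Ls_def mat_def)
    qed
    then show ?thesis by (simp add: vec_eq_iff)
  qed
  then have zero: "real_jacobian (Ls 0) = 1" by (simp add: real_jacobian_isometry)
  have entry: "continuous_on UNIV (\<lambda>s. realify_matrix (Ls s) $ i $ j)" for i j :: "'d bit0"
  proof -
    have "continuous_on UNIV (\<lambda>s. realify (Ls s *v inv realify (axis j 1)) $ i)"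
    proof (intro continuous_intros)
      have c: "continuous_on UNIV (\<lambda>s. Ls s *v inv realify (axis j 1))"
        unfolding continuous_on_vec_lambda matrix_vector_mult_def Ls_def
        by (auto intro!: continuous_intros)
      show "continuous_on UNIV (\<lambda>s. realify (Ls s *v inv realify (axis j 1)))"
        using realify(1) c linear_continuous_on_compose by blast
    qed
    then show "continuous_on UNIV (\<lambda>s. realify_matrix (Ls s) $ i $ j)"
      by (simp add: realify_matrix_def matrix_def)
  qed
  have "continuous_on UNIV (\<lambda>s. real_jacobian (Ls s))"
    unfolding real_jacobian_eq by (intro continuous_on_rabs continuous_on_det entry)
  then have "((\<lambda>s. real_jacobian (Ls s)) \<longlongrightarrow> real_jacobian (Ls 0)) (at_right 0)"
    by (simp add: continuous_on_def filterlim_at_split)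
  moreover have "\<forall>\<^sub>F s in at_right 0. real_jacobian (Ls s) = real_jacobian L"
    using const by (auto simp: eventually_at_right_field intro!: exI[of _ 1])
  ultimately have "((\<lambda>s::real. real_jacobian L) \<longlongrightarrow> 1) (at_right 0)"
    unfolding zero by (rule Lim_transform_eventually)
  then show ?thesis by (simp add: tendsto_const_iff)
qed

lemma real_jacobian_triangular:
  fixes L :: "complex^'d::finite^'d" and r :: "'d \<Rightarrow> nat"
  assumes tri: "\<And>i j. i \<noteq> j \<Longrightarrow> r i \<le> r j \<Longrightarrow> L $ i $ j = 0" and diag: "\<And>i. L $ i $ i \<noteq> 0"
  shows "real_jacobian L = (\<Prod>i\<in>UNIV. (cmod (L $ i $ i))\<^sup>2)"
proof -
  define M where "M = (\<chi> i j. L $ i $ j / L $ j $ j)"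
  have "L = M ** diag_matrix (\<lambda>i. L $ i $ i)"
    using diag by (simp add: diag_matrix_mult_right M_def vec_eq_iff)
  moreover have "real_jacobian M = 1"
    by (rule real_jacobian_unitriangular[where r=r]) (auto simp: M_def tri diag)
  ultimately show ?thesis
    by (metis real_jacobian_mult real_jacobian_diag mult_1)
qed

section \<open>Complex differentiability in several variables\<close>

definition complex_linear_deriv :: "(complex^'n \<Rightarrow> complex) \<Rightarrow> complex^'n \<Rightarrow> bool" where
  "complex_linear_deriv f z \<longleftrightarrow> (\<exists>a. (f has_derivative (\<lambda>h. \<Sum>i\<in>UNIV. a $ i * h $ i)) (at z))"

lemma holomorphic_cn_on_iff: "holomorphic_cn_on f \<Omega> \<longleftrightarrow> (\<forall>z\<in>\<Omega>. complex_linear_deriv f z)"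
  by (simp add: holomorphic_cn_on_def complex_linear_deriv_def)

lemma complex_linear_derivI:
  assumes "(f has_derivative (\<lambda>h. \<Sum>i\<in>UNIV. a i * h $ i)) (at z)"
  shows "complex_linear_deriv f z"
  using assms unfolding complex_linear_deriv_def by (intro exI[of _ "\<chi> i. a i"]) simp

lemma complex_linear_derivE:
  assumes "complex_linear_deriv f z"
  obtains a where "(f has_derivative (\<lambda>h. \<Sum>i\<in>UNIV. a i * h $ i)) (at z)"
proof -
  from assms obtain a where "(f has_derivative (\<lambda>h. \<Sum>i\<in>UNIV. a $ i * h $ i)) (at z)"
    unfolding complex_linear_deriv_def by blast
  then show ?thesis by (rule that)
qed

lemma complex_linear_deriv_const: "complex_linear_deriv (\<lambda>_. c) z"
  by (rule complex_linear_derivI[where a="\<lambda>_. 0"]) simp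

lemma complex_linear_deriv_component: "complex_linear_deriv (\<lambda>z. z $ k) z"
proof (rule complex_linear_derivI[where a="\<lambda>i. if i = k then 1 else 0"])
  have "((\<lambda>z :: complex^'a. z $ k) has_derivative (\<lambda>h. h $ k)) (at z)"
    by (rule bounded_linear_imp_has_derivative) (rule bounded_linear_vec_nth)
  moreover have "(\<lambda>h :: complex^'a. h $ k) = (\<lambda>h. \<Sum>i\<in>UNIV. (if i = k then 1 else 0) * h $ i)"
    by (simp add: if_distrib if_distribR cong: if_cong)
  ultimately show "((\<lambda>z :: complex^'a. z $ k) has_derivative (\<lambda>h. \<Sum>i\<in>UNIV. (if i = k then 1 else 0) * h $ i)) (at z)"
    by simp
qed

lemma complex_linear_deriv_add:
  assumes "complex_linear_deriv f z" "complex_linear_deriv g z"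
  shows "complex_linear_deriv (\<lambda>z. f z + g z) z"
proof -
  obtain a where a: "(f has_derivative (\<lambda>h. \<Sum>i\<in>UNIV. a i * h $ i)) (at z)"
    using assms(1) by (rule complex_linear_derivE)
  obtain b where b: "(g has_derivative (\<lambda>h. \<Sum>i\<in>UNIV. b i * h $ i)) (at z)"
    using assms(2) by (rule complex_linear_derivE)
  from has_derivative_add[OF a b] show ?thesis
    by (intro complex_linear_derivI[where a="\<lambda>i. a i + b i"]) (simp add: distrib_right sum.distrib)
qed

lemma complex_linear_deriv_mult:
  assumes "complex_linear_deriv f z" "complex_linear_deriv g z"
  shows "complex_linear_deriv (\<lambda>z. f z * g z) z"
proof -
  obtain a where a: "(f has_derivative (\<lambda>h. \<Sum>i\<in>UNIV. a i * h $ i)) (at z)"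
    using assms(1) by (rule complex_linear_derivE)
  obtain b where b: "(g has_derivative (\<lambda>h. \<Sum>i\<in>UNIV. b i * h $ i)) (at z)"
    using assms(2) by (rule complex_linear_derivE)
  have "(\<lambda>h. f z * (\<Sum>i\<in>UNIV. b i * h $ i) + (\<Sum>i\<in>UNIV. a i * h $ i) * g z)
      = (\<lambda>h. \<Sum>i\<in>UNIV. (f z * b i + a i * g z) * h $ i)"
    by (simp add: fun_eq_iff sum_distrib_left sum_distrib_right flip: sum.distrib) (simp add: algebra_simps)
  with has_derivative_mult[OF a b] show ?thesis
    by (intro complex_linear_derivI[where a="\<lambda>i. f z * b i + a i * g z"]) simp
qed

lemma complex_linear_deriv_sum:
  "(\<And>i. i \<in> I \<Longrightarrow> complex_linear_deriv (f i) z) \<Longrightarrow> complex_linear_deriv (\<lambda>z. \<Sum>i\<in>I. f i z) z"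
  by (induction I rule: infinite_finite_induct) (simp_all add: complex_linear_deriv_const complex_linear_deriv_add)

lemma complex_linear_deriv_prod:
  "(\<And>i. i \<in> I \<Longrightarrow> complex_linear_deriv (f i) z) \<Longrightarrow> complex_linear_deriv (\<lambda>z. \<Prod>i\<in>I. f i z) z"
  by (induction I rule: infinite_finite_induct) (simp_all add: complex_linear_deriv_const complex_linear_deriv_mult)

lemma complex_linear_deriv_det:
  "(\<And>i j. complex_linear_deriv (\<lambda>z. M z $ i $ j) z) \<Longrightarrow> complex_linear_deriv (\<lambda>z. det (M z)) z"
  unfolding det_def
  by (intro complex_linear_deriv_sum complex_linear_deriv_mult complex_linear_deriv_const complex_linear_deriv_prod)

lemma has_derivative_vector_components:
  fixes F :: "complex^'n \<Rightarrow> complex^'m"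
  assumes "\<And>k. ((\<lambda>z. F z $ k) has_derivative (\<lambda>h. F' h $ k)) (at z)"
  shows "(F has_derivative F') (at z)"
proof -
  have "((\<lambda>z. F z \<bullet> b) has_derivative (\<lambda>h. F' h \<bullet> b)) (at z)" if "b \<in> Basis" for b
  proof -
    from that obtain k u where b: "b = axis k u" by (auto simp: Basis_vec_def)
    have "((\<lambda>z. F z $ k \<bullet> u) has_derivative (\<lambda>h. F' h $ k \<bullet> u)) (at z)"
      using assms[of k] by (rule has_derivative_inner_left)
    then show ?thesis by (simp add: b inner_axis)
  qed
  then show ?thesis using has_derivative_componentwise_within[of F F' z UNIV] by auto
qed

lemma complex_linear_deriv_matrix:
  fixes F :: "complex^'n \<Rightarrow> complex^'m"
  assumes "\<And>k. complex_linear_deriv (\<lambda>z. F z $ k) z"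
  obtains A where "(F has_derivative (\<lambda>h. A *v h)) (at z)"
proof -
  have "\<forall>k. \<exists>a. ((\<lambda>z. F z $ k) has_derivative (\<lambda>h. \<Sum>i\<in>UNIV. a $ i * h $ i)) (at z)"
    using assms unfolding complex_linear_deriv_def by blast
  from choice[OF this] obtain a
    where a: "\<And>k. ((\<lambda>z. F z $ k) has_derivative (\<lambda>h. \<Sum>i\<in>UNIV. a k $ i * h $ i)) (at z)"
    by blast
  show ?thesis
    by (rule that[of "\<chi> k i. a k $ i"], rule has_derivative_vector_components) (use a in \<open>simp add: matrix_vector_mult_def\<close>)
qed

lemma complex_linear_deriv_compose:
  fixes F :: "complex^'n \<Rightarrow> complex^'m"
  assumes "(F has_derivative (\<lambda>h. A *v h)) (at z)" "complex_linear_deriv f (F z)"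
  shows "complex_linear_deriv (\<lambda>z. f (F z)) z"
proof -
  obtain a where a: "(f has_derivative (\<lambda>h. \<Sum>i\<in>UNIV. a i * h $ i)) (at (F z))"
    using assms(2) by (rule complex_linear_derivE)
  from diff_chain_at[OF assms(1) a] have "((\<lambda>z. f (F z)) has_derivative (\<lambda>h. \<Sum>i\<in>UNIV. a i * (A *v h) $ i)) (at z)"
    by (simp add: o_def)
  moreover have "(\<lambda>h. \<Sum>i\<in>UNIV. a i * (A *v h) $ i) = (\<lambda>h. \<Sum>j\<in>UNIV. (\<Sum>i\<in>UNIV. a i * A $ i $ j) * h $ j)"
    unfolding matrix_vector_mult_def by (simp add: sum_distrib_left sum_distrib_right mult.assoc, rule ext, rule sum.swap)
  ultimately show ?thesis by (intro complex_linear_derivI) simp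
qed

lemma complex_linear_deriv_field:
  assumes "complex_linear_deriv f z" "(g has_field_derivative D) (at (f z))"
  shows "complex_linear_deriv (\<lambda>z. g (f z)) z"
proof -
  obtain a where a: "(f has_derivative (\<lambda>h. \<Sum>i\<in>UNIV. a i * h $ i)) (at z)"
    using assms(1) by (rule complex_linear_derivE)
  from diff_chain_at[OF a has_field_derivative_imp_has_derivative[OF assms(2)]] show ?thesis
    by (intro complex_linear_derivI[where a="\<lambda>i. D * a i"]) (simp add: o_def sum_distrib_left mult.assoc)
qed

lemma holomorphic_cn_on_imp_continuous_on: "holomorphic_cn_on f \<Omega> \<Longrightarrow> continuous_on \<Omega> f"
  unfolding holomorphic_cn_on_def
  by (intro continuous_at_imp_continuous_on ballI) (auto dest: has_derivative_continuous)

section \<open>Elementary symmetric polynomials and the Vandermonde determinant\<close>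

lemma index_rank_le_iff: "index_rank i \<le> index_rank j \<longleftrightarrow> i \<le> (j :: 'd::{finite,wellorder})"
proof
  assume "index_rank i \<le> index_rank j"
  show "i \<le> j"
  proof (rule ccontr)
    assume "\<not> i \<le> j"
    then have "{k. k \<le> j} \<subseteq> {k. k \<le> i}" "i \<in> {k. k \<le> i} - {k. k \<le> j}" by auto
    then have "{k. k \<le> j} \<subset> {k. k \<le> i}" by blast
    then have "index_rank j < index_rank i" unfolding index_rank_def by (intro psubset_card_mono) auto
    with \<open>index_rank i \<le> index_rank j\<close> show False by simp
  qed
next
  assume "i \<le> j"
  then show "index_rank i \<le> index_rank j" unfolding index_rank_def by (intro card_mono) auto
qed

lemma index_rank_less_iff: "index_rank i < index_rank j \<longleftrightarrow> i < (j :: 'd::{finite,wellorder})"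
  using index_rank_le_iff[of j i] by (simp add: not_le[symmetric])

lemma index_rank_eq_iff [simp]: "index_rank i = index_rank j \<longleftrightarrow> i = (j :: 'd::{finite,wellorder})"
  using index_rank_le_iff[of i j] index_rank_le_iff[of j i] by force

lemma index_rank_bounds: "1 \<le> index_rank (i :: 'd::{finite,wellorder})" "index_rank i \<le> CARD('d)"
proof -
  have "i \<in> {k. k \<le> i}" by simp
  then show "1 \<le> index_rank i" unfolding index_rank_def
    by (metis One_nat_def Suc_leI card_gt_0_iff empty_iff finite_code)
  show "index_rank i \<le> CARD('d)" unfolding index_rank_def by (intro card_mono) auto
qed

lemma bij_betw_index_rank: "bij_betw index_rank (UNIV :: 'd::{finite,wellorder} set) {1..CARD('d)}"
proof -
  have "inj (index_rank :: 'd \<Rightarrow> nat)" by (auto simp: inj_on_def)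
  moreover have "range (index_rank :: 'd \<Rightarrow> nat) = {1..CARD('d)}"
  proof (rule card_subset_eq)
    show "range (index_rank :: 'd \<Rightarrow> nat) \<subseteq> {1..CARD('d)}" using index_rank_bounds by fastforce
    show "card (range (index_rank :: 'd \<Rightarrow> nat)) = card {1..CARD('d)}"
      using \<open>inj (index_rank :: 'd \<Rightarrow> nat)\<close> by (simp add: card_image)
  qed simp
  ultimately show ?thesis by (simp add: bij_betw_def)
qed

text \<open>
  The signs make the coordinates of \<open>symmetrization z\<close> the coefficients of the polynomial with roots
  \<open>z_i\<close>, and the basis is ordered by decreasing degree.
\<close>
definition signed_power :: "'d::{finite,wellorder} \<Rightarrow> complex \<Rightarrow> complex" where
  "signed_power k t = (-1) ^ index_rank k * t ^ (CARD('d) - index_rank k)"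

definition root_poly :: "complex^'d::{finite,wellorder} \<Rightarrow> complex \<Rightarrow> complex" where
  "root_poly u t = t ^ CARD('d) + (\<Sum>k\<in>UNIV. u $ k * signed_power k t)"

text \<open>
  Vieta: expand the product over subsets of the index set and collect the subsets of equal size.
\<close>
lemma root_poly_symmetrization:
  fixes z :: "complex^'d::{finite,wellorder}"
  shows "root_poly (symmetrization z) t = (\<Prod>i\<in>UNIV. t - z $ i)"
proof -
  define T where "T = (\<lambda>n. (-1) ^ n * t ^ (CARD('d) - n) * elem_sym n z)"
  have "(\<Prod>i\<in>UNIV. t - z $ i) = (\<Prod>i\<in>UNIV. - (z $ i) + t)" by simp
  also have "\<dots> = (\<Sum>X\<in>Pow UNIV. (\<Prod>i\<in>X. - (z $ i)) * (\<Prod>i\<in>UNIV - X. t))"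
    by (rule prod_add) simp
  also have "\<dots> = (\<Sum>X\<in>UNIV. (-1) ^ card X * t ^ (CARD('d) - card X) * (\<Prod>i\<in>X. z $ i))"
    by (intro sum.cong) (simp_all add: prod_uminus card_Diff_subset mult_ac)
  also have "\<dots> = (\<Sum>n\<in>{0..CARD('d)}. \<Sum>X\<in>{X. X \<in> UNIV \<and> card X = n}. (-1) ^ card X * t ^ (CARD('d) - card X) * (\<Prod>i\<in>X. z $ i))"
    by (rule sum.group[symmetric]) (auto simp: card_mono)
  also have "\<dots> = (\<Sum>n\<in>{0..CARD('d)}. T n)"
    unfolding T_def elem_sym_def by (auto simp: sum_distrib_left intro!: sum.cong)
  also have "\<dots> = T 0 + (\<Sum>n\<in>{1..CARD('d)}. T n)"
    by (simp add: sum.atLeast_Suc_atMost)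
  also have "(\<Sum>n\<in>{1..CARD('d)}. T n) = (\<Sum>k\<in>(UNIV :: 'd set). T (index_rank k))"
    using sum.reindex_bij_betw[OF bij_betw_index_rank[where 'd='d], of T] by simp
  also have "T 0 = t ^ CARD('d)"
  proof -
    have "{I :: 'd set. card I = 0} = {{}}" by auto
    then show ?thesis by (simp add: T_def elem_sym_def)
  qed
  finally show ?thesis
    by (simp add: root_poly_def symmetrization_def T_def signed_power_def mult_ac)
qed

definition vandermonde_matrix :: "complex^'d::{finite,wellorder} \<Rightarrow> complex^'d::{finite,wellorder}^'d::{finite,wellorder}" where
  "vandermonde_matrix z = (\<chi> i k. signed_power k (z $ i))"

definition vandermonde :: "complex^'d::{finite,wellorder} \<Rightarrow> complex" where
  "vandermonde z = det (vandermonde_matrix z)"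

lemma card_greater: "card {l :: 'd::{finite,wellorder}. k < l} = CARD('d) - index_rank k"
proof -
  have "{l :: 'd. k < l} = UNIV - {l. l \<le> k}" by auto
  then show ?thesis by (simp add: card_Diff_subset index_rank_def)
qed

text \<open>
  Column operations replace the signed powers by the Newton basis, whose \<open>k\<close>-th element vanishes at
  \<open>z_l\<close> for all \<open>l > k\<close>. The resulting matrix is triangular, so both its determinant and its real
  Jacobian can be read off.
\<close>
lemma vandermonde_newton:
  fixes z :: "complex^'d::{finite,wellorder}"
  obtains U :: "complex^'d::{finite,wellorder}^'d::{finite,wellorder}" where
    "\<And>i j. i < j \<Longrightarrow> U $ i $ j = 0" "\<And>i. U $ i $ i = 1"
    "vandermonde_matrix z ** U = (\<chi> i k. (-1) ^ index_rank k * (\<Prod>l\<in>{l. k < l}. z $ i - z $ l))"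
proof
  define P where "P = (\<lambda>k :: 'd. \<Prod>l\<in>{l. k < l}. [:- (z $ l), 1:])"
  define d where "d = CARD('d)"
  define U :: "complex^'d::{finite,wellorder}^'d::{finite,wellorder}" where
    "U = (\<chi> m k. (-1) ^ (index_rank m + index_rank k) * coeff (P k) (d - index_rank m))"
  have deg: "degree (P k) = d - index_rank k" for k
    unfolding P_def d_def card_greater[symmetric] by (subst degree_prod_eq_sum_degree) auto
  have lead: "lead_coeff (P k) = 1" for k
    unfolding P_def by (simp add: lead_coeff_prod)
  show "U $ i $ j = 0" if "i < j" for i j
  proof -
    have "index_rank i < index_rank j" "index_rank j \<le> d"
      using that index_rank_bounds by (auto simp: index_rank_less_iff d_def)
    then have "degree (P j) < d - index_rank i" unfolding deg by linarith
    then show ?thesis by (simp add: U_def coeff_eq_0)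
  qed
  show "U $ i $ i = 1" for i
    using lead[of i] by (simp add: U_def deg)
  have "(\<Sum>m\<in>UNIV. signed_power m t * U $ m $ k) = (-1) ^ index_rank k * (\<Prod>l\<in>{l. k < l}. t - z $ l)" for t k
  proof -
    have lt: "degree (P k) < d" unfolding deg using index_rank_bounds[of k] by (simp add: d_def)
    have "(\<Sum>m\<in>UNIV. signed_power m t * U $ m $ k) = (\<Sum>m\<in>(UNIV :: 'd set). (-1) ^ index_rank k * (coeff (P k) (d - index_rank m) * t ^ (d - index_rank m)))"
      by (intro sum.cong refl) (simp add: U_def signed_power_def d_def power_add mult_ac flip: power_mult_distrib)
    also have "\<dots> = (-1) ^ index_rank k * (\<Sum>m\<in>(UNIV :: 'd set). coeff (P k) (d - index_rank m) * t ^ (d - index_rank m))"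
      by (simp add: sum_distrib_left)
    also have "(\<Sum>m\<in>(UNIV :: 'd set). coeff (P k) (d - index_rank m) * t ^ (d - index_rank m)) = (\<Sum>n\<in>{1..d}. coeff (P k) (d - n) * t ^ (d - n))"
      using sum.reindex_bij_betw[OF bij_betw_index_rank[where 'd='d], of "\<lambda>n. coeff (P k) (d - n) * t ^ (d - n)"] by (simp add: d_def)
    also have "\<dots> = (\<Sum>n<d. coeff (P k) n * t ^ n)"
      by (rule sum.reindex_bij_witness[where i="\<lambda>n. d - n" and j="\<lambda>n. d - n"]) auto
    also have "\<dots> = (\<Sum>n\<le>degree (P k). coeff (P k) n * t ^ n)"
      using lt by (intro sum.mono_neutral_right) (auto simp: coeff_eq_0)
    also have "\<dots> = poly (P k) t" by (simp add: poly_altdef)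
    also have "\<dots> = (\<Prod>l\<in>{l. k < l}. t - z $ l)" by (simp add: P_def poly_prod)
    finally show ?thesis .
  qed
  then show "vandermonde_matrix z ** U = (\<chi> i k. (-1) ^ index_rank k * (\<Prod>l\<in>{l. k < l}. z $ i - z $ l))"
    by (simp add: matrix_matrix_mult_def vandermonde_matrix_def)
qed

lemma vandermonde_eq:
  fixes z :: "complex^'d::{finite,wellorder}"
  shows "vandermonde z = (\<Prod>k\<in>(UNIV :: 'd set). (-1) ^ index_rank k) * (\<Prod>k\<in>UNIV. \<Prod>l\<in>{l. k < l}. z $ k - z $ l)"
proof -
  obtain U :: "complex^'d::{finite,wellorder}^'d::{finite,wellorder}" where
    U: "\<And>i j. i < j \<Longrightarrow> U $ i $ j = 0" "\<And>i. U $ i $ i = 1"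
    "vandermonde_matrix z ** U = (\<chi> i k. (-1) ^ index_rank k * (\<Prod>l\<in>{l. k < l}. z $ i - z $ l))"
    using vandermonde_newton[of z] by blast
  have "vandermonde z = det (vandermonde_matrix z ** U)"
    using det_lowerdiagonal[OF U(1)] by (simp add: vandermonde_def det_mul U(2))
  also have "\<dots> = (\<Prod>k\<in>UNIV. (-1) ^ index_rank k * (\<Prod>l\<in>{l. k < l}. z $ k - z $ l))"
    unfolding U(3) by (subst det_upperdiagonal) auto
  finally show ?thesis by (simp add: prod.distrib)
qed

text \<open>
  The sign between \<open>vandermonde\<close> and the product of differences does not depend on the point, so it
  occurs twice and cancels.
\<close>
lemma vandermonde_product_eq: "vandermonde_product z w = vandermonde z * cnj (vandermonde w)"
proof -
  have "{(i, j). i < j} = (SIGMA i:UNIV. {j :: 'a. i < j})" by auto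
  then have "vandermonde_product z w = (\<Prod>k\<in>UNIV. \<Prod>l\<in>{l. k < l}. z $ k - z $ l) * cnj (\<Prod>k\<in>UNIV. \<Prod>l\<in>{l. k < l}. w $ k - w $ l)"
    unfolding vandermonde_product_def by (simp add: prod.Sigma[symmetric] prod.distrib)
  moreover have "(\<Prod>k\<in>(UNIV :: 'a set). (-1) ^ index_rank k) * cnj (\<Prod>k\<in>(UNIV :: 'a set). (-1) ^ index_rank k) = (1 :: complex)"
    by (simp flip: prod.distrib power_mult_distrib)
  ultimately show ?thesis unfolding vandermonde_eq by (simp add: algebra_simps) 
qed

lemma vandermonde_nonzero_iff: "vandermonde z \<noteq> 0 \<longleftrightarrow> inj (\<lambda>i. z $ i)"
proof -
  have "vandermonde z \<noteq> 0 \<longleftrightarrow> (\<forall>k l. k < l \<longrightarrow> z $ k \<noteq> z $ l)"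
    by (auto simp: vandermonde_eq)
  also have "\<dots> \<longleftrightarrow> inj (\<lambda>i. z $ i)"
  proof
    assume *: "\<forall>k l. k < l \<longrightarrow> z $ k \<noteq> z $ l"
    show "inj (\<lambda>i. z $ i)"
    proof (rule injI, rule ccontr)
      fix x y assume "z $ x = z $ y" "x \<noteq> y"
      then show False using *[rule_format, of x y] *[rule_format, of y x] by (cases x y rule: linorder_cases) auto
    qed
  qed (auto simp: inj_def)
  finally show ?thesis .
qed

lemma real_jacobian_vandermonde:
  assumes "vandermonde z \<noteq> 0"
  shows "real_jacobian (vandermonde_matrix z) = (cmod (vandermonde z))\<^sup>2"
proof -
  obtain U :: "complex^'a::{finite,wellorder}^'a::{finite,wellorder}" where
    U: "\<And>i j. i < j \<Longrightarrow> U $ i $ j = 0" "\<And>i. U $ i $ i = 1"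
    "vandermonde_matrix z ** U = (\<chi> i k. (-1) ^ index_rank k * (\<Prod>l\<in>{l. k < l}. z $ i - z $ l))"
    using vandermonde_newton[of z] by blast
  have "real_jacobian U = 1"
    by (rule real_jacobian_unitriangular[where r=index_rank]) (auto simp: U index_rank_le_iff)
  then have "real_jacobian (vandermonde_matrix z) = real_jacobian (vandermonde_matrix z ** U)"
    by (simp add: real_jacobian_mult)
  also have "\<dots> = (\<Prod>k\<in>UNIV. (cmod ((vandermonde_matrix z ** U) $ k $ k))\<^sup>2)"
  proof (rule real_jacobian_triangular[where r="\<lambda>i. CARD('a) - index_rank i"])
    fix i j :: 'a assume "i \<noteq> j" "CARD('a) - index_rank i \<le> CARD('a) - index_rank j"
    then have "j < i" using index_rank_bounds[of i] index_rank_bounds[of j] 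
      index_rank_le_iff[of j i] by force
    then show "(vandermonde_matrix z ** U) $ i $ j = 0" by (auto simp: U(3))
  next
    show "(vandermonde_matrix z ** U) $ i $ i \<noteq> 0" for i
      using assms by (auto simp: U(3) vandermonde_eq)
  qed
  also have "\<dots> = (cmod (\<Prod>k\<in>UNIV. (vandermonde_matrix z ** U) $ k $ k))\<^sup>2"
    by (simp add: prod_norm[symmetric] prod_power_distrib)
  also have "(\<Prod>k\<in>UNIV. (vandermonde_matrix z ** U) $ k $ k) = vandermonde z"
    by (simp add: U(3) vandermonde_eq prod.distrib)
  finally show ?thesis .
qed

lemma vandermonde_permute:
  fixes z :: "complex^'d::{finite,wellorder}"
  assumes "p permutes UNIV"
  shows "vandermonde (\<chi> i. z $ p i) = of_int (sign p) * vandermonde z"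
proof -
  have "vandermonde_matrix (\<chi> i. z $ p i) = (\<chi> i. vandermonde_matrix z $ p i)"
    by (simp add: vandermonde_matrix_def vec_eq_iff)
  then show ?thesis unfolding vandermonde_def by (simp add: det_permute_rows[OF assms])
qed

lemma symmetrization_permute:
  fixes z :: "complex^'d::{finite,wellorder}"
  assumes "bij p"
  shows "symmetrization (\<chi> i. z $ p i) = symmetrization z"
proof -
  have "elem_sym n (\<chi> i. z $ p i) = elem_sym n z" for n
  proof -
    have "elem_sym n (\<chi> i. z $ p i) = (\<Sum>I | card I = n. \<Prod>i\<in>I. z $ p i)" by (simp add: elem_sym_def)
    also have "\<dots> = (\<Sum>I | card I = n. \<Prod>i\<in>p ` I. z $ i)"
      using assms by (intro sum.cong refl) (simp add: prod.reindex inj_on_subset[OF bij_is_inj[OF assms]])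
    also have "\<dots> = elem_sym n z" unfolding elem_sym_def
      by (rule sum.reindex_bij_witness[where i="\<lambda>I. inv p ` I" and j="\<lambda>I. p ` I"])
        (use assms in \<open>auto simp: image_comp o_def bij_def surj_f_inv_f card_image inj_on_subset
          card_image[OF inj_on_subset[OF surj_imp_inj_inv]]\<close>)
    finally show ?thesis .
  qed
  then show ?thesis by (simp add: symmetrization_def)
qed

lemma complex_linear_deriv_symmetrization: "complex_linear_deriv (\<lambda>z. symmetrization z $ k) z"
  unfolding symmetrization_def elem_sym_def
  by (simp, intro complex_linear_deriv_sum complex_linear_deriv_prod complex_linear_deriv_component)

definition symmetrization_deriv :: "complex^'d::{finite,wellorder} \<Rightarrow> complex^'d::{finite,wellorder}^'d::{finite,wellorder}" where
  "symmetrization_deriv z = (SOME A. (symmetrization has_derivative (\<lambda>h. A *v h)) (at z))"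

lemma has_derivative_symmetrization:
  "(symmetrization has_derivative (\<lambda>h. symmetrization_deriv z *v h)) (at z)"
  unfolding symmetrization_deriv_def
  by (rule someI_ex, rule complex_linear_deriv_matrix[OF complex_linear_deriv_symmetrization]) blast

lemma continuous_on_symmetrization: "continuous_on S symmetrization"
  by (intro continuous_at_imp_continuous_on ballI has_derivative_continuous[OF has_derivative_symmetrization])

text \<open>
  Differentiate \<open>root_poly (symmetrization z) t = (\<Prod>i. t - z $ i)\<close> in \<open>z\<close> for fixed \<open>t\<close>, and put
  \<open>t = z $ j\<close>: on the right only the factor that belongs to \<open>j\<close> needs to be differentiated.
\<close>
lemma vandermonde_symmetrization_deriv:
  fixes z :: "complex^'d::{finite,wellorder}"
  shows "vandermonde_matrix z ** symmetrization_deriv z = diag_matrix (\<lambda>i. - (\<Prod>l\<in>UNIV - {i}. z $ i - z $ l))"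
proof -
  let ?D = "symmetrization_deriv z"
  have key: "(\<Sum>k\<in>UNIV. (?D *v h) $ k * signed_power k t) = - (\<Sum>i\<in>UNIV. h $ i * (\<Prod>l\<in>UNIV - {i}. t - z $ l))" for h t
  proof -
    have "((\<lambda>z. symmetrization z $ k) has_derivative (\<lambda>h. (?D *v h) $ k)) (at z)" for k
      by (rule bounded_linear.has_derivative[OF bounded_linear_vec_nth has_derivative_symmetrization])
    then have 1: "((\<lambda>z. root_poly (symmetrization z) t) has_derivative (\<lambda>h. \<Sum>k\<in>UNIV. (?D *v h) $ k * signed_power k t)) (at z)"
      unfolding root_poly_def by (auto intro!: derivative_eq_intros)
    have "((\<lambda>z. z $ i) has_derivative (\<lambda>h. h $ i)) (at z)" for i
      by (rule bounded_linear_imp_has_derivative) (rule bounded_linear_vec_nth)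
    then have "((\<lambda>z. \<Prod>i\<in>UNIV. t - z $ i) has_derivative (\<lambda>h. \<Sum>i\<in>UNIV. (- (h $ i)) * (\<Prod>l\<in>UNIV - {i}. t - z $ l))) (at z)"
      by (intro has_derivative_prod) (auto intro!: derivative_eq_intros)
    then have 2: "((\<lambda>z. root_poly (symmetrization z) t) has_derivative (\<lambda>h. \<Sum>i\<in>UNIV. (- (h $ i)) * (\<Prod>l\<in>UNIV - {i}. t - z $ l))) (at z)"
      by (simp add: root_poly_symmetrization)
    from has_derivative_unique[OF 1 2] show ?thesis by (simp add: sum_negf fun_eq_iff)
  qed
  have "(vandermonde_matrix z ** ?D) $ j $ m = diag_matrix (\<lambda>i. - (\<Prod>l\<in>UNIV - {i}. z $ i - z $ l)) $ j $ m" for j m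
  proof -
    have "(vandermonde_matrix z ** ?D) $ j $ m = (\<Sum>k\<in>UNIV. (?D *v axis m 1) $ k * signed_power k (z $ j))"
      by (simp add: matrix_matrix_mult_def vandermonde_matrix_def matrix_vector_mult_def axis_def if_distrib mult.commute
        cong: if_cong)
    also have "\<dots> = - (\<Sum>i\<in>UNIV. axis m 1 $ i * (\<Prod>l\<in>UNIV - {i}. z $ j - z $ l))"
      by (rule key)
    also have "\<dots> = - (\<Prod>l\<in>UNIV - {m}. z $ j - z $ l)"
      by (simp add: axis_def if_distrib if_distribR cong: if_cong)
    also have "\<dots> = diag_matrix (\<lambda>i. - (\<Prod>l\<in>UNIV - {i}. z $ i - z $ l)) $ j $ m"
      by (auto simp: diag_matrix_def)
    finally show ?thesis .
  qed
  then show ?thesis by (simp add: vec_eq_iff)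
qed

text \<open>
  The diagonal matrix of the previous lemma has determinant \<open>V(z)\<^sup>2\<close> up to sign, because each pair of
  indices contributes its difference twice. Cancelling one factor \<open>V(z)\<close> leaves the Jacobian.
\<close>
theorem real_jacobian_symmetrization:
  fixes z :: "complex^'d::{finite,wellorder}"
  assumes "vandermonde z \<noteq> 0"
  shows "real_jacobian (symmetrization_deriv z) = (cmod (vandermonde z))\<^sup>2"
proof -
  let ?P = "\<lambda>k. \<Prod>l\<in>{l. k < l}. z $ k - z $ l" and ?N = "\<lambda>k. \<Prod>l\<in>{l. l < k}. z $ k - z $ l"
  have split: "(\<Prod>l\<in>UNIV - {i}. z $ i - z $ l) = ?P i * ?N i" for i
  proof -
    have "UNIV - {i} = {l. i < l} \<union> {l. l < i}" by auto
    moreover have "{l. i < l} \<inter> {l. l < i} = {}" by auto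
    ultimately show ?thesis by (simp add: prod.union_disjoint)
  qed
  have cV: "cmod (vandermonde z) = (\<Prod>k\<in>UNIV. cmod (?P k))"
    by (simp add: vandermonde_eq norm_mult prod_norm[symmetric] norm_power)
  have "(\<Prod>k\<in>UNIV. cmod (?N k)) = (\<Prod>k\<in>UNIV. \<Prod>l\<in>{l. l < k}. cmod (z $ l - z $ k))"
    by (simp add: prod_norm[symmetric] norm_minus_commute)
  also have "\<dots> = (\<Prod>(k, l)\<in>(SIGMA k:UNIV. {l. l < k}). cmod (z $ l - z $ k))"
    by (subst prod.Sigma) auto
  also have "\<dots> = (\<Prod>(k, l)\<in>(SIGMA k:UNIV. {l. k < l}). cmod (z $ k - z $ l))"
    by (rule prod.reindex_bij_witness[where i="\<lambda>(k, l). (l, k)" and j="\<lambda>(k, l). (l, k)"]) auto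
  also have "\<dots> = cmod (vandermonde z)"
    unfolding cV by (subst prod.Sigma[symmetric]) (auto simp: prod_norm[symmetric])
  finally have cN: "(\<Prod>k\<in>UNIV. cmod (?N k)) = cmod (vandermonde z)" .
  have "(cmod (vandermonde z))\<^sup>2 * real_jacobian (symmetrization_deriv z) = (\<Prod>i\<in>UNIV. (cmod (?P i * ?N i))\<^sup>2)"
    using arg_cong[OF vandermonde_symmetrization_deriv[of z], of real_jacobian]
    by (simp add: real_jacobian_mult real_jacobian_vandermonde[OF assms] real_jacobian_diag split)
  also have "\<dots> = ((\<Prod>i\<in>UNIV. cmod (?P i)) * (\<Prod>i\<in>UNIV. cmod (?N i)))\<^sup>2"
    by (simp only: norm_mult power_mult_distrib prod.distrib prod_power_distrib)
  also have "\<dots> = (cmod (vandermonde z))\<^sup>2 * (cmod (vandermonde z))\<^sup>2"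
    unfolding cN cV[symmetric] by (simp add: power2_eq_square)
  finally have "(cmod (vandermonde z))\<^sup>2 * real_jacobian (symmetrization_deriv z)
    = (cmod (vandermonde z))\<^sup>2 * (cmod (vandermonde z))\<^sup>2" .
  moreover have "(cmod (vandermonde z))\<^sup>2 \<noteq> 0" using assms by simp
  ultimately show ?thesis by (rule mult_left_cancel[THEN iffD1, rotated])
qed

section \<open>Polynomials with all roots in a disc\<close>

text \<open>
  Differentiation under the integral sign; the derivative of the integral is complex linear because the
  integral of a complex linear map is.
\<close>
lemma complex_linear_deriv_integral:
  fixes f :: "complex^'n \<Rightarrow> real \<Rightarrow> complex"
  assumes U: "open U" "u0 \<in> U"
    and der: "\<And>u x. u \<in> U \<Longrightarrow> x \<in> {0..1} \<Longrightarrow> ((\<lambda>u. f u x) has_derivative (\<lambda>h. \<Sum>i\<in>UNIV. a i u x * h $ i)) (at u)"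
    and cont_a: "\<And>i. continuous_on (U \<times> {0..1}) (\<lambda>(u, x). a i u x)"
    and cont_f: "\<And>u. u \<in> U \<Longrightarrow> continuous_on {0..1} (f u)"
  shows "complex_linear_deriv (\<lambda>u. integral {0..1} (f u)) u0"
proof -
  obtain e where e: "e > 0" "ball u0 e \<subseteq> U" using U openE by blast
  define D where "D = (\<lambda>u x. Blinfun (\<lambda>h. \<Sum>i\<in>UNIV. a i u x * h $ i))"
  have D: "blinfun_apply (D u x) = (\<lambda>h. \<Sum>i\<in>UNIV. a i u x * h $ i)" if "u \<in> U" "x \<in> {0..1}" for u x
    unfolding D_def by (rule bounded_linear_Blinfun_apply) (rule has_derivative_bounded_linear[OF der[OF that]])
  have contD: "continuous_on (ball u0 e \<times> cbox 0 1) (\<lambda>(u, x). D u x)"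
  proof (rule continuous_on_blinfun_componentwise)
    fix b :: "complex^'n"
    have "continuous_on (ball u0 e \<times> {0..1}) (\<lambda>p. \<Sum>i\<in>UNIV. a i (fst p) (snd p) * b $ i)"
    proof (intro continuous_intros)
      show "continuous_on (ball u0 e \<times> {0..1}) (\<lambda>p. a i (fst p) (snd p))" for i
        using continuous_on_subset[OF cont_a[of i], of "ball u0 e \<times> {0..1}"] e(2) by (auto simp: case_prod_unfold)
    qed
    then show "continuous_on (ball u0 e \<times> cbox 0 1) (\<lambda>p. blinfun_apply (case p of (u, x) \<Rightarrow> D u x) b)"
      using e(2) by (subst continuous_on_cong[OF refl, where g="\<lambda>p. \<Sum>i\<in>UNIV. a i (fst p) (snd p) * b $ i"])
        (auto simp: D subset_iff)
  qed
  have "((\<lambda>u. integral (cbox 0 1) (f u)) has_derivative integral (cbox 0 1) (D u0)) (at u0 within ball u0 e)"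
  proof (rule leibniz_rule)
    show "((\<lambda>u. f u x) has_derivative blinfun_apply (D u x)) (at u within ball u0 e)"
      if "u \<in> ball u0 e" "x \<in> cbox 0 1" for u x
      using der[of u x] that e(2) by (auto simp: D subset_iff intro: has_derivative_at_withinI)
    show "f u integrable_on cbox 0 1" if "u \<in> ball u0 e" for u
      using cont_f[of u] that e(2) by (auto intro!: integrable_continuous_real)
  qed (use contD e in auto)
  then have F: "((\<lambda>u. integral {0..1} (f u)) has_derivative blinfun_apply (integral {0..1} (D u0))) (at u0)"
    using e(1) by (simp add: at_within_open[of u0 "ball u0 e"])
  have P: "continuous_on {0..1::real} (Pair u0)"
    by (rule continuous_on_Pair[OF continuous_on_const continuous_on_id])
  have contD0: "continuous_on {0..1} (D u0)"
    using continuous_on_compose2[OF contD, of "{0..1}" "Pair u0"] P e(1) by (simp add: image_subset_iff)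
  have conta0: "continuous_on {0..1} (a i u0)" for i
    using continuous_on_compose2[OF cont_a[of i], of "{0..1}" "Pair u0"] P U(2) by (simp add: image_subset_iff)
  have "blinfun_apply (integral {0..1} (D u0)) h = (\<Sum>i\<in>UNIV. integral {0..1} (a i u0) * h $ i)" for h
  proof -
    have "blinfun_apply (integral {0..1} (D u0)) h = integral {0..1} (\<lambda>x. blinfun_apply (D u0 x) h)"
      by (rule blinfun_apply_integral) (rule integrable_continuous_real[OF contD0])
    also have "\<dots> = integral {0..1} (\<lambda>x. \<Sum>i\<in>UNIV. a i u0 x * h $ i)"
      using U(2) by (intro integral_cong) (simp add: D)
    also have "\<dots> = (\<Sum>i\<in>UNIV. integral {0..1} (\<lambda>x. a i u0 x * h $ i))"
      by (rule integral_sum) (auto intro!: integrable_continuous_real continuous_intros conta0)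
    also have "\<dots> = (\<Sum>i\<in>UNIV. integral {0..1} (a i u0) * h $ i)"
      by simp
    finally show ?thesis .
  qed
  then have "blinfun_apply (integral {0..1} (D u0)) = (\<lambda>h. \<Sum>i\<in>UNIV. integral {0..1} (a i u0) * h $ i)"
    by (simp add: fun_eq_iff)
  with F show ?thesis by (intro complex_linear_derivI) simp
qed

definition roots_within :: "real \<Rightarrow> complex^'d::{finite,wellorder} \<Rightarrow> bool" where
  "roots_within R u \<longleftrightarrow> (\<forall>t. root_poly u t = 0 \<longrightarrow> cmod t < R)"

lemma continuous_on_signed_power [continuous_intros]:
  "continuous_on S f \<Longrightarrow> continuous_on S (\<lambda>x. signed_power k (f x))"
  unfolding signed_power_def by (intro continuous_intros)

lemma continuous_on_root_poly [continuous_intros]: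
  "continuous_on S f \<Longrightarrow> continuous_on S g \<Longrightarrow> continuous_on S (\<lambda>x. root_poly (f x) (g x))"
  unfolding root_poly_def by (intro continuous_intros)

lemma root_bound:
  fixes u :: "complex^'d::{finite,wellorder}"
  assumes "root_poly u t = 0"
  shows "cmod t \<le> 1 + (\<Sum>k\<in>UNIV. cmod (u $ k))"
proof (cases "cmod t \<le> 1")
  case True
  then show ?thesis by (simp add: add_increasing2 sum_nonneg)
next
  case False
  let ?d = "CARD('d)"
  have d: "?d > 0" by simp
  have "t ^ ?d = - (\<Sum>k\<in>UNIV. u $ k * signed_power k t)"
    using assms unfolding root_poly_def by (rule eq_neg_iff_add_eq_0[THEN iffD2])
  then have "cmod t ^ ?d \<le> (\<Sum>k\<in>UNIV. cmod (u $ k * signed_power k t))"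
    using norm_sum[of "\<lambda>k. u $ k * signed_power k t" UNIV] by (simp flip: norm_power)
  also have "\<dots> \<le> (\<Sum>k\<in>UNIV. cmod (u $ k) * cmod t ^ (?d - 1))"
  proof (rule sum_mono)
    fix k :: 'd
    have "cmod t ^ (?d - index_rank k) \<le> cmod t ^ (?d - 1)"
      using False index_rank_bounds[of k] by (intro power_increasing) auto
    then show "cmod (u $ k * signed_power k t) \<le> cmod (u $ k) * cmod t ^ (?d - 1)"
      by (simp add: signed_power_def norm_mult norm_power mult_left_mono)
  qed
  also have "\<dots> = (\<Sum>k\<in>UNIV. cmod (u $ k)) * cmod t ^ (?d - 1)" by (simp add: sum_distrib_right)
  finally have "cmod t * cmod t ^ (?d - 1) \<le> (\<Sum>k\<in>UNIV. cmod (u $ k)) * cmod t ^ (?d - 1)"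
    using power_minus_mult[OF d, of "cmod t"] by (simp add: mult.commute)
  then have "cmod t \<le> (\<Sum>k\<in>UNIV. cmod (u $ k))"
  proof (rule mult_right_le_imp_le)
    show "0 < cmod t ^ (?d - 1)" using False by (intro zero_less_power) linarith
  qed
  then show ?thesis by simp
qed

text \<open>
  Roots of a convergent sequence of polynomials are bounded, so a subsequence of them converges, and the
  limit is a root of the limit polynomial. Hence having a root of modulus at least \<open>R\<close> is a closed
  condition.
\<close>
lemma open_roots_within: "open {u :: complex^'d::{finite,wellorder}. roots_within R u}"
proof -
  have "closed {u :: complex^'d::{finite,wellorder}. \<not> roots_within R u}"
    unfolding closed_sequential_limits
  proof (intro allI impI, elim conjE)
    fix X and u :: "complex^'d::{finite,wellorder}" assume X: "\<forall>n. X n \<in> {u. \<not> roots_within R u}" and lim: "X \<longlonglongrightarrow> u"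
    from X have "\<forall>n. \<exists>t. root_poly (X n) t = 0 \<and> R \<le> cmod t"
      by (simp add: roots_within_def not_less)
    from choice[OF this] obtain t where t: "\<And>n. root_poly (X n) (t n) = 0" "\<And>n. R \<le> cmod (t n)" by blast
    have "(\<lambda>n. 1 + (\<Sum>k\<in>UNIV. cmod (X n $ k))) \<longlonglongrightarrow> 1 + (\<Sum>k\<in>UNIV. cmod (u $ k))"
      by (intro tendsto_intros lim)
    then have "Bseq (\<lambda>n. 1 + (\<Sum>k\<in>UNIV. cmod (X n $ k)))"
      by (rule convergent_imp_Bseq[OF convergentI])
    then obtain B where B: "\<And>n. norm (1 + (\<Sum>k\<in>UNIV. cmod (X n $ k))) \<le> B" unfolding Bseq_def by blast
    have "t n \<in> cball 0 B" for n
      using order.trans[OF root_bound[OF t(1)[of n]] order.trans[OF abs_ge_self B[of n, unfolded real_norm_def]]] by simp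
    then obtain l s where ls: "strict_mono (s :: nat \<Rightarrow> nat)" "(t \<circ> s) \<longlonglongrightarrow> l"
      using compact_cball[of "0 :: complex" B] unfolding compact_def by blast
    have Xs: "(X \<circ> s) \<longlonglongrightarrow> u" using lim ls(1) by (rule LIMSEQ_subseq_LIMSEQ)
    have "(\<lambda>n. root_poly ((X \<circ> s) n) ((t \<circ> s) n)) \<longlonglongrightarrow> root_poly u l"
      unfolding root_poly_def signed_power_def by (intro tendsto_intros Xs ls(2))
    then have "root_poly u l = 0" using t(1) by (simp add: o_def LIMSEQ_const_iff)
    moreover have "R \<le> cmod l"
      by (rule LIMSEQ_le_const[OF tendsto_norm[OF ls(2)]]) (simp add: t(2))
    ultimately show "u \<in> {u. \<not> roots_within R u}" by (auto simp: roots_within_def not_less)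
  qed
  moreover have "- {u :: complex^'d::{finite,wellorder}. \<not> roots_within R u} = {u. roots_within R u}" by auto
  ultimately show ?thesis unfolding closed_open by simp
qed

lemma roots_within_mono: "roots_within R u \<Longrightarrow> R \<le> R' \<Longrightarrow> roots_within R' u"
  by (force simp: roots_within_def)

lemma root_poly_symmetrization_eq_0: "root_poly (symmetrization z) t = 0 \<longleftrightarrow> t \<in> range (($) z)"
  by (auto simp: root_poly_symmetrization)

text \<open>
  The fundamental theorem of algebra.
\<close>
lemma symmetrization_surj:
  fixes u :: "complex^'d::{finite,wellorder}"
  obtains z where "symmetrization z = u"
proof -
  let ?d = "CARD('d)"
  define p :: "complex poly" where "p = monom 1 ?d + (\<Sum>k\<in>UNIV. monom (u $ k * (-1) ^ index_rank k) (?d - index_rank k))"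
  have poly_p: "poly p t = root_poly u t" for t
    by (simp add: p_def root_poly_def poly_monom poly_sum signed_power_def mult.assoc)
  have deg_lt: "degree (\<Sum>k\<in>UNIV. monom (u $ k * (-1) ^ index_rank k) (?d - index_rank k)) < ?d"
  proof (rule degree_sum_less)
    fix k :: 'd
    have "?d - index_rank k < ?d" using index_rank_bounds[of k] by simp
    then show "degree (monom (u $ k * (-1) ^ index_rank k) (?d - index_rank k)) < ?d"
      using degree_monom_le le_less_trans by blast
  qed simp
  have deg: "degree p = ?d" unfolding p_def
    using deg_lt by (subst degree_add_eq_left) (auto simp: degree_monom_eq)
  have lead: "lead_coeff p = 1"
    using deg_lt unfolding deg by (simp add: p_def coeff_eq_0)
  have "p \<noteq> 0" using lead by auto
  from alg_closed_imp_factorization[where ?'a=complex, OF this]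
  obtain A where A: "size A = degree p" "p = smult (lead_coeff p) (\<Prod>x\<in>#A. [:- x, 1:])"
    by (elim exE conjE)
  obtain xs where xs: "mset xs = A" using ex_mset by blast
  have len: "length xs = ?d" using A(1) deg unfolding xs[symmetric] by simp
  define z :: "complex^'d::{finite,wellorder}" where "z = (\<chi> k. xs ! (index_rank k - 1))"
  have "root_poly u t = (\<Prod>k\<in>UNIV. t - z $ k)" for t
  proof -
    have "root_poly u t = (\<Prod>x\<leftarrow>xs. t - x)"
    proof -
      have "poly (\<Prod>x\<in>#mset ys. [:- x, 1:]) t = (\<Prod>x\<leftarrow>ys. t - x)" for ys
        by (induction ys) (auto simp: algebra_simps)
      moreover have "p = (\<Prod>x\<in>#mset xs. [:- x, 1:])" using A(2) xs lead by simp
      ultimately show ?thesis by (simp flip: poly_p)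
    qed
    also have "\<dots> = (\<Prod>n\<in>{0..<?d}. t - xs ! n)"
      by (simp add: prod.list_conv_set_nth len)
    also have "\<dots> = (\<Prod>n\<in>{1..?d}. t - xs ! (n - 1))"
      by (rule prod.reindex_bij_witness[where i="\<lambda>n. n - 1" and j="\<lambda>n. n + 1"]) auto
    also have "\<dots> = (\<Prod>k\<in>(UNIV :: 'd set). t - xs ! (index_rank k - 1))"
      using prod.reindex_bij_betw[OF bij_betw_index_rank[where 'd='d], of "\<lambda>n. t - xs ! (n - 1)"] by simp
    finally show ?thesis by (simp add: z_def)
  qed
  then have eq: "root_poly u t = root_poly (symmetrization z) t" for t
    by (simp add: root_poly_symmetrization)
  have "symmetrization z = u"
  proof -
    \<comment> \<open>equal polynomials have equal coefficients, and these are the coordinates\<close>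
    define v where "v = u - symmetrization z"
    have "(\<Sum>k\<in>UNIV. v $ k * signed_power k t) = 0" for t
      using eq[of t] by (simp add: root_poly_def v_def algebra_simps sum_subtractf)
    then have zero: "poly (\<Sum>k\<in>UNIV. monom (v $ k * (-1) ^ index_rank k) (?d - index_rank k)) t = 0" for t
      by (simp add: poly_sum poly_monom signed_power_def mult.assoc)
    have "(\<Sum>k\<in>UNIV. monom (v $ k * (-1) ^ index_rank k) (?d - index_rank k)) = 0"
      using zero by (intro poly_all_0_iff_0[THEN iffD1] allI)
    then have c: "coeff (\<Sum>k\<in>UNIV. monom (v $ k * (-1) ^ index_rank k) (?d - index_rank k)) n = 0" for n by simp
    have "v $ j = 0" for j
    proof -
      have "?d - index_rank k = ?d - index_rank j \<longleftrightarrow> k = j" for k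
        using index_rank_bounds[of k] index_rank_bounds[of j] index_rank_eq_iff[of k j] by linarith
      then have "coeff (\<Sum>k\<in>UNIV. monom (v $ k * (-1) ^ index_rank k) (?d - index_rank k)) (?d - index_rank j)
          = v $ j * (-1) ^ index_rank j"
        by (simp add: coeff_sum)
      then show ?thesis using c by simp
    qed
    then have "v = 0" by (simp add: vec_eq_iff)
    then show ?thesis by (simp add: v_def)
  qed
  then show ?thesis by (rule that)
qed

lemma symmetrized_polydisc_eq:
  "symmetrized_polydisc = {u :: complex^'d::{finite,wellorder}. roots_within 1 u}"
proof (intro equalityI subsetI)
  fix u :: "complex^'d::{finite,wellorder}" assume "u \<in> symmetrized_polydisc"
  then show "u \<in> {u. roots_within 1 u}"
    by (auto simp: symmetrized_polydisc_def roots_within_def root_poly_symmetrization_eq_0 polydisc_def)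
next
  fix u :: "complex^'d::{finite,wellorder}" assume u: "u \<in> {u. roots_within 1 u}"
  obtain z where z: "symmetrization z = u" by (rule symmetrization_surj)
  with u have "z \<in> polydisc" by (auto simp: polydisc_def roots_within_def root_poly_symmetrization_eq_0)
  with z show "u \<in> symmetrized_polydisc" by (auto simp: symmetrized_polydisc_def)
qed

lemma open_symmetrized_polydisc: "open symmetrized_polydisc"
  unfolding symmetrized_polydisc_eq by (rule open_roots_within)

lemma ex_roots_within:
  assumes "u \<in> symmetrized_polydisc"
  shows "\<exists>R. 0 < R \<and> R < 1 \<and> roots_within R u"
proof -
  from assms obtain z where z: "z \<in> polydisc" "u = symmetrization z" by (auto simp: symmetrized_polydisc_def)
  define m where "m = Max (range (\<lambda>i. cmod (z $ i)))"
  have "m < 1" using z(1) unfolding m_def by (subst Max_less_iff) (auto simp: polydisc_def)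
  have le: "cmod (z $ i) \<le> m" for i unfolding m_def by (intro Max_ge) auto
  have "m \<ge> 0" using le[of undefined] norm_ge_zero order.trans by blast
  show ?thesis
  proof (intro exI conjI)
    show "0 < (1 + m) / 2" "(1 + m) / 2 < 1" using \<open>m < 1\<close> \<open>m \<ge> 0\<close> by auto
    have "cmod (z $ i) < (1 + m) / 2" for i using le[of i] \<open>m < 1\<close> by simp
    then show "roots_within ((1 + m) / 2) u"
      by (auto simp: roots_within_def z(2) root_poly_symmetrization_eq_0)
  qed
qed

section \<open>Holomorphic interpolation at the roots of a polynomial\<close>

definition quotient_coeff :: "'d::{finite,wellorder} \<Rightarrow> complex \<Rightarrow> complex^'d::{finite,wellorder} \<Rightarrow> complex" where
  "quotient_coeff k \<zeta> u = (-1) ^ index_rank k * (\<zeta> ^ (index_rank k - 1) +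
     (\<Sum>l\<in>UNIV. u $ l * (if l < k then (-1) ^ index_rank l * \<zeta> ^ (index_rank k - index_rank l - 1) else 0)))"

lemma power_difference_index_rank:
  fixes \<zeta> t :: complex
  assumes "r \<le> CARD('d::{finite,wellorder})"
  shows "(\<zeta> - t) * (\<Sum>k\<in>(UNIV :: 'd set). if r < index_rank k then t ^ (CARD('d) - index_rank k) * \<zeta> ^ (index_rank k - r - 1) else 0)
    = \<zeta> ^ (CARD('d) - r) - t ^ (CARD('d) - r)"
proof -
  let ?d = "CARD('d)" and ?f = "\<lambda>n. if r < n then t ^ (CARD('d) - n) * \<zeta> ^ (n - r - 1) else 0"
  have "(\<Sum>k\<in>(UNIV :: 'd set). ?f (index_rank k)) = (\<Sum>n\<in>{1..?d}. ?f n)"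
    using sum.reindex_bij_betw[OF bij_betw_index_rank[where 'd='d], of ?f] by simp
  also have "\<dots> = (\<Sum>n\<in>{r+1..?d}. t ^ (?d - n) * \<zeta> ^ (n - r - 1))"
    by (rule sum.mono_neutral_cong_right) auto
  also have "\<dots> = (\<Sum>i<?d - r. t ^ (?d - r - Suc i) * \<zeta> ^ i)"
    by (rule sum.reindex_bij_witness[where i="\<lambda>i. i + r + 1" and j="\<lambda>n. n - r - 1"]) (auto simp: algebra_simps)
  finally show ?thesis by (simp add: power_diff_sumr2)
qed

text \<open>
  The coefficients with respect to the basis \<open>signed_power\<close> of the polynomial
  \<open>(p(\<zeta>) - p(t)) / (\<zeta> - t)\<close> in \<open>t\<close>, where \<open>p = root_poly u\<close>; each power of \<open>\<zeta>\<close> and \<open>t\<close> is treated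
  with the geometric sum.
\<close>
lemma quotient_coeff_identity:
  fixes u :: "complex^'d::{finite,wellorder}"
  shows "(\<zeta> - t) * (\<Sum>k\<in>UNIV. signed_power k t * quotient_coeff k \<zeta> u) = root_poly u \<zeta> - root_poly u t"
proof -
  let ?d = "CARD('d)"
  define F where "F = (\<lambda>r (k :: 'd). if r < index_rank k then t ^ (?d - index_rank k) * \<zeta> ^ (index_rank k - r - 1) else 0)"
  have F: "(\<zeta> - t) * (\<Sum>k\<in>UNIV. F r k) = \<zeta> ^ (?d - r) - t ^ (?d - r)" if "r \<le> ?d" for r
    unfolding F_def using that by (rule power_difference_index_rank)
  have summand: "signed_power k t * quotient_coeff k \<zeta> u = F 0 k + (\<Sum>l\<in>UNIV. u $ l * (-1) ^ index_rank l * F (index_rank l) k)" for k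
  proof -
    have pos: "0 < index_rank k" using index_rank_bounds(1)[of k] by simp
    have s: "(-1) ^ index_rank k * ((-1) ^ index_rank k * w) = (w :: complex)" for w
      by (simp flip: mult.assoc power_mult_distrib)
    have "signed_power k t * quotient_coeff k \<zeta> u = t ^ (?d - index_rank k) * (\<zeta> ^ (index_rank k - 1) +
     (\<Sum>l\<in>UNIV. u $ l * (if l < k then (-1) ^ index_rank l * \<zeta> ^ (index_rank k - index_rank l - 1) else 0)))"
      unfolding signed_power_def quotient_coeff_def by (simp add: s mult_ac)
    also have "\<dots> = F 0 k + (\<Sum>l\<in>UNIV. u $ l * (-1) ^ index_rank l * F (index_rank l) k)"
      using pos unfolding distrib_left sum_distrib_left F_def
      by (intro arg_cong2[where f="(+)"] sum.cong) (auto simp: index_rank_less_iff)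
    finally show ?thesis .
  qed
  have "(\<zeta> - t) * (\<Sum>k\<in>UNIV. signed_power k t * quotient_coeff k \<zeta> u)
    = (\<zeta> - t) * (\<Sum>k\<in>UNIV. F 0 k) + (\<zeta> - t) * (\<Sum>k\<in>UNIV. \<Sum>l\<in>UNIV. u $ l * (-1) ^ index_rank l * F (index_rank l) k)"
    unfolding summand sum.distrib distrib_left ..
  also have "(\<Sum>k\<in>UNIV. \<Sum>l\<in>UNIV. u $ l * (-1) ^ index_rank l * F (index_rank l) k)
      = (\<Sum>l\<in>UNIV. u $ l * (-1) ^ index_rank l * (\<Sum>k\<in>UNIV. F (index_rank l) k))"
    unfolding sum_distrib_left by (rule sum.swap)
  also have "(\<zeta> - t) * \<dots> = (\<Sum>l\<in>UNIV. u $ l * (-1) ^ index_rank l * ((\<zeta> - t) * (\<Sum>k\<in>UNIV. F (index_rank l) k)))"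
    by (subst sum_distrib_left, intro sum.cong refl) (simp add: mult_ac)
  also have "\<dots> = (\<Sum>l\<in>UNIV. u $ l * signed_power l \<zeta>) - (\<Sum>l\<in>UNIV. u $ l * signed_power l t)"
    unfolding sum_subtractf[symmetric]
    by (intro sum.cong refl, simp only: F[OF index_rank_bounds(2)]) (simp add: signed_power_def algebra_simps)
  also have "(\<zeta> - t) * (\<Sum>k\<in>UNIV. F 0 k) = \<zeta> ^ ?d - t ^ ?d" using F[of 0] by simp
  finally show ?thesis by (simp add: root_poly_def)
qed

text \<open>
  The factor \<open>\<zeta> = circlepath 0 R x\<close> comes from \<open>d\<zeta> = 2 pi i \<zeta> dx\<close>; the constant cancels against the
  one of Cauchy's formula.
\<close>
definition interp_weight :: "real \<Rightarrow> complex^'d::{finite,wellorder} \<Rightarrow> 'd \<Rightarrow> real \<Rightarrow> complex" where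
  "interp_weight R u k x = circlepath 0 R x * quotient_coeff k (circlepath 0 R x) u / root_poly u (circlepath 0 R x)"

definition interp_coeff :: "real \<Rightarrow> (complex \<Rightarrow> complex) \<Rightarrow> complex^'d::{finite,wellorder} \<Rightarrow> 'd \<Rightarrow> complex" where
  "interp_coeff R \<phi> u k = integral {0..1} (\<lambda>x. \<phi> (circlepath 0 R x) * interp_weight R u k x)"

lemma continuous_on_if_const:
  "(P \<Longrightarrow> continuous_on S f) \<Longrightarrow> continuous_on S (\<lambda>x. if P then f x else (0 :: 'a::real_normed_vector))"
  by (cases P) auto

lemma holomorphic_on_if_const:
  "(P \<Longrightarrow> f holomorphic_on S) \<Longrightarrow> (\<lambda>x. if P then f x else 0) holomorphic_on S"
  by (cases P) auto

lemma continuous_on_quotient_coeff [continuous_intros]: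
  "continuous_on S f \<Longrightarrow> continuous_on S g \<Longrightarrow> continuous_on S (\<lambda>x. quotient_coeff k (f x) (g x))"
  unfolding quotient_coeff_def by (intro continuous_intros continuous_on_if_const)

lemma continuous_on_circlepath [continuous_intros]:
  "continuous_on S f \<Longrightarrow> continuous_on S (\<lambda>x. circlepath z R (f x))"
  unfolding circlepath by (intro continuous_intros)

lemma norm_circlepath_0: "0 \<le> R \<Longrightarrow> cmod (circlepath 0 R x) = R"
  by (simp add: circlepath norm_mult)

lemma root_poly_circlepath_nz: "roots_within R u \<Longrightarrow> 0 < R \<Longrightarrow> root_poly u (circlepath 0 R x) \<noteq> 0"
  by (auto simp: roots_within_def norm_circlepath_0)

lemma continuous_on_interp_weight:
  assumes "0 < R" "\<And>p. p \<in> S \<Longrightarrow> roots_within R (f p)" "continuous_on S f" "continuous_on S g"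
  shows "continuous_on S (\<lambda>p. interp_weight R (f p) k (g p))"
  unfolding interp_weight_def using assms
  by (intro continuous_intros) (auto simp: root_poly_circlepath_nz)

lemma interp_coeff_contour:
  "interp_coeff R \<phi> u k = contour_integral (circlepath 0 R) (\<lambda>\<zeta>. \<phi> \<zeta> * quotient_coeff k \<zeta> u / root_poly u \<zeta>) / (2 * of_real pi * \<i>)"
proof -
  have "contour_integral (circlepath 0 R) (\<lambda>\<zeta>. \<phi> \<zeta> * quotient_coeff k \<zeta> u / root_poly u \<zeta>)
    = integral {0..1} (\<lambda>x. (2 * of_real pi * \<i>) * (\<phi> (circlepath 0 R x) * interp_weight R u k x))"
    unfolding contour_integral_integral vector_derivative_circlepath interp_weight_def
    by (intro integral_cong) (simp add: circlepath algebra_simps)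
  then show ?thesis by (simp add: interp_coeff_def)
qed

text \<open>
  At a root \<open>t\<close> of \<open>p\<close> the sum of the integrands is \<open>\<phi>(\<zeta>) / (\<zeta> - t)\<close> on the circle, because
  \<open>p(\<zeta>)\<close> cancels. Cauchy's formula then gives \<open>\<phi>(t)\<close>, for multiple roots as well.
\<close>
theorem interp_coeff_interpolates:
  fixes u :: "complex^'d::{finite,wellorder}"
  assumes "\<phi> holomorphic_on ball 0 1" "0 < R" "R < 1" "roots_within R u" "root_poly u t = 0"
  shows "\<phi> t = (\<Sum>k\<in>UNIV. signed_power k t * interp_coeff R \<phi> u k)"
proof -
  have t: "cmod t < R" using assms(4,5) by (auto simp: roots_within_def)
  have cont: "continuous_on {0..1} (\<lambda>x. \<phi> (circlepath 0 R x))"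
    by (rule continuous_on_compose2[OF holomorphic_on_imp_continuous_on[OF assms(1)]])
      (use assms in \<open>auto intro!: continuous_intros simp: norm_circlepath_0\<close>)
  have contw: "continuous_on {0..1} (interp_weight R u k)" for k
    using assms by (intro continuous_on_interp_weight) (auto intro!: continuous_intros)
  have "((\<lambda>\<zeta>. \<phi> \<zeta> / (\<zeta> - t)) has_contour_integral (2 * of_real pi * \<i> * \<phi> t)) (circlepath 0 R)"
    using assms t by (intro Cauchy_integral_circlepath_simple holomorphic_on_subset[OF assms(1)]) auto
  then have "2 * of_real pi * \<i> * \<phi> t = contour_integral (circlepath 0 R) (\<lambda>\<zeta>. \<phi> \<zeta> / (\<zeta> - t))"
    by (simp add: contour_integral_unique)
  also have "\<dots> = integral {0..1} (\<lambda>x. (2 * of_real pi * \<i>) * (\<Sum>k\<in>UNIV. signed_power k t * (\<phi> (circlepath 0 R x) * interp_weight R u k x)))"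
    unfolding contour_integral_integral
  proof (rule integral_cong)
    fix x :: real
    define \<zeta> where "\<zeta> = circlepath 0 R x"
    have nz: "root_poly u \<zeta> \<noteq> 0" unfolding \<zeta>_def using assms by (intro root_poly_circlepath_nz)
    have "cmod \<zeta> = R" using assms by (simp add: \<zeta>_def norm_circlepath_0)
    \<comment> \<open>the circle avoids the root, so the division by \<open>\<zeta> - t\<close> is harmless\<close>
    then have "\<zeta> \<noteq> t" using t by auto
    have "(\<Sum>k\<in>UNIV. signed_power k t * (\<phi> \<zeta> * interp_weight R u k x))
      = (\<phi> \<zeta> * \<zeta> / root_poly u \<zeta>) * (\<Sum>k\<in>UNIV. signed_power k t * quotient_coeff k \<zeta> u)"
      unfolding interp_weight_def \<zeta>_def[symmetric] sum_distrib_left by (intro sum.cong refl) (simp add: field_simps)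
    also have "(\<Sum>k\<in>UNIV. signed_power k t * quotient_coeff k \<zeta> u) = root_poly u \<zeta> / (\<zeta> - t)"
      using quotient_coeff_identity[of \<zeta> t u] assms(5) \<open>\<zeta> \<noteq> t\<close> by (simp add: field_simps)
    also have "(\<phi> \<zeta> * \<zeta> / root_poly u \<zeta>) * (root_poly u \<zeta> / (\<zeta> - t)) = \<phi> \<zeta> / (\<zeta> - t) * \<zeta>"
      using nz by simp
    finally have "(\<Sum>k\<in>UNIV. signed_power k t * (\<phi> \<zeta> * interp_weight R u k x)) = \<phi> \<zeta> / (\<zeta> - t) * \<zeta>" .
    then show "\<phi> (circlepath 0 R x) / (circlepath 0 R x - t) * vector_derivative (circlepath 0 R) (at x)
      = (2 * of_real pi * \<i>) * (\<Sum>k\<in>UNIV. signed_power k t * (\<phi> (circlepath 0 R x) * interp_weight R u k x))"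
      unfolding vector_derivative_circlepath \<zeta>_def by (simp add: circlepath)
  qed
  also have "\<dots> = (2 * of_real pi * \<i>) * (\<Sum>k\<in>UNIV. integral {0..1} (\<lambda>x. signed_power k t * (\<phi> (circlepath 0 R x) * interp_weight R u k x)))"
    unfolding integral_mult_right
    by (subst integral_sum) (auto intro!: integrable_continuous_real continuous_intros cont contw)
  finally show ?thesis by (simp add: interp_coeff_def)
qed

text \<open>
  The integrand is holomorphic on the annulus between the two circles, since all roots lie inside the
  smaller one.
\<close>
lemma interp_coeff_radius:
  fixes u :: "complex^'d::{finite,wellorder}"
  assumes \<phi>: "\<phi> holomorphic_on ball 0 1" and R: "0 < R" "R \<le> R'" "R' < 1" "roots_within R u"
  shows "interp_coeff R \<phi> u k = interp_coeff R' \<phi> u k"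
proof -
  define S where "S = ball 0 1 \<inter> {\<zeta>. root_poly u \<zeta> \<noteq> 0}"
  have "open S" unfolding S_def
    by (intro open_Int open_ball open_Collect_neq continuous_intros)
  have "contour_integral (circlepath 0 R) (\<lambda>\<zeta>. \<phi> \<zeta> * quotient_coeff k \<zeta> u / root_poly u \<zeta>)
    = contour_integral (circlepath 0 R') (\<lambda>\<zeta>. \<phi> \<zeta> * quotient_coeff k \<zeta> u / root_poly u \<zeta>)"
  proof (rule Cauchy_theorem_homotopic_loops[OF homotopic_loops_linear \<open>open S\<close>])
    fix x :: real
    show "closed_segment (circlepath 0 R x) (circlepath 0 R' x) \<subseteq> S"
    proof
      fix y assume "y \<in> closed_segment (circlepath 0 R x) (circlepath 0 R' x)"
      then obtain s where s: "0 \<le> s" "s \<le> 1" "y = (1 - s) *\<^sub>R circlepath 0 R x + s *\<^sub>R circlepath 0 R' x"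
        by (auto simp: closed_segment_def)
      \<comment> \<open>the segment between corresponding points of the circles consists of points of intermediate circles\<close>
      define r where "r = (1 - s) * R + s * R'"
      have "y = circlepath 0 r x" by (simp add: s(3) r_def circlepath algebra_simps scaleR_conv_of_real)
      moreover have r: "R \<le> r" "r \<le> R'"
      proof -
        have "r = R + s * (R' - R)" "r = R' - (1 - s) * (R' - R)" by (simp_all add: r_def algebra_simps)
        then show "R \<le> r" "r \<le> R'" using s R mult_nonneg_nonneg[of s "R' - R"] mult_nonneg_nonneg[of "1 - s" "R' - R"] by linarith+
      qed
      ultimately show "y \<in> S"
        using R root_poly_circlepath_nz[OF roots_within_mono[OF R(4) r(1)]] by (simp add: S_def norm_circlepath_0)
    qed
  next
    show "(\<lambda>\<zeta>. \<phi> \<zeta> * quotient_coeff k \<zeta> u / root_poly u \<zeta>) holomorphic_on S"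
      unfolding quotient_coeff_def root_poly_def signed_power_def
      by (intro holomorphic_intros holomorphic_on_if_const holomorphic_on_subset[OF \<phi>])
        (auto simp: S_def root_poly_def signed_power_def)
  qed auto
  then show ?thesis by (simp add: interp_coeff_contour)
qed

text \<open>
  For \<open>\<zeta>\<close> on the circle the integrand is a quotient of two affine functions of \<open>u\<close> whose denominator
  has no zero near \<open>u\<close>; the functions \<open>a i\<close> are its partial derivatives.
\<close>
lemma complex_linear_deriv_interp_coeff:
  fixes u :: "complex^'d::{finite,wellorder}"
  assumes \<phi>: "\<phi> holomorphic_on ball 0 1" and R: "0 < R" "R < 1" "roots_within R u"
  shows "complex_linear_deriv (\<lambda>u. interp_coeff R \<phi> u k) u"
proof -
  let ?U = "{u :: complex^'d::{finite,wellorder}. roots_within R u}" and ?c = "circlepath 0 R"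
  define n1 where "n1 = (\<lambda>i \<zeta>. if i < k then (-1) ^ index_rank k * (-1) ^ index_rank i * \<zeta> ^ (index_rank k - index_rank i - 1) else (0::complex))"
  define a where "a = (\<lambda>(i::'d) u x. \<phi> (?c x) * (?c x * (n1 i (?c x) * root_poly u (?c x) - quotient_coeff k (?c x) u * signed_power i (?c x)) / (root_poly u (?c x))\<^sup>2))"
  have cont: "continuous_on S (\<lambda>x. \<phi> (?c (f x)))" if "continuous_on S f" for S :: "'x::topological_space set" and f
    by (rule continuous_on_compose2[OF holomorphic_on_imp_continuous_on[OF \<phi>]])
      (use R that in \<open>auto intro!: continuous_intros simp: norm_circlepath_0\<close>)
  have contn: "continuous_on S (\<lambda>x. n1 i (f x))" if "continuous_on S f" for S :: "'x::topological_space set" and f i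
    using that unfolding n1_def by (cases "i < k") (auto intro!: continuous_intros)
  show ?thesis
    unfolding interp_coeff_def
  proof (rule complex_linear_deriv_integral[where U="?U" and a=a])
    show "open ?U" by (rule open_roots_within)
    show "u \<in> ?U" using R by simp
    show "continuous_on (?U \<times> {0..1}) (\<lambda>(u, x). a i u x)" for i
      unfolding a_def case_prod_unfold using R
      by (intro continuous_intros cont contn) (auto simp: root_poly_circlepath_nz)
    show "continuous_on {0..1} (\<lambda>x. \<phi> (?c x) * interp_weight R u k x)" if "u \<in> ?U" for u
      using that R by (intro continuous_intros cont continuous_on_interp_weight) auto
    show "((\<lambda>u. \<phi> (?c x) * interp_weight R u k x) has_derivative (\<lambda>h. \<Sum>i\<in>UNIV. a i u x * h $ i)) (at u)"
      if "u \<in> ?U" for u x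
    proof -
      let ?\<zeta> = "?c x"
      have nz: "root_poly u ?\<zeta> \<noteq> 0" using that R by (intro root_poly_circlepath_nz) auto
      have comp: "((\<lambda>u :: complex^'d::{finite,wellorder}. u $ i) has_derivative (\<lambda>h. h $ i)) (at u)" for i u
        by (rule bounded_linear_imp_has_derivative) (rule bounded_linear_vec_nth)
      have 1: "((\<lambda>u. root_poly u ?\<zeta>) has_derivative (\<lambda>h. \<Sum>i\<in>UNIV. signed_power i ?\<zeta> * h $ i)) (at u)"
        unfolding root_poly_def by (auto intro!: derivative_eq_intros comp simp: mult.commute)
      have "quotient_coeff k ?\<zeta> = (\<lambda>u. (-1) ^ index_rank k * ?\<zeta> ^ (index_rank k - 1) + (\<Sum>l\<in>UNIV. u $ l * n1 l ?\<zeta>))"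
        unfolding quotient_coeff_def n1_def by (auto simp: fun_eq_iff distrib_left sum_distrib_left intro!: sum.cong)
      then have 2: "(quotient_coeff k ?\<zeta> has_derivative (\<lambda>h. \<Sum>i\<in>UNIV. n1 i ?\<zeta> * h $ i)) (at u)"
        by (auto intro!: derivative_eq_intros comp simp: mult.commute)
      have 3: "((\<lambda>u. \<phi> ?\<zeta> * (?\<zeta> * quotient_coeff k ?\<zeta> u / root_poly u ?\<zeta>)) has_derivative
          (\<lambda>h. \<phi> ?\<zeta> * ((?\<zeta> * (\<Sum>i\<in>UNIV. n1 i ?\<zeta> * h $ i) * root_poly u ?\<zeta> - ?\<zeta> * quotient_coeff k ?\<zeta> u * (\<Sum>i\<in>UNIV. signed_power i ?\<zeta> * h $ i)) / (root_poly u ?\<zeta> * root_poly u ?\<zeta>)))) (at u)"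
        by (rule has_derivative_mult_right[OF has_derivative_divide'[OF has_derivative_mult_right[OF 2] 1 nz]])
      have "(\<phi> ?\<zeta> * ((?\<zeta> * (\<Sum>i\<in>UNIV. n1 i ?\<zeta> * h $ i) * root_poly u ?\<zeta> - ?\<zeta> * quotient_coeff k ?\<zeta> u * (\<Sum>i\<in>UNIV. signed_power i ?\<zeta> * h $ i)) / (root_poly u ?\<zeta> * root_poly u ?\<zeta>)))
        = (\<Sum>i\<in>UNIV. a i u x * h $ i)" for h
      proof -
        have "(\<Sum>i\<in>UNIV. a i u x * h $ i) = (\<Sum>i\<in>UNIV. (\<phi> ?\<zeta> * ?\<zeta> / (root_poly u ?\<zeta>)\<^sup>2) * (root_poly u ?\<zeta> * (n1 i ?\<zeta> * h $ i) - quotient_coeff k ?\<zeta> u * (signed_power i ?\<zeta> * h $ i)))"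
          unfolding a_def by (intro sum.cong refl) (simp add: algebra_simps diff_divide_distrib)
        also have "\<dots> = (\<phi> ?\<zeta> * ?\<zeta> / (root_poly u ?\<zeta>)\<^sup>2) * (root_poly u ?\<zeta> * (\<Sum>i\<in>UNIV. n1 i ?\<zeta> * h $ i) - quotient_coeff k ?\<zeta> u * (\<Sum>i\<in>UNIV. signed_power i ?\<zeta> * h $ i))"
          unfolding sum_distrib_left[symmetric] by (simp only: sum_subtractf) (simp only: sum_distrib_left)
        finally show ?thesis by (simp add: power2_eq_square algebra_simps diff_divide_distrib)
      qed
      with 3 show ?thesis unfolding interp_weight_def by simp
    qed
  qed
qed

section \<open>The power kernel and its interpolation coefficients\<close>

definition power_kernel :: "real \<Rightarrow> complex \<Rightarrow> complex \<Rightarrow> complex" where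
  "power_kernel lam z w = (1 - z * cnj w) powr (- complex_of_real lam)"

lemma Re_kernel_base:
  assumes "cmod z < 1" "cmod w < 1"
  shows "0 < Re (1 - z * cnj w)"
proof -
  have "Re (z * cnj w) \<le> cmod (z * cnj w)" by (rule complex_Re_le_cmod)
  also have "\<dots> < 1 * 1" unfolding norm_mult complex_mod_cnj by (rule mult_strict_mono) (use assms in auto)
  finally show ?thesis by simp
qed

lemma kernel_base_not_nonpos:
  assumes "cmod z < 1" "cmod w < 1"
  shows "1 - z * cnj w \<notin> \<real>\<^sub>\<le>\<^sub>0"
  using Re_kernel_base[OF assms] by (auto simp: complex_nonpos_Reals_iff)

lemma cnj_power_kernel:
  assumes "cmod z < 1" "cmod w < 1"
  shows "cnj (power_kernel lam z w) = power_kernel lam w z"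
  using Re_kernel_base[OF assms] unfolding power_kernel_def by (subst cnj_powr) (auto simp: mult.commute)

lemma has_field_derivative_power_kernel:
  assumes "cmod z < 1" "cmod w < 1"
  shows "((\<lambda>z. power_kernel lam z w) has_field_derivative (lam * cnj w * power_kernel (lam + 1) z w)) (at z)"
proof -
  have "((\<lambda>z. 1 - z * cnj w) has_field_derivative (- cnj w)) (at z)"
    by (auto intro!: derivative_eq_intros)
  from DERIV_chain2[OF has_field_derivative_powr[OF kernel_base_not_nonpos[OF assms], of "- complex_of_real lam"] this]
  have "((\<lambda>z. power_kernel lam z w) has_field_derivative
    - complex_of_real lam * (1 - z * cnj w) powr (- complex_of_real lam - 1) * (- cnj w)) (at z)"
    by (simp add: power_kernel_def)
  moreover have "- complex_of_real lam * (1 - z * cnj w) powr (- complex_of_real lam - 1) * (- cnj w)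
    = lam * cnj w * power_kernel (lam + 1) z w"
  proof -
    have exponent: "- complex_of_real lam - 1 = - complex_of_real (lam + 1)" by simp
    show ?thesis unfolding power_kernel_def exponent
      by (simp only: mult_minus_left mult_minus_right minus_minus mult_ac)
  qed
  ultimately show ?thesis by (simp only:)
qed

lemma holomorphic_power_kernel:
  assumes "cmod w < 1"
  shows "(\<lambda>z. power_kernel lam z w) holomorphic_on ball 0 1"
  unfolding holomorphic_on_open[OF open_ball]
proof
  fix z :: complex assume "z \<in> ball 0 1"
  then have "((\<lambda>z. power_kernel lam z w) has_field_derivative (lam * cnj w * power_kernel (lam + 1) z w)) (at z)"
    using assms by (intro has_field_derivative_power_kernel) auto
  then show "\<exists>f'. ((\<lambda>z. power_kernel lam z w) has_field_derivative f') (at z)" by (rule exI)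
qed

lemma continuous_on_power_kernel [continuous_intros]:
  assumes "continuous_on S f" "continuous_on S g" "\<And>x. x \<in> S \<Longrightarrow> cmod (f x) < 1" "\<And>x. x \<in> S \<Longrightarrow> cmod (g x) < 1"
  shows "continuous_on S (\<lambda>x. power_kernel lam (f x) (g x))"
  unfolding power_kernel_def
proof (rule continuous_on_powr_complex)
  have pos: "0 < Re (1 - f x * cnj (g x))" if "x \<in> S" for x using assms that by (intro Re_kernel_base)
  show "S \<subseteq> {x. 0 \<le> Re (1 - f x * cnj (g x)) \<or> Im (1 - f x * cnj (g x)) \<noteq> 0}"
    using pos less_imp_le by blast
  show "0 < Re (- complex_of_real lam)" if "x \<in> S" "1 - f x * cnj (g x) = 0" for x
    using pos[OF that(1)] unfolding that(2) by simp
qed (use assms in \<open>auto intro!: continuous_intros\<close>)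

lemma norm_power_kernel_le:
  assumes "cmod z < 1" "cmod w \<le> R" "R < 1" "lam > 0"
  shows "cmod (power_kernel lam z w) \<le> (1 - R) powr (- lam)"
proof -
  have "cmod (z * cnj w) \<le> 1 * R" unfolding norm_mult complex_mod_cnj by (rule mult_mono) (use assms in auto)
  then have "1 - R \<le> cmod (1 - z * cnj w)" using norm_triangle_ineq2[of 1 "z * cnj w"] by simp
  then show ?thesis using assms
    by (simp add: power_kernel_def norm_powr_real_powr' powr_mono2')
qed

text \<open>
  Any radius that encloses the roots serves; all of them give the same interpolation coefficients.
\<close>
definition radius :: "complex^'d::{finite,wellorder} \<Rightarrow> real" where
  "radius u = (SOME R. 0 < R \<and> R < 1 \<and> roots_within R u)"

lemma radius:
  assumes "u \<in> symmetrized_polydisc"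
  shows "0 < radius u" "radius u < 1" "roots_within (radius u) u"
  using someI_ex[OF ex_roots_within[OF assms]] by (simp_all add: radius_def)

definition interp :: "(complex \<Rightarrow> complex) \<Rightarrow> complex^'d::{finite,wellorder} \<Rightarrow> 'd \<Rightarrow> complex" where
  "interp \<phi> u k = interp_coeff (radius u) \<phi> u k"

lemma roots_within_imp_mem: "roots_within R u \<Longrightarrow> R < 1 \<Longrightarrow> u \<in> symmetrized_polydisc"
  by (simp add: symmetrized_polydisc_eq roots_within_mono)

text \<open>
  Independence of the radius allows one fixed circle for all \<open>u\<close> in a neighbourhood, which is what
  differentiation in \<open>u\<close> needs.
\<close>
lemma interp_eq:
  assumes "\<phi> holomorphic_on ball 0 1" "0 < R" "R < 1" "roots_within R u"
  shows "interp \<phi> u k = interp_coeff R \<phi> u k"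
proof -
  note r = radius[OF roots_within_imp_mem[OF assms(4,3)]]
  show ?thesis
  proof (cases "R \<le> radius u")
    case True
    then show ?thesis unfolding interp_def using assms r by (intro interp_coeff_radius[symmetric])
  next
    case False
    then show ?thesis unfolding interp_def using assms r by (intro interp_coeff_radius) auto
  qed
qed

lemma interp_interpolates:
  assumes "\<phi> holomorphic_on ball 0 1" "z \<in> polydisc"
  shows "\<phi> (z $ i) = (\<Sum>k\<in>UNIV. signed_power k (z $ i) * interp \<phi> (symmetrization z) k)"
proof -
  have "symmetrization z \<in> symmetrized_polydisc" using assms(2) by (simp add: symmetrized_polydisc_def)
  note r = radius[OF this]
  show ?thesis unfolding interp_def
    by (rule interp_coeff_interpolates[OF assms(1) r]) (simp add: root_poly_symmetrization_eq_0)
qed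

lemma complex_linear_deriv_transform:
  assumes "complex_linear_deriv f z" "open S" "z \<in> S" "\<And>x. x \<in> S \<Longrightarrow> f x = g x"
  shows "complex_linear_deriv g z"
proof -
  obtain a where "(f has_derivative (\<lambda>h. \<Sum>i\<in>UNIV. a i * h $ i)) (at z)"
    using assms(1) by (rule complex_linear_derivE)
  then have "(g has_derivative (\<lambda>h. \<Sum>i\<in>UNIV. a i * h $ i)) (at z)"
    using assms(2-4) by (rule has_derivative_transform_within_open)
  then show ?thesis by (rule complex_linear_derivI)
qed

lemma complex_linear_deriv_interp:
  fixes u :: "complex^'d::{finite,wellorder}"
  assumes "\<phi> holomorphic_on ball 0 1" "u \<in> symmetrized_polydisc"
  shows "complex_linear_deriv (\<lambda>u. interp \<phi> u k) u"
proof (rule complex_linear_deriv_transform[where S="{v. roots_within (radius u) v}"])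
  note r = radius[OF assms(2)]
  show "complex_linear_deriv (\<lambda>v. interp_coeff (radius u) \<phi> v k) u"
    by (rule complex_linear_deriv_interp_coeff[OF assms(1) r])
  show "open {v. roots_within (radius u) v}" by (rule open_roots_within)
  show "u \<in> {v. roots_within (radius u) v}" using r by simp
  show "interp_coeff (radius u) \<phi> v k = interp \<phi> v k" if "v \<in> {v. roots_within (radius u) v}" for v
    using that r by (intro interp_eq[OF assms(1), symmetric]) auto
qed

text \<open>
  Interpolation coefficients of \<open>\<eta> \<mapsto> power_kernel lam \<zeta> \<eta>\<close>. This function is antiholomorphic, hence the
  conjugations; as a function of \<open>\<zeta>\<close> the coefficients are holomorphic.
\<close>
definition dual_coeff :: "real \<Rightarrow> complex^'d::{finite,wellorder} \<Rightarrow> 'd \<Rightarrow> complex \<Rightarrow> complex" where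
  "dual_coeff lam v l \<zeta> = cnj (interp (\<lambda>\<eta>. power_kernel lam \<eta> \<zeta>) v l)"

lemma dual_coeff_integral:
  fixes v :: "complex^'d::{finite,wellorder}"
  assumes "0 < R" "R < 1" "roots_within R v" "cmod \<zeta> < 1"
  shows "dual_coeff lam v l \<zeta> = integral {0..1} (\<lambda>x. power_kernel lam \<zeta> (circlepath 0 R x) * cnj (interp_weight R v l x))"
proof -
  have "dual_coeff lam v l \<zeta> = cnj (interp_coeff R (\<lambda>\<eta>. power_kernel lam \<eta> \<zeta>) v l)"
    unfolding dual_coeff_def using assms by (subst interp_eq[OF holomorphic_power_kernel, where R=R]) auto
  also have "\<dots> = integral {0..1} (\<lambda>x. cnj (power_kernel lam (circlepath 0 R x) \<zeta> * interp_weight R v l x))"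
    unfolding interp_coeff_def by (rule integral_cnj)
  also have "\<dots> = integral {0..1} (\<lambda>x. power_kernel lam \<zeta> (circlepath 0 R x) * cnj (interp_weight R v l x))"
    using assms by (intro integral_cong) (simp add: cnj_power_kernel norm_circlepath_0)
  finally show ?thesis .
qed

lemma holomorphic_dual_coeff:
  fixes v :: "complex^'d::{finite,wellorder}"
  assumes "v \<in> symmetrized_polydisc"
  shows "dual_coeff lam v l holomorphic_on ball 0 1"
proof -
  define R where "R = radius v"
  have r: "0 < R" "R < 1" "roots_within R v" using radius[OF assms] by (simp_all add: R_def)
  let ?c = "circlepath 0 R"
  have c: "cmod (?c x) < 1" for x using r by (simp add: norm_circlepath_0)
  have contw: "continuous_on S (\<lambda>p. interp_weight R v l (f p))" if "continuous_on S f" for S :: "'x::topological_space set" and f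
    using r that by (intro continuous_on_interp_weight) (auto intro!: continuous_intros)
  have "(\<lambda>\<zeta>. integral (cbox 0 1) (\<lambda>x. power_kernel lam \<zeta> (?c x) * cnj (interp_weight R v l x))) holomorphic_on ball 0 1"
  proof (rule leibniz_rule_holomorphic)
    show "((\<lambda>\<zeta>. power_kernel lam \<zeta> (?c x) * cnj (interp_weight R v l x)) has_field_derivative
       (lam * cnj (?c x) * power_kernel (lam + 1) \<zeta> (?c x) * cnj (interp_weight R v l x))) (at \<zeta> within ball 0 1)"
      if "\<zeta> \<in> ball 0 1" for \<zeta> x
      by (rule has_field_derivative_at_within, rule DERIV_cmult_right, rule has_field_derivative_power_kernel)
        (use that c in auto)
    show "(\<lambda>x. power_kernel lam \<zeta> (?c x) * cnj (interp_weight R v l x)) integrable_on cbox 0 1" if "\<zeta> \<in> ball 0 1" for \<zeta>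
      using that c by (auto intro!: integrable_continuous_real continuous_intros contw)
    show "continuous_on (ball 0 1 \<times> cbox 0 1)
      (\<lambda>(\<zeta>, x). lam * cnj (?c x) * power_kernel (lam + 1) \<zeta> (?c x) * cnj (interp_weight R v l x))"
      unfolding case_prod_unfold using c by (intro continuous_intros contw) auto
  qed simp
  then show ?thesis
    by (rule holomorphic_transform) (simp add: dual_coeff_integral[OF r])
qed

text \<open>
  Interpolation in the second variable of the kernel: the conjugates make the interpolated function
  holomorphic.
\<close>
lemma power_kernel_interpolation:
  assumes "w \<in> polydisc" "cmod \<zeta> < 1"
  shows "power_kernel lam \<zeta> (w $ j) = (\<Sum>l\<in>UNIV. dual_coeff lam (symmetrization w) l \<zeta> * cnj (signed_power l (w $ j)))"
proof -
  have "power_kernel lam \<zeta> (w $ j) = cnj (power_kernel lam (w $ j) \<zeta>)"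
    using assms by (subst cnj_power_kernel) (auto simp: polydisc_def)
  also have "\<dots> = cnj (\<Sum>k\<in>UNIV. signed_power k (w $ j) * interp (\<lambda>\<eta>. power_kernel lam \<eta> \<zeta>) (symmetrization w) k)"
    using interp_interpolates[OF holomorphic_power_kernel[OF assms(2)] assms(1), of lam j] by simp
  also have "\<dots> = (\<Sum>l\<in>UNIV. dual_coeff lam (symmetrization w) l \<zeta> * cnj (signed_power l (w $ j)))"
    by (simp add: dual_coeff_def mult.commute)
  finally show ?thesis .
qed

text \<open>
  The circle of integration stays away from the unit circle, so the kernel is bounded on it uniformly in
  \<open>\<zeta>\<close>, and the weights are bounded by compactness.
\<close>
lemma dual_coeff_bounded:
  fixes v :: "complex^'d::{finite,wellorder}"
  assumes "v \<in> symmetrized_polydisc" "lam > 0"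
  obtains e C where "e > 0" "ball v e \<subseteq> symmetrized_polydisc"
    "\<And>v' l \<zeta>. v' \<in> ball v e \<Longrightarrow> cmod \<zeta> < 1 \<Longrightarrow> cmod (dual_coeff lam v' l \<zeta>) \<le> C"
proof -
  define R where "R = radius v"
  have r: "0 < R" "R < 1" "roots_within R v" using radius[OF assms(1)] by (simp_all add: R_def)
  let ?c = "circlepath 0 R"
  obtain e where e: "e > 0" "cball v e \<subseteq> {v. roots_within R v}"
    using open_roots_within[of R] r(3) unfolding open_contains_cball by blast
  have "\<exists>B. \<forall>v'\<in>cball v e. \<forall>x\<in>{0..1}. cmod (interp_weight R v' l x) \<le> B" for l
  proof -
    have "continuous_on (cball v e \<times> {0..1}) (\<lambda>p. interp_weight R (fst p) l (snd p))"
      using r e by (intro continuous_on_interp_weight) (auto intro!: continuous_intros)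
    then have "compact ((\<lambda>p. interp_weight R (fst p) l (snd p)) ` (cball v e \<times> {0..1}))"
      by (intro compact_continuous_image compact_Times) auto
    then show ?thesis
      by (auto dest!: compact_imp_bounded simp: bounded_iff)
  qed
  then have "\<forall>l. \<exists>B. \<forall>v'\<in>cball v e. \<forall>x\<in>{0..1}. cmod (interp_weight R v' l x) \<le> B" by blast
  from choice[OF this] obtain B
    where B: "\<And>l v' x. v' \<in> cball v e \<Longrightarrow> x \<in> {0..1} \<Longrightarrow> cmod (interp_weight R v' l x) \<le> B l"
    by blast
  define C where "C = Max (range (\<lambda>l. (1 - R) powr (- lam) * B l))"
  have "cmod (dual_coeff lam v' l \<zeta>) \<le> C" if "v' \<in> ball v e" "cmod \<zeta> < 1" for v' l \<zeta>
  proof -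
    have v'2: "v' \<in> cball v e" using that by simp
    with e(2) have v'1: "roots_within R v'" by blast
    note v' = v'1 v'2
    have "cmod (dual_coeff lam v' l \<zeta>) \<le> (1 - R) powr (- lam) * B l * (1 - 0)"
      unfolding dual_coeff_integral[OF r(1,2) v'(1) that(2)]
    proof (rule integral_bound)
      show "continuous_on {0..1} (\<lambda>x. power_kernel lam \<zeta> (?c x) * cnj (interp_weight R v' l x))"
        using r v' that by (auto intro!: continuous_intros continuous_on_interp_weight simp: norm_circlepath_0)
      show "cmod (power_kernel lam \<zeta> (?c x) * cnj (interp_weight R v' l x)) \<le> (1 - R) powr (- lam) * B l" if x: "x \<in> {0..1}" for x
        unfolding norm_mult complex_mod_cnj
        using x r v' \<open>cmod \<zeta> < 1\<close> assms(2) by (intro mult_mono norm_power_kernel_le B) (auto simp: norm_circlepath_0)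
    qed simp
    also have "\<dots> \<le> C" unfolding C_def by (simp, intro Max_ge) auto
    finally show ?thesis .
  qed
  moreover have "ball v e \<subseteq> symmetrized_polydisc" 
  proof
    fix y assume "y \<in> ball v e"
    then have "y \<in> cball v e" by simp
    with e(2) have "roots_within R y" by blast
    then show "y \<in> symmetrized_polydisc" using r(2) by (rule roots_within_imp_mem)
  qed
  ultimately show ?thesis using e(1) by (intro that[of e C]) auto
qed

lemma isCont_dual_coeff:
  fixes v :: "complex^'d::{finite,wellorder}"
  assumes "v \<in> symmetrized_polydisc" "cmod \<zeta> < 1"
  shows "isCont (\<lambda>v. dual_coeff lam v l \<zeta>) v"
proof -
  obtain a where "((\<lambda>u. interp (\<lambda>\<eta>. power_kernel lam \<eta> \<zeta>) u l) has_derivative (\<lambda>h. \<Sum>i\<in>UNIV. a i * h $ i)) (at v)"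
    using complex_linear_deriv_interp[OF holomorphic_power_kernel[OF assms(2)] assms(1)] by (rule complex_linear_derivE)
  then have "isCont (\<lambda>u. interp (\<lambda>\<eta>. power_kernel lam \<eta> \<zeta>) u l) v" by (rule has_derivative_continuous)
  then show ?thesis unfolding dual_coeff_def by (rule isCont_cnj)
qed

text \<open>
  The kernel determinant divided by the conjugate Vandermonde determinant of the second variable, as a
  function that is also defined where the latter vanishes.
\<close>
definition half_det :: "real \<Rightarrow> complex^'d::{finite,wellorder} \<Rightarrow> complex^'d::{finite,wellorder} \<Rightarrow> complex" where
  "half_det lam z v = det (\<chi> i l. dual_coeff lam v l (z $ i))"

text \<open>
  The kernel determinant divided by both Vandermonde determinants, as a function on the symmetrized
  polydisc in both variables.
\<close>
definition sym_kernel :: "real \<Rightarrow> complex^'d::{finite,wellorder} \<Rightarrow> complex^'d::{finite,wellorder} \<Rightarrow> complex" where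
  "sym_kernel lam u v = det (\<chi> k l. interp (dual_coeff lam v l) u k)"

text \<open>
  Interpolation in the first variable.
\<close>
lemma half_det_eq:
  assumes "z \<in> polydisc" "v \<in> symmetrized_polydisc"
  shows "half_det lam z v = vandermonde z * sym_kernel lam (symmetrization z) v"
proof -
  have "(\<chi> i l. dual_coeff lam v l (z $ i)) = vandermonde_matrix z ** (\<chi> k l. interp (dual_coeff lam v l) (symmetrization z) k)"
    using interp_interpolates[OF holomorphic_dual_coeff[OF assms(2)] assms(1)]
    by (simp add: vec_eq_iff matrix_matrix_mult_def vandermonde_matrix_def)
  then show ?thesis by (simp add: half_det_def sym_kernel_def vandermonde_def det_mul)
qed

lemma cnj_det: "cnj (det M) = det (\<chi> i j. cnj (M $ i $ j))"
  by (simp add: det_def)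

text \<open>
  Interpolation in the second variable.
\<close>
lemma power_kernel_det_eq:
  assumes "z \<in> polydisc" "w \<in> polydisc"
  shows "power_kernel_det lam z w = half_det lam z (symmetrization w) * cnj (vandermonde w)"
proof -
  have z: "cmod (z $ i) < 1" for i using assms(1) by (simp add: polydisc_def)
  have "(\<chi> i j. (1 - z $ i * cnj (w $ j)) powr (- complex_of_real lam)) = (\<chi> i j. power_kernel lam (z $ i) (w $ j))"
    by (simp add: power_kernel_def)
  also have "\<dots> = (\<chi> i l. dual_coeff lam (symmetrization w) l (z $ i)) ** transpose (\<chi> i j. cnj (vandermonde_matrix w $ i $ j))"
    by (simp add: vec_eq_iff matrix_matrix_mult_def vandermonde_matrix_def transpose_def power_kernel_interpolation[OF assms(2) z])
  finally show ?thesis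
    by (simp add: power_kernel_det_def half_det_def vandermonde_def det_mul cnj_det)
qed

lemma power_kernel_det_factorization:
  assumes "z \<in> polydisc" "w \<in> polydisc"
  shows "power_kernel_det lam z w = sym_kernel lam (symmetrization z) (symmetrization w) * vandermonde_product z w"
proof -
  have "symmetrization w \<in> symmetrized_polydisc" using assms by (simp add: symmetrized_polydisc_def)
  then show ?thesis using assms
    by (simp add: power_kernel_det_eq half_det_eq vandermonde_product_eq)
qed

lemma holomorphic_sym_kernel:
  assumes "v \<in> symmetrized_polydisc"
  shows "holomorphic_cn_on (\<lambda>u. sym_kernel lam u v) symmetrized_polydisc"
  unfolding holomorphic_cn_on_iff sym_kernel_def
  by (intro ballI complex_linear_deriv_det) (simp add: complex_linear_deriv_interp[OF holomorphic_dual_coeff[OF assms]])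

lemma norm_det_le:
  fixes M :: "complex^'n^'n"
  assumes "\<And>i j. cmod (M $ i $ j) \<le> C"
  shows "cmod (det M) \<le> fact CARD('n) * C ^ CARD('n)"
proof -
  have "cmod (det M) \<le> (\<Sum>p\<in>{p. p permutes (UNIV :: 'n set)}. cmod (of_int (sign p) * (\<Prod>i\<in>UNIV. M $ i $ p i)))"
    unfolding det_def by (rule norm_sum)
  also have "\<dots> \<le> (\<Sum>p\<in>{p. p permutes (UNIV :: 'n set)}. C ^ CARD('n))"
  proof (rule sum_mono)
    fix p :: "'n \<Rightarrow> 'n"
    have "(\<Prod>i\<in>UNIV. cmod (M $ i $ p i)) \<le> (\<Prod>i\<in>(UNIV :: 'n set). C)"
      using assms by (intro prod_mono) auto
    then show "cmod (of_int (sign p) * (\<Prod>i\<in>UNIV. M $ i $ p i)) \<le> C ^ CARD('n)"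
      by (simp add: norm_mult prod_norm sign_def)
  qed
  also have "\<dots> = fact CARD('n) * C ^ CARD('n)"
    by (simp add: card_permutations[of UNIV "CARD('n)"])
  finally show ?thesis .
qed

lemma half_det_locally_bounded:
  fixes v :: "complex^'d::{finite,wellorder}"
  assumes "v \<in> symmetrized_polydisc" "lam > 0"
  shows "\<exists>e C. e > 0 \<and> ball v e \<subseteq> symmetrized_polydisc \<and>
    (\<forall>v'\<in>ball v e. \<forall>z\<in>polydisc. cmod (half_det lam z v') \<le> C)"
proof -
  obtain e C where e: "e > 0" "ball v e \<subseteq> symmetrized_polydisc"
    and C: "\<And>v' l \<zeta>. v' \<in> ball v e \<Longrightarrow> cmod \<zeta> < 1 \<Longrightarrow> cmod (dual_coeff lam v' l \<zeta>) \<le> C"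
    using dual_coeff_bounded[OF assms] by blast
  have "cmod (half_det lam z v') \<le> fact CARD('d) * C ^ CARD('d)"
    if "v' \<in> ball v e" "z \<in> polydisc" for v' z :: "complex^'d::{finite,wellorder}"
    using that unfolding half_det_def by (intro norm_det_le) (simp add: C polydisc_def)
  with e show ?thesis by blast
qed

lemma isCont_half_det:
  assumes "v \<in> symmetrized_polydisc" "z \<in> polydisc"
  shows "isCont (\<lambda>v. half_det lam z v) v"
proof -
  have "isCont (\<lambda>v. dual_coeff lam v l (z $ i)) v" for l i
    using assms by (intro isCont_dual_coeff) (auto simp: polydisc_def)
  then show ?thesis unfolding half_det_def det_def vec_lambda_beta by (intro continuous_intros) simp
qed

lemma continuous_on_half_det:
  assumes "v \<in> symmetrized_polydisc"
  shows "continuous_on polydisc (\<lambda>z. half_det lam z v)"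
proof -
  have "continuous_on polydisc (\<lambda>z. dual_coeff lam v l (z $ i))" for l i
    by (rule continuous_on_compose2[OF holomorphic_on_imp_continuous_on[OF holomorphic_dual_coeff[OF assms]]])
      (auto intro!: continuous_intros simp: polydisc_def)
  then show ?thesis unfolding half_det_def det_def vec_lambda_beta by (intro continuous_intros) simp
qed

section \<open>Weight and automorphisms of the polydisc\<close>

text \<open>
  The image of Lebesgue measure on the disc under \<open>1 - |z|\<^sup>2\<close> is \<open>pi\<close> times Lebesgue measure on the
  unit interval, because discs of radius \<open>r\<close> have area \<open>pi r\<^sup>2\<close>.
\<close>
lemma nn_integral_disc_weight:
  fixes a :: real
  assumes "a > -1"
  shows "(\<integral>\<^sup>+ z. ennreal (indicator (ball 0 1) z * (1 - (cmod z)\<^sup>2) powr a) \<partial>lborel) = ennreal (pi / (a + 1))"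
proof -
  define N where "N = distr (density lborel (indicator (ball 0 1))) borel (\<lambda>z. 1 - (cmod z)\<^sup>2)"
  define N' where "N' = density lborel (\<lambda>t :: real. ennreal (pi * indicator {0..1} t))"
  have [measurable, simp]: "ball (0 :: complex) 1 \<in> sets borel" by (rule borel_open) simp
  have [measurable]: "(\<lambda>z. 1 - (cmod z)\<^sup>2) \<in> borel_measurable borel" by simp
  have disc: "emeasure lborel (ball (0::complex) r) = ennreal (pi * r\<^sup>2)" if "r \<ge> 0" for r
    using that by (simp add: emeasure_ball unit_ball_vol_2)
  have NN: "emeasure N {x<..} = ennreal (pi * (if x < 0 then 1 else if x < 1 then 1 - x else 0))" for x
  proof -
    have "emeasure N {x<..} = emeasure (density lborel (indicator (ball 0 1))) ((\<lambda>z. 1 - (cmod z)\<^sup>2) -` {x<..} \<inter> space (density lborel (indicator (ball (0::complex) 1))))"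
      unfolding N_def by (rule emeasure_distr) auto
    also have "\<dots> = emeasure lborel (ball 0 1 \<inter> {z. x < 1 - (cmod z)\<^sup>2})"
      proof (subst emeasure_density)
      let ?A = "(\<lambda>z. 1 - (cmod z)\<^sup>2) -` {x<..} \<inter> space (density lborel (indicator (ball (0::complex) 1)))"
      have A: "?A = {z. x < 1 - (cmod z)\<^sup>2}" by auto
      have m: "{z :: complex. x < 1 - (cmod z)\<^sup>2} \<in> sets borel" by measurable
      show "(indicator (ball 0 1) :: complex \<Rightarrow> ennreal) \<in> borel_measurable lborel" by simp
      show "?A \<in> sets lborel" unfolding A using m by simp
      have "(\<integral>\<^sup>+ z. indicator (ball 0 1) z * indicator ?A z \<partial>lborel) = (\<integral>\<^sup>+ z. indicator (ball 0 1 \<inter> {z. x < 1 - (cmod z)\<^sup>2}) z \<partial>lborel)"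
        unfolding A by (simp only: indicator_inter_arith)
      also have "\<dots> = emeasure lborel (ball 0 1 \<inter> {z. x < 1 - (cmod z)\<^sup>2})"
        using m by (intro nn_integral_indicator) auto
      finally show "(\<integral>\<^sup>+ z. indicator (ball 0 1) z * indicator ?A z \<partial>lborel) = emeasure lborel (ball 0 1 \<inter> {z. x < 1 - (cmod z)\<^sup>2})" .
    qed
    also have "ball 0 1 \<inter> {z. x < 1 - (cmod z)\<^sup>2} = ball (0::complex) (if x < 0 then 1 else if x < 1 then sqrt (1 - x) else 0)"
    proof -
      have "cmod z < 1 \<and> x < 1 - (cmod z)\<^sup>2 \<longleftrightarrow> cmod z < (if x < 0 then 1 else if x < 1 then sqrt (1 - x) else 0)" for z
      proof -
        have 1: "cmod z < 1 \<longleftrightarrow> (cmod z)\<^sup>2 < 1" by (simp add: power_less_one_iff)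
        have 2: "cmod z < sqrt (1 - x) \<longleftrightarrow> (cmod z)\<^sup>2 < 1 - x" if "x < 1"
          using real_less_rsqrt real_sqrt_less_iff[of "(cmod z)\<^sup>2" "1 - x"] by simp
        have 3: "0 \<le> (cmod z)\<^sup>2" by simp
        show ?thesis
        proof (cases "x < 0")
          case True then show ?thesis using 1 by auto
        next
          case False
          show ?thesis
          proof (cases "x < 1")
            case True with False show ?thesis using 1 2[OF True] by auto
          next
            case F2: False
            then have "\<not> x < 1 - (cmod z)\<^sup>2" using 3 by linarith
            moreover have "\<not> cmod z < 0" by simp
            ultimately show ?thesis using False F2 by argo
          qed
        qed
      qed
      then show ?thesis by (intro set_eqI) (simp only: Int_iff mem_Collect_eq mem_ball dist_0_norm)
    qed
    also have "emeasure lborel \<dots> = ennreal (pi * (if x < 0 then 1 else if x < 1 then 1 - x else 0))"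
      by (subst disc) auto
    finally show ?thesis .
  qed
  have NN': "emeasure N' {x<..} = ennreal (pi * (if x < 0 then 1 else if x < 1 then 1 - x else 0))" for x
  proof -
    have "emeasure N' {x<..} = (\<integral>\<^sup>+ t. ennreal pi * indicator ({0..1} \<inter> {x<..}) t \<partial>lborel)"
      unfolding N'_def by (subst emeasure_density) (auto intro!: nn_integral_cong split: split_indicator)
    also have "\<dots> = ennreal pi * emeasure lborel ({0..1} \<inter> {x<..})" by (simp add: nn_integral_cmult)
    also have "{0..1} \<inter> {x<..} = (if x < 0 then {0..1} else if x < 1 then {x<..1} else {})" by auto
    also have "emeasure lborel \<dots> = ennreal (if x < 0 then 1 else if x < 1 then 1 - x else 0)" by auto
    finally show ?thesis by (simp add: ennreal_mult'')
  qed
  have "N = N'"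
    by (rule measure_eqI_lessThan) (simp_all add: NN NN', simp_all add: N_def N'_def)
  have "(\<integral>\<^sup>+ z. ennreal (indicator (ball 0 1) z * (1 - (cmod z)\<^sup>2) powr a) \<partial>lborel)
      = (\<integral>\<^sup>+ z. indicator (ball 0 1) z * ennreal ((1 - (cmod z)\<^sup>2) powr a) \<partial>lborel)"
    by (auto intro!: nn_integral_cong split: split_indicator)
  also have "\<dots> = (\<integral>\<^sup>+ z. ennreal ((1 - (cmod z)\<^sup>2) powr a) \<partial>density lborel (indicator (ball 0 1)))"
    by (subst nn_integral_density) auto
  also have "\<dots> = (\<integral>\<^sup>+ t. ennreal (t powr a) \<partial>N)" unfolding N_def by (subst nn_integral_distr) auto
  also have "\<dots> = (\<integral>\<^sup>+ t. ennreal (pi * (if t \<in> {0..1} then t powr a else 0)) \<partial>lborel)"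
    unfolding \<open>N = N'\<close> N'_def by (subst nn_integral_density) (auto intro!: nn_integral_cong split: split_indicator simp: ennreal_mult'' ennreal_mult)
  also have "\<dots> = ennreal (pi * (1 / (a + 1)))"
  proof (rule nn_integral_has_integral_lborel)
    have "((\<lambda>t. t powr a) has_integral (1 powr (a + 1) / (a + 1))) {0..1::real}"
      using assms by (intro has_integral_powr_from_0) auto
    then have "((\<lambda>t. if t \<in> {0..1} then t powr a else 0) has_integral (1 / (a + 1))) UNIV"
      by (subst has_integral_restrict_UNIV) simp
    then show "((\<lambda>t. pi * (if t \<in> {0..1::real} then t powr a else 0)) has_integral (pi * (1 / (a + 1)))) UNIV"
      by (rule has_integral_mult_right)
  qed auto
  finally show ?thesis by simp
qed

lemma measurable_vec_lambda:
  "(\<lambda>f. \<chi> j. f j) \<in> (\<Pi>\<^sub>M j\<in>(UNIV :: 'n::finite set). (lborel :: complex measure)) \<rightarrow>\<^sub>M borel"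
proof -
  have ax: "(\<lambda>c :: complex. axis j c :: complex^'n) \<in> borel_measurable borel" for j
    unfolding axis_def
    by (intro borel_measurable_continuous_onI continuous_on_vec_lambda continuous_on_if_const continuous_on_id)
  have "(\<lambda>f. axis j (f j) :: complex^'n) \<in> borel_measurable (\<Pi>\<^sub>M j\<in>(UNIV :: 'n set). (lborel :: complex measure))" for j
    by (rule measurable_compose[OF _ ax]) (use measurable_component_singleton[of j UNIV "\<lambda>_. lborel :: complex measure"] in simp)
  then have "(\<lambda>f. \<Sum>j\<in>UNIV. axis j (f j) :: complex^'n) \<in> borel_measurable (\<Pi>\<^sub>M j\<in>(UNIV :: 'n set). (lborel :: complex measure))"
    by (intro borel_measurable_sum) auto
  moreover have "(\<Sum>j\<in>UNIV. axis j (f j)) = (\<chi> j. f j)" for f :: "'n \<Rightarrow> complex"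
    by (simp add: vec_eq_iff axis_def if_distrib if_distribR cong: if_cong)
  ultimately show ?thesis by simp
qed

text \<open>
  Both measures give the same volume to boxes. This makes Fubini's theorem available for products of
  functions of the single coordinates.
\<close>
lemma lborel_vec_eq_PiM:
  "(lborel :: (complex^'n) measure) = distr (\<Pi>\<^sub>M j\<in>(UNIV :: 'n set). (lborel :: complex measure)) borel (\<lambda>f. \<chi> j. f j)"
proof (rule lborel_eqI)
  interpret product_sigma_finite "\<lambda>_ :: 'n. lborel :: complex measure" ..
  note meas = measurable_vec_lambda[where 'n='n]
  fix l u :: "complex^'n" assume le: "\<And>b. b \<in> Basis \<Longrightarrow> l \<bullet> b \<le> u \<bullet> b"
  have le': "l $ j \<bullet> c \<le> u $ j \<bullet> c" if "c \<in> Basis" for j c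
    using le[of "axis j c"] that by (auto simp: inner_axis axis_in_Basis_iff)
  have box: "box l u = {x. \<forall>j. x $ j \<in> box (l $ j) (u $ j)}"
    by (auto simp: box_def Basis_vec_def inner_axis)
  have "emeasure (distr (\<Pi>\<^sub>M j\<in>(UNIV :: 'n set). lborel) borel (\<lambda>f. \<chi> j. f j)) (box l u)
     = emeasure (\<Pi>\<^sub>M j\<in>(UNIV :: 'n set). lborel) (\<Pi>\<^sub>E j\<in>UNIV. box (l $ j) (u $ j))"
    by (subst emeasure_distr[OF meas borel_open[OF open_box]])
      (auto simp: box space_PiM PiE_def Pi_def intro!: arg_cong[where f="emeasure _"])
  also have "\<dots> = (\<Prod>j\<in>UNIV. emeasure lborel (box (l $ j) (u $ j)))"
    by (rule emeasure_PiM) auto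
  also have "\<dots> = (\<Prod>j\<in>UNIV. ennreal (\<Prod>c\<in>Basis. (u $ j - l $ j) \<bullet> c))"
    using le' by (intro prod.cong refl) (simp add: emeasure_lborel_box_eq)
  also have "\<dots> = ennreal (\<Prod>j\<in>UNIV. \<Prod>c\<in>Basis. (u $ j - l $ j) \<bullet> c)"
    using le' by (intro prod_ennreal prod_nonneg) (auto simp: inner_diff_left)
  also have "(\<Prod>j\<in>UNIV. \<Prod>c\<in>Basis. (u $ j - l $ j) \<bullet> c) = (\<Prod>(j, c)\<in>UNIV \<times> Basis. (u $ j - l $ j) \<bullet> c)"
    by (rule prod.cartesian_product)
  also have "\<dots> = (\<Prod>b\<in>Basis. (u - l) \<bullet> b)"
  proof (rule prod.reindex_bij_betw[where h="\<lambda>(j, c). axis j c" and g="\<lambda>b. (u - l) \<bullet> b", THEN trans[rotated]])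
    show "bij_betw (\<lambda>(j, c). axis j c) (UNIV \<times> Basis) (Basis :: (complex^'n) set)"
      by (auto simp: bij_betw_def inj_on_def Basis_vec_def axis_eq_axis)
    show "(\<Prod>(j, c)\<in>UNIV \<times> Basis. (u $ j - l $ j) \<bullet> c) = (\<Prod>x\<in>UNIV \<times> Basis. (u - l) \<bullet> (case x of (j, c) \<Rightarrow> axis j c))"
      by (intro prod.cong refl) (auto simp: inner_axis)
  qed
  finally show "emeasure (distr (\<Pi>\<^sub>M j\<in>(UNIV :: 'n set). lborel) borel (\<lambda>f. \<chi> j. f j)) (box l u) = ennreal (\<Prod>b\<in>Basis. (u - l) \<bullet> b)" .
qed simp

lemma open_polydisc: "open (polydisc :: (complex^'n) set)"
proof -
  have "polydisc = (\<Inter>i\<in>UNIV. {z :: complex^'n. cmod (z $ i) < 1})" by (auto simp: polydisc_def)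
  also have "open \<dots>" by (intro open_INT ballI open_Collect_less continuous_intros) auto
  finally show ?thesis .
qed

lemma polydisc_sets [simp]: "polydisc \<in> sets borel" "polydisc \<in> sets lebesgue"
proof -
  show "polydisc \<in> sets borel" using open_polydisc by (rule borel_open)
  then show "polydisc \<in> sets lebesgue" by (intro sets_completionI_sets) simp
qed

lemma disc_weight_pos: "cmod z < 1 \<Longrightarrow> 0 < 1 - (cmod z)\<^sup>2"
  by (simp add: power_less_one_iff)

lemma disc_weight_nz: "cmod z < 1 \<Longrightarrow> 1 - (cmod z)\<^sup>2 \<noteq> 0"
  using disc_weight_pos by force

lemma continuous_on_polydisc_weight: "continuous_on polydisc (polydisc_weight lam)"
  unfolding polydisc_weight_def[abs_def]
proof (intro continuous_intros ballI)
  fix j z assume "z \<in> polydisc"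
  then show "1 - (cmod (z $ j))\<^sup>2 \<noteq> 0" by (intro disc_weight_nz) (simp add: polydisc_def)
qed

lemma polydisc_weight_pos: "z \<in> polydisc \<Longrightarrow> 0 < polydisc_weight lam z"
  unfolding polydisc_weight_def powr_gt_zero by (intro prod_pos) (simp add: polydisc_def disc_weight_nz del: right_minus_eq)

lemma nn_integral_polydisc_weight:
  assumes "lam > 1"
  shows "(\<integral>\<^sup>+ z. ennreal (indicator polydisc z * polydisc_weight lam z) \<partial>(lborel :: (complex^'n) measure)) = ennreal ((pi / (lam - 1)) ^ CARD('n))"
proof -
  interpret product_sigma_finite "\<lambda>_ :: 'n. lborel :: complex measure" ..
  define g where "g = (\<lambda>z :: complex. ennreal (indicator (ball 0 1) z * (1 - (cmod z)\<^sup>2) powr (lam - 2)))"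
  have [measurable]: "ball (0 :: complex) 1 \<in> sets borel" by (rule borel_open) simp
  have [measurable]: "g \<in> borel_measurable borel" unfolding g_def by simp
  have split: "ennreal (indicator polydisc z * polydisc_weight lam z) = (\<Prod>j\<in>UNIV. g (z $ j))" for z :: "complex^'n"
  proof (cases "z \<in> polydisc")
    case True
    then have "(\<Prod>j\<in>UNIV. g (z $ j)) = (\<Prod>j\<in>UNIV. ennreal ((1 - (cmod (z $ j))\<^sup>2) powr (lam - 2)))"
      by (intro prod.cong refl) (auto simp: g_def polydisc_def)
    also have "\<dots> = ennreal (polydisc_weight lam z)"
      unfolding polydisc_weight_def by (rule prod_ennreal) auto
    finally show ?thesis using True by simp
  next
    case False
    then obtain j where "z $ j \<notin> ball 0 1" by (auto simp: polydisc_def)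
    then have "g (z $ j) = 0" by (simp add: g_def)
    then have "(\<Prod>j\<in>UNIV. g (z $ j)) = 0" by (intro prod_zero) auto
    with False show ?thesis by simp
  qed
  have comp: "(\<lambda>z :: complex^'n. z $ j) \<in> borel_measurable borel" for j
    by (intro borel_measurable_continuous_onI continuous_intros)
  note meas = measurable_vec_lambda[where 'n='n]
  have "(\<integral>\<^sup>+ z. ennreal (indicator polydisc z * polydisc_weight lam z) \<partial>(lborel :: (complex^'n) measure))
    = (\<integral>\<^sup>+ z. (\<Prod>j\<in>UNIV. g (z $ j)) \<partial>distr (\<Pi>\<^sub>M j\<in>(UNIV :: 'n set). lborel) borel (\<lambda>f. \<chi> j. f j))"
    unfolding split lborel_vec_eq_PiM ..
  also have "\<dots> = (\<integral>\<^sup>+ f. (\<Prod>j\<in>UNIV. g (f j)) \<partial>(\<Pi>\<^sub>M j\<in>(UNIV :: 'n set). lborel))"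
    using comp by (subst nn_integral_distr[OF meas]) auto
  also have "\<dots> = (\<Prod>j\<in>(UNIV :: 'n set). \<integral>\<^sup>+ z. g z \<partial>lborel)"
    by (rule product_nn_integral_prod) auto
  also have "(\<integral>\<^sup>+ z. g z \<partial>lborel) = ennreal (pi / (lam - 1))"
    using nn_integral_disc_weight[of "lam - 2"] assms by (simp add: g_def)
  finally show ?thesis using assms by (simp add: ennreal_power)
qed

lemma polydisc_weight_integral:
  assumes "lam > 1"
  shows "polydisc_weight lam absolutely_integrable_on (polydisc :: (complex^'n) set)"
    and "integral (polydisc :: (complex^'n) set) (polydisc_weight lam) = (pi / (lam - 1)) ^ CARD('n)"
proof -
  have m: "(\<lambda>z :: complex^'n. indicator polydisc z *\<^sub>R polydisc_weight lam z) \<in> borel_measurable borel"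
    by (intro borel_measurable_continuous_on_indicator continuous_on_polydisc_weight polydisc_sets)
  have nn: "0 \<le> indicator polydisc z *\<^sub>R polydisc_weight lam z" for z :: "complex^'n"
    by (simp add: indicator_def polydisc_weight_pos less_imp_le)
  have "has_bochner_integral lborel (\<lambda>z :: complex^'n. indicator polydisc z *\<^sub>R polydisc_weight lam z) ((pi / (lam - 1)) ^ CARD('n))"
    using nn_integral_polydisc_weight[OF assms, where 'n='n] m nn assms
    by (intro has_bochner_integral_nn_integral) auto
  then have i: "integrable lborel (\<lambda>z :: complex^'n. indicator polydisc z *\<^sub>R polydisc_weight lam z)"
    and e: "integral\<^sup>L lborel (\<lambda>z :: complex^'n. indicator polydisc z *\<^sub>R polydisc_weight lam z) = (pi / (lam - 1)) ^ CARD('n)"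
    by (auto simp: has_bochner_integral_iff)
  show "polydisc_weight lam absolutely_integrable_on (polydisc :: (complex^'n) set)"
    using i m unfolding set_integrable_def by (subst integrable_completion) auto
  show "integral (polydisc :: (complex^'n) set) (polydisc_weight lam) = (pi / (lam - 1)) ^ CARD('n)"
    using set_borel_integral_eq_integral(2)[of "polydisc :: (complex^'n) set" "polydisc_weight lam"] i e
    unfolding set_integrable_def set_lebesgue_integral_def by simp
qed

text \<open>
  The involutive automorphism of the disc that exchanges \<open>w\<close> and 0.
\<close>
definition moebius :: "complex \<Rightarrow> complex \<Rightarrow> complex" where
  "moebius w \<zeta> = (w - \<zeta>) / (1 - cnj w * \<zeta>)"

context
  fixes w \<zeta> :: complex
  assumes w: "cmod w < 1" and \<zeta>: "cmod \<zeta> < 1"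
begin

lemma moebius_denominator: "1 - cnj w * \<zeta> \<noteq> 0"
proof
  assume "1 - cnj w * \<zeta> = 0"
  then have "1 - \<zeta> * cnj w = 0" by (simp only: mult.commute)
  then show False using Re_kernel_base[OF \<zeta> w] by (simp only: zero_complex.sel less_irrefl)
qed

lemma moebius_weight: "1 - (cmod (moebius w \<zeta>))\<^sup>2 = (1 - (cmod w)\<^sup>2) * (1 - (cmod \<zeta>)\<^sup>2) / (cmod (1 - cnj w * \<zeta>))\<^sup>2"
proof -
  have nz: "(cmod (1 - cnj w * \<zeta>))\<^sup>2 \<noteq> 0" using moebius_denominator by simp
  have "(cmod (1 - cnj w * \<zeta>))\<^sup>2 - (cmod (w - \<zeta>))\<^sup>2 = (1 - (cmod w)\<^sup>2) * (1 - (cmod \<zeta>)\<^sup>2)"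
    unfolding cmod_power2 by (simp add: power2_eq_square algebra_simps)
  then show ?thesis using nz by (simp add: moebius_def norm_divide power_divide field_simps)
qed

lemma moebius_in_disc: "cmod (moebius w \<zeta>) < 1"
proof -
  have "0 < 1 - (cmod (moebius w \<zeta>))\<^sup>2"
    unfolding moebius_weight using w \<zeta> moebius_denominator by (intro divide_pos_pos mult_pos_pos disc_weight_pos) auto
  then show ?thesis by (simp add: power_less_one_iff)
qed

lemma moebius_involution: "moebius w (moebius w \<zeta>) = \<zeta>"
proof -
  have nz: "1 - cnj w * \<zeta> \<noteq> 0" by (rule moebius_denominator)
  have a: "1 - cnj w * w \<noteq> 0"
  proof
    assume "1 - cnj w * w = 0"
    then have "1 - w * cnj w = 0" by (simp only: mult.commute)
    then show False using Re_kernel_base[OF w w] by (simp only: zero_complex.sel less_irrefl)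
  qed
  have "w - moebius w \<zeta> = \<zeta> * (1 - cnj w * w) / (1 - cnj w * \<zeta>)"
    using nz by (simp add: moebius_def field_simps)
  moreover have "1 - cnj w * moebius w \<zeta> = (1 - cnj w * w) / (1 - cnj w * \<zeta>)"
    using nz by (simp add: moebius_def field_simps)
  ultimately show ?thesis using nz a by (subst moebius_def) simp
qed

lemma has_field_derivative_moebius:
  "(moebius w has_field_derivative (- of_real (1 - (cmod w)\<^sup>2) / (1 - cnj w * \<zeta>)\<^sup>2)) (at \<zeta>)"
proof -
  have nz: "1 - cnj w * \<zeta> \<noteq> 0" by (rule moebius_denominator)
  have "(moebius w has_field_derivative (((- 1) * (1 - cnj w * \<zeta>) - (w - \<zeta>) * (- cnj w)) / ((1 - cnj w * \<zeta>) * (1 - cnj w * \<zeta>)))) (at \<zeta>)"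
    unfolding moebius_def[abs_def] using nz by (auto intro!: derivative_eq_intros)
  moreover have "((- 1) * (1 - cnj w * \<zeta>) - (w - \<zeta>) * (- cnj w)) = - of_real (1 - (cmod w)\<^sup>2)"
    using complex_norm_square[of w] by (simp add: algebra_simps)
  ultimately show ?thesis unfolding power2_eq_square[of "1 - cnj w * \<zeta>"] by (simp only:)
qed

text \<open>
  With \<open>b = 1 - cnj w \<zeta>\<close> and \<open>c = (1 - |w|\<^sup>2) / |b|\<^sup>2 > 0\<close> the Jacobian is \<open>c\<^sup>2\<close>, the weight acquires
  the factor \<open>c powr (lam - 2)\<close>, and \<open>1 - w cnj (moebius w \<zeta>) = c b\<close>, so the kernel acquires the factor
  \<open>c powr - lam\<close>. The powers of \<open>c\<close> cancel.
\<close>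
lemma moebius_kernel:
  "complex_of_real ((cmod (of_real (1 - (cmod w)\<^sup>2) / (1 - cnj w * \<zeta>)\<^sup>2))\<^sup>2) * cnj (power_kernel lam (moebius w \<zeta>) w)
      * of_real ((1 - (cmod (moebius w \<zeta>))\<^sup>2) powr (lam - 2))
    = power_kernel lam \<zeta> w * of_real ((1 - (cmod \<zeta>)\<^sup>2) powr (lam - 2))"
proof -
  define b where "b = 1 - cnj w * \<zeta>"
  define c where "c = (1 - (cmod w)\<^sup>2) / (cmod b)\<^sup>2"
  have nz: "b \<noteq> 0" unfolding b_def by (rule moebius_denominator)
  have apos: "0 < 1 - (cmod w)\<^sup>2" using w by (rule disc_weight_pos)
  have zpos: "0 < 1 - (cmod \<zeta>)\<^sup>2" using \<zeta> by (rule disc_weight_pos)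
  have cpos: "c > 0" unfolding c_def using apos nz by simp
  have jac: "(cmod (of_real (1 - (cmod w)\<^sup>2) / b\<^sup>2))\<^sup>2 = c\<^sup>2"
    unfolding c_def norm_divide norm_power norm_of_real abs_of_pos[OF apos] ..
  have wt: "1 - (cmod (moebius w \<zeta>))\<^sup>2 = c * (1 - (cmod \<zeta>)\<^sup>2)"
    unfolding moebius_weight b_def[symmetric] c_def by simp
  have "1 - w * cnj (moebius w \<zeta>) = of_real c * b"
  proof -
    have cb: "cnj b = 1 - w * cnj \<zeta>" by (simp add: b_def)
    have cbnz: "cnj b \<noteq> 0" using nz by simp
    have "1 - w * cnj (moebius w \<zeta>) = (cnj b - w * (cnj w - cnj \<zeta>)) / cnj b"
      unfolding moebius_def b_def[symmetric] using cbnz by (simp add: diff_divide_distrib right_diff_distrib)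
    also have "cnj b - w * (cnj w - cnj \<zeta>) = of_real (1 - (cmod w)\<^sup>2)"
      using complex_norm_square[of w] by (simp add: cb algebra_simps)
    also have "of_real (1 - (cmod w)\<^sup>2) / cnj b = of_real c * b"
    proof -
      have "complex_of_real ((cmod b)\<^sup>2) = b * cnj b" using complex_norm_square[of b] by simp
      then have "of_real c * b = of_real (1 - (cmod w)\<^sup>2) / (b * cnj b) * b" by (simp add: c_def)
      then show ?thesis using nz cbnz by simp
    qed
    finally show ?thesis .
  qed
  then have "power_kernel lam w (moebius w \<zeta>) = (of_real c * b) powr (- complex_of_real lam)"
    by (simp add: power_kernel_def)
  also have "\<dots> = of_real c powr (- complex_of_real lam) * b powr (- complex_of_real lam)"
    using cpos by (intro powr_times_real_left) auto
  also have "complex_of_real c powr (- complex_of_real lam) = of_real (c powr (- lam))"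
    using cpos powr_of_real[of c "- lam"] by simp
  also have "b powr (- complex_of_real lam) = power_kernel lam \<zeta> w"
    by (simp add: power_kernel_def b_def mult.commute)
  finally have k: "cnj (power_kernel lam (moebius w \<zeta>) w) = of_real (c powr (- lam)) * power_kernel lam \<zeta> w"
    by (simp add: cnj_power_kernel[OF moebius_in_disc w])
  have p: "c\<^sup>2 * c powr (- lam) * (c * (1 - (cmod \<zeta>)\<^sup>2)) powr (lam - 2) = (1 - (cmod \<zeta>)\<^sup>2) powr (lam - 2)"
  proof -
    have "c\<^sup>2 * c powr (- lam) * (c * (1 - (cmod \<zeta>)\<^sup>2)) powr (lam - 2)
        = (c powr 2 * c powr (- lam) * c powr (lam - 2)) * (1 - (cmod \<zeta>)\<^sup>2) powr (lam - 2)"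
      using cpos zpos by (simp add: powr_mult)
    also have "c powr 2 * c powr (- lam) * c powr (lam - 2) = c powr (2 + - lam + (lam - 2))"
      by (simp only: powr_add)
    finally show ?thesis using cpos by simp
  qed
  show ?thesis
    unfolding b_def[symmetric] jac wt k
    using arg_cong[OF p, of complex_of_real] by (simp add: mult_ac)
qed

end

section \<open>The reproducing property on the polydisc\<close>

lemma continuous_imp_absolutely_integrable:
  fixes f :: "complex^'n \<Rightarrow> 'b::euclidean_space"
  assumes "continuous_on S f" "S \<in> sets lebesgue" "g integrable_on S" "\<And>z. z \<in> S \<Longrightarrow> norm (f z) \<le> g z"
  shows "f absolutely_integrable_on S"
  by (rule measurable_bounded_by_integrable_imp_absolutely_integrable[OF continuous_imp_measurable_on_sets_lebesgue assms(2,3,4)])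
    (use assms in auto)

lemma absolutely_integrable_polydisc_iff:
  fixes f :: "complex^'n \<Rightarrow> complex"
  assumes "continuous_on polydisc f"
  shows "f absolutely_integrable_on polydisc \<longleftrightarrow> integrable lborel (\<lambda>z. indicator polydisc z *\<^sub>R f z)"
  unfolding set_integrable_def
  by (rule integrable_completion) (simp add: borel_measurable_continuous_on_indicator assms)

lemma integral_polydisc_lborel:
  fixes f :: "complex^'n \<Rightarrow> complex"
  assumes "continuous_on polydisc f" "f absolutely_integrable_on polydisc"
  shows "integral\<^sup>L lborel (\<lambda>z. indicator polydisc z *\<^sub>R f z) = integral polydisc f"
proof -
  have "set_integrable lborel polydisc f"
    using assms(2) unfolding set_integrable_def absolutely_integrable_polydisc_iff[OF assms(1), unfolded set_integrable_def] .
  from set_borel_integral_eq_integral(2)[OF this] show ?thesis unfolding set_lebesgue_integral_def .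
qed

lemma scalar_polydisc:
  assumes "cmod c \<le> 1" "z \<in> polydisc"
  shows "c *s z \<in> polydisc"
proof -
  have "cmod (c * z $ i) < 1" for i
  proof -
    have "cmod (c * z $ i) \<le> cmod (z $ i)"
      unfolding norm_mult by (rule mult_left_le_one_le) (use assms in auto)
    also have "\<dots> < 1" using assms(2) by (simp add: polydisc_def)
    finally show ?thesis .
  qed
  then show ?thesis by (simp add: polydisc_def)
qed

lemma rotation_integral:
  fixes f :: "complex^'n \<Rightarrow> complex"
  assumes c: "cmod c = 1"
  shows "(\<lambda>z. f (c *s z)) absolutely_integrable_on polydisc \<longleftrightarrow> f absolutely_integrable_on polydisc"
    and "f absolutely_integrable_on polydisc \<Longrightarrow> integral polydisc (\<lambda>z. f (c *s z)) = integral polydisc f"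
proof -
  let ?A = "diag_matrix (\<lambda>_. c) :: complex^'n^'n"
  have lin: "(\<lambda>z. c *s z) = (\<lambda>z. ?A *v z)" by (simp add: diag_matrix_mult_vector vec_eq_iff fun_eq_iff)
  have der: "((\<lambda>z. c *s z) has_derivative (\<lambda>h. ?A *v h)) (at z within S)" for z :: "complex^'n" and S
    unfolding lin by (rule bounded_linear_imp_has_derivative) (use linear_matrix_complex[of ?A] in \<open>simp add: linear_conv_bounded_linear\<close>)
  have "c \<noteq> 0" using c by auto
  then have cc: "inverse c * c = 1" "cmod (inverse c) = 1" using c by (simp_all add: norm_inverse)
  have inj: "inj_on (\<lambda>z. c *s z) (polydisc :: (complex^'n) set)"
    using c by (auto simp: inj_on_def vec_eq_iff)
  have im: "(\<lambda>z. c *s z) ` polydisc = (polydisc :: (complex^'n) set)"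
  proof
    show "(\<lambda>z. c *s z) ` polydisc \<subseteq> (polydisc :: (complex^'n) set)" using c scalar_polydisc[of c] by auto
    show "(polydisc :: (complex^'n) set) \<subseteq> (\<lambda>z. c *s z) ` polydisc"
    proof
      fix z :: "complex^'n" assume "z \<in> polydisc"
      then have "inverse c *s z \<in> polydisc" using cc scalar_polydisc[of "inverse c"] by simp
      moreover have "z = c *s (inverse c *s z)" using cc by (simp add: vector_smult_assoc mult.commute)
      ultimately show "z \<in> (\<lambda>z. c *s z) ` polydisc" by blast
    qed
  qed
  have jac: "real_jacobian ?A = 1" by (simp add: real_jacobian_diag c)
  note cv = has_absolute_integral_change_of_variables_complex[OF polydisc_sets(2) der inj, of f, unfolded jac scaleR_one im]
  show "(\<lambda>z. f (c *s z)) absolutely_integrable_on polydisc \<longleftrightarrow> f absolutely_integrable_on polydisc"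
    using cv by blast
  show "f absolutely_integrable_on polydisc \<Longrightarrow> integral polydisc (\<lambda>z. f (c *s z)) = integral polydisc f"
    using cv by blast
qed

text \<open>
  The mean value property on the disc of all \<open>c z\<close> with \<open>|c| \<le> 1\<close>; a single circle suffices.
\<close>
lemma circle_mean_value:
  fixes H :: "complex^'n \<Rightarrow> complex"
  assumes H: "holomorphic_cn_on H polydisc" and z: "z \<in> polydisc"
  shows "integral {0..1} (\<lambda>t. H (circlepath 0 1 t *s z)) = H 0"
proof -
  define G where "G = (\<lambda>c. H (c *s z))"
  have "G holomorphic_on cball 0 1"
    unfolding holomorphic_on_def
  proof
    fix c :: complex assume "c \<in> cball 0 1"
    then have "c *s z \<in> polydisc" using z by (intro scalar_polydisc) auto
    then obtain a where a: "(H has_derivative (\<lambda>h. \<Sum>i\<in>UNIV. a $ i * h $ i)) (at (c *s z))"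
      using H unfolding holomorphic_cn_on_def by blast
    have lin: "bounded_linear (\<lambda>c. c *s z)"
      unfolding linear_conv_bounded_linear[symmetric]
      by (rule linearI) (simp_all add: vec_eq_iff distrib_right)
    have "(G has_derivative (\<lambda>h. \<Sum>i\<in>UNIV. a $ i * (h *s z) $ i)) (at c)"
      using diff_chain_at[OF bounded_linear_imp_has_derivative[OF lin] a] by (simp add: G_def o_def)
    moreover have "(\<lambda>h. \<Sum>i\<in>UNIV. a $ i * (h *s z) $ i) = (*) (\<Sum>i\<in>UNIV. a $ i * z $ i)"
      by (simp add: fun_eq_iff sum_distrib_left sum_distrib_right mult_ac)
    ultimately have "(G has_field_derivative (\<Sum>i\<in>UNIV. a $ i * z $ i)) (at c)"
      by (simp add: has_field_derivative_def)
    then show "G field_differentiable at c within cball 0 1"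
      using field_differentiable_at_within field_differentiable_def by blast
  qed
  then have "((\<lambda>u. G u / (u - 0)) has_contour_integral (2 * of_real pi * \<i> * G 0)) (circlepath 0 1)"
    by (intro Cauchy_integral_circlepath_simple) auto
  then have "2 * of_real pi * \<i> * G 0 = contour_integral (circlepath 0 1) (\<lambda>u. G u / (u - 0))"
    by (simp add: contour_integral_unique)
  also have "\<dots> = integral {0..1} (\<lambda>t. (2 * of_real pi * \<i>) * G (circlepath 0 1 t))"
    unfolding contour_integral_integral vector_derivative_circlepath
    by (intro integral_cong) (simp add: circlepath)
  also have "\<dots> = (2 * of_real pi * \<i>) * integral {0..1} (\<lambda>t. G (circlepath 0 1 t))"
    by simp
  finally have "G 0 = integral {0..1} (\<lambda>t. G (circlepath 0 1 t))" by simp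
  moreover have "0 *s z = 0" by (simp add: vec_eq_iff)
  ultimately show ?thesis by (simp add: G_def)
qed

lemma polydisc_weight_rotation: "cmod c = 1 \<Longrightarrow> polydisc_weight lam (c *s z) = polydisc_weight lam z"
  by (simp add: polydisc_weight_def norm_mult)

lemma continuous_on_scalar_vec [continuous_intros]:
  assumes "continuous_on S f" "continuous_on S g"
  shows "continuous_on S (\<lambda>x. (f x :: complex) *s (g x :: complex^'n))"
  unfolding vector_scalar_mult_def by (intro continuous_intros continuous_on_vec_lambda assms)

text \<open>
  The integral does not change when \<open>H\<close> is rotated. Average over all rotations and exchange the order
  of integration: the average of \<open>H\<close> over the circle through \<open>z\<close> is \<open>H 0\<close>.
\<close>
theorem weighted_mean_value:
  fixes H :: "complex^'n \<Rightarrow> complex"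
  assumes H: "holomorphic_cn_on H polydisc"
    and int: "(\<lambda>z. H z * of_real (polydisc_weight lam z)) absolutely_integrable_on polydisc" and lam: "lam > 1"
  shows "integral polydisc (\<lambda>z. H z * of_real (polydisc_weight lam z)) = H 0 * of_real ((pi / (lam - 1)) ^ CARD('n))"
proof -
  let ?D = "polydisc :: (complex^'n) set" and ?w = "polydisc_weight lam :: complex^'n \<Rightarrow> real"
  let ?c = "circlepath 0 1"
  define F where "F = (\<lambda>z. H z * of_real (?w z))"
  have c: "cmod (?c t) = 1" for t by (simp add: norm_circlepath_0)
  have contF: "continuous_on ?D F"
    unfolding F_def by (intro continuous_intros holomorphic_cn_on_imp_continuous_on[OF H] continuous_on_polydisc_weight)
  have intF: "F absolutely_integrable_on ?D" using int by (simp add: F_def)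
  define f where "f = (\<lambda>t z. indicator {0..1::real} t *\<^sub>R (indicator ?D z *\<^sub>R F (?c t *s z)))"
  have rotc: "continuous_on ?D (\<lambda>z. F (?c t *s z))" for t
    by (rule continuous_on_compose2[OF contF]) (auto intro!: continuous_intros scalar_polydisc simp: c)
  have meas: "case_prod f \<in> borel_measurable (lborel \<Otimes>\<^sub>M lborel)"
  proof -
    have "(\<lambda>p. indicator ({0..1} \<times> ?D) p *\<^sub>R F (?c (fst p) *s snd p)) \<in> borel_measurable borel"
    proof (rule borel_measurable_continuous_on_indicator)
      show "{0..1::real} \<times> ?D \<in> sets borel" by (intro borel_Times) auto
      show "continuous_on ({0..1} \<times> ?D) (\<lambda>p. F (?c (fst p) *s snd p))"
        by (rule continuous_on_compose2[OF contF]) (auto intro!: continuous_intros scalar_polydisc simp: c)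
    qed
    moreover have "case_prod f = (\<lambda>p. indicator ({0..1} \<times> ?D) p *\<^sub>R F (?c (fst p) *s snd p))"
      by (auto simp: f_def fun_eq_iff indicator_def)
    ultimately show ?thesis by (simp add: lborel_prod)
  qed
  have slice: "integrable lborel (\<lambda>z. indicator ?D z *\<^sub>R F (?c t *s z))" for t
    using rotation_integral(1)[OF c, of F t] intF absolutely_integrable_polydisc_iff[OF rotc, of t] by simp
  define K where "K = integral\<^sup>L lborel (\<lambda>z. indicator ?D z *\<^sub>R norm (F z))"
  \<comment> \<open>the inner integral of the norm is constant in \<open>t\<close>, by rotation invariance\<close>
  have normK: "(LINT z|lborel. norm (f t z)) = indicator {0..1} t * K" for t
  proof -
    let ?N = "\<lambda>z. complex_of_real (norm (F z))"
    have contN: "continuous_on ?D ?N" by (intro continuous_intros contF)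
    have contN': "continuous_on ?D (\<lambda>z. ?N (?c t *s z))" by (intro continuous_intros rotc)
    have intN: "?N absolutely_integrable_on ?D"
      by (rule continuous_imp_absolutely_integrable[OF contN polydisc_sets(2), where g="\<lambda>z. norm (F z)"])
        (use intF in \<open>auto simp: absolutely_integrable_on_def\<close>)
    have "complex_of_real (LINT z|lborel. indicator ?D z *\<^sub>R norm (F (?c t *s z))) = integral\<^sup>L lborel (\<lambda>z. indicator ?D z *\<^sub>R ?N (?c t *s z))"
      by (simp flip: integral_complex_of_real add: scaleR_conv_of_real)
    also have "\<dots> = integral\<^sup>L lborel (\<lambda>z. indicator ?D z *\<^sub>R ?N z)"
      using rotation_integral[OF c, of ?N t] intN
      by (simp only: integral_polydisc_lborel[OF contN' ] integral_polydisc_lborel[OF contN])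
    also have "\<dots> = complex_of_real K"
      unfolding K_def by (simp flip: integral_complex_of_real add: scaleR_conv_of_real)
    finally have "(LINT z|lborel. indicator ?D z *\<^sub>R norm (F (?c t *s z))) = K"
      by (simp only: of_real_eq_iff)
    then show ?thesis by (simp add: f_def mult.assoc)
  qed
  have "integrable (lborel \<Otimes>\<^sub>M lborel) (case_prod f)"
  proof (rule lborel_pair.Fubini_integrable[OF meas])
    have "integrable lborel (\<lambda>t :: real. indicator {0..1} t *\<^sub>R K)"
      by (intro integrable_scaleR_left integrable_real_indicator) auto
    then show "integrable lborel (\<lambda>t. LINT z|lborel. norm (case (t, z) of (t, z) \<Rightarrow> f t z))"
      by (simp add: normK)
    show "AE t in lborel. integrable lborel (\<lambda>z. case (t, z) of (t, z) \<Rightarrow> f t z)"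
      unfolding case_prod_conv f_def by (intro AE_I2 integrable_scaleR_right slice)
  qed
  then have fub: "(LINT z|lborel. LINT t|lborel. f t z) = (LINT t|lborel. LINT z|lborel. f t z)"
    by (rule lborel_pair.Fubini_integral)
  have "(LINT z|lborel. f t z) = indicator {0..1} t *\<^sub>R integral ?D F" for t
  proof -
    have "(LINT z|lborel. indicator ?D z *\<^sub>R F (?c t *s z)) = integral ?D F"
      using integral_polydisc_lborel[OF rotc, of t] rotation_integral(2)[OF c intF, of t]
        rotation_integral(1)[OF c, of F t] intF by simp
    then show ?thesis unfolding f_def integral_scaleR_right by (simp only:)
  qed
  then have right: "(LINT t|lborel. LINT z|lborel. f t z) = integral ?D F" by simp
  have "(LINT t|lborel. f t z) = indicator ?D z *\<^sub>R (H 0 * of_real (?w z))" for z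
  proof (cases "z \<in> ?D")
    case True
    have cont: "continuous_on {0..1} (\<lambda>t. H (?c t *s z))"
      by (rule continuous_on_compose2[OF holomorphic_cn_on_imp_continuous_on[OF H]])
        (use True in \<open>auto intro!: continuous_intros scalar_polydisc simp: c\<close>)
    have "(LINT t|lborel. f t z) = (LINT t:{0..1}|lborel. H (?c t *s z) * of_real (?w z))"
      unfolding set_lebesgue_integral_def f_def F_def using True by (simp add: polydisc_weight_rotation c)
    also have "\<dots> = integral {0..1} (\<lambda>t. H (?c t *s z) * of_real (?w z))"
    proof (rule set_borel_integral_eq_integral(2))
      show "set_integrable lborel {0..1} (\<lambda>t. H (?c t *s z) * of_real (?w z))"
        by (intro borel_integrable_atLeastAtMost' continuous_intros cont)
    qed
    also have "\<dots> = H 0 * of_real (?w z)" using circle_mean_value[OF H True] by simp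
    finally show ?thesis using True by simp
  qed (simp add: f_def)
  then have "(LINT z|lborel. LINT t|lborel. f t z) = (LINT z|lborel. H 0 * complex_of_real (indicator ?D z *\<^sub>R ?w z))"
    by (simp add: scaleR_conv_of_real mult_ac)
  also have "\<dots> = H 0 * of_real (LINT z|lborel. indicator ?D z *\<^sub>R ?w z)"
    by (simp flip: integral_complex_of_real)
  also have "(LINT z|lborel. indicator ?D z *\<^sub>R ?w z) = integral ?D ?w"
  proof -
    have "(\<lambda>z. indicator ?D z *\<^sub>R ?w z) \<in> borel_measurable borel"
      by (rule borel_measurable_continuous_on_indicator[OF polydisc_sets(1) continuous_on_polydisc_weight])
    then have "(\<lambda>z. indicator ?D z *\<^sub>R ?w z) \<in> borel_measurable lborel"
      by (subst measurable_cong_sets[where M'=borel and N'=borel]) (simp_all only: sets_lborel)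
    from integrable_completion[OF this] have "integrable lborel (\<lambda>z. indicator ?D z *\<^sub>R ?w z)"
      using polydisc_weight_integral(1)[OF lam, where 'n='n] unfolding set_integrable_def by (rule iffD1)
    then show ?thesis
      using set_borel_integral_eq_integral(2)[of ?D ?w] unfolding set_integrable_def set_lebesgue_integral_def by simp
  qed
  also have "integral ?D ?w = (pi / (lam - 1)) ^ CARD('n)" by (rule polydisc_weight_integral(2)[OF lam])
  finally show ?thesis using fub right by (simp add: F_def)
qed

definition moebius_map :: "complex^'n \<Rightarrow> complex^'n \<Rightarrow> complex^'n" where
  "moebius_map w \<zeta> = (\<chi> j. moebius (w $ j) (\<zeta> $ j))"

definition polydisc_kernel :: "real \<Rightarrow> complex^'n \<Rightarrow> complex^'n \<Rightarrow> complex" where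
  "polydisc_kernel lam z w = (\<Prod>j\<in>UNIV. power_kernel lam (z $ j) (w $ j))"

lemma continuous_on_polydisc_kernel: "w \<in> polydisc \<Longrightarrow> continuous_on polydisc (\<lambda>z. polydisc_kernel lam z w)"
  unfolding polydisc_kernel_def by (intro continuous_intros) (auto simp: polydisc_def)

lemma polydisc_kernel_bounded:
  fixes w :: "complex^'n"
  assumes "w \<in> polydisc" "lam > 0"
  obtains C where "\<And>z. z \<in> polydisc \<Longrightarrow> cmod (polydisc_kernel lam z w) \<le> C"
proof (rule that)
  fix z :: "complex^'n" assume z: "z \<in> polydisc"
  have "cmod (power_kernel lam (z $ j) (w $ j)) \<le> (1 - cmod (w $ j)) powr (- lam)" for j
    using assms z by (intro norm_power_kernel_le) (auto simp: polydisc_def)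
  then show "cmod (polydisc_kernel lam z w) \<le> (\<Prod>j\<in>UNIV. (1 - cmod (w $ j)) powr (- lam))"
    unfolding polydisc_kernel_def prod_norm[symmetric] by (intro prod_mono) auto
qed

text \<open>
  Substitute \<open>moebius_map w\<close>, which exchanges \<open>w\<close> and 0. By \<open>moebius_kernel\<close> the integrand becomes the
  weight times the holomorphic function \<open>H\<close>, whose value at 0 is \<open>h w\<close>.
\<close>
theorem polydisc_reproducing:
  fixes h :: "complex^'n \<Rightarrow> complex"
  assumes h: "holomorphic_cn_on h polydisc" and w: "w \<in> polydisc" and lam: "lam > 1"
    and int: "(\<lambda>z. h z * of_real (polydisc_weight lam z)) absolutely_integrable_on polydisc"
  shows "(\<lambda>z. h z * cnj (polydisc_kernel lam z w) * of_real (polydisc_weight lam z)) absolutely_integrable_on polydisc"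
    and "integral polydisc (\<lambda>z. h z * cnj (polydisc_kernel lam z w) * of_real (polydisc_weight lam z))
      = h w * of_real ((pi / (lam - 1)) ^ CARD('n))"
proof -
  let ?D = "polydisc :: (complex^'n) set" and ?w = "polydisc_weight lam :: complex^'n \<Rightarrow> real"
  let ?\<phi> = "moebius_map w"
  define f where "f = (\<lambda>z. h z * cnj (polydisc_kernel lam z w) * of_real (?w z))"
  obtain C where C: "\<And>z. z \<in> ?D \<Longrightarrow> cmod (polydisc_kernel lam z w) \<le> C"
    using polydisc_kernel_bounded[OF w, of lam] lam by auto
  have wj: "cmod (w $ j) < 1" for j using w by (simp add: polydisc_def)
  have contf: "continuous_on ?D f"
    unfolding f_def by (intro continuous_intros holomorphic_cn_on_imp_continuous_on[OF h] continuous_on_polydisc_weight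
      continuous_on_polydisc_kernel w)
  show intf: "f absolutely_integrable_on ?D"
  proof (rule continuous_imp_absolutely_integrable[OF contf polydisc_sets(2)])
    show "(\<lambda>z. C * norm (h z * of_real (?w z))) integrable_on ?D"
      using int by (intro integrable_on_mult_right) (auto simp: absolutely_integrable_on_def)
    show "norm (f z) \<le> C * norm (h z * of_real (?w z))" if "z \<in> ?D" for z
      using mult_right_mono[OF C[OF that], of "norm (h z * of_real (?w z))"] by (simp add: f_def norm_mult mult_ac)
  qed
  define a where "a = (\<lambda>\<zeta> j. - of_real (1 - (cmod (w $ j))\<^sup>2) / (1 - cnj (w $ j) * \<zeta> $ j)\<^sup>2)"
  have der: "(?\<phi> has_derivative (\<lambda>k. diag_matrix (a \<zeta>) *v k)) (at \<zeta>)" if "\<zeta> \<in> ?D" for \<zeta>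
  proof (rule has_derivative_vector_components)
    fix j
    have \<zeta>: "cmod (\<zeta> $ j) < 1" using that by (simp add: polydisc_def)
    have 1: "((\<lambda>\<zeta> :: complex^'n. \<zeta> $ j) has_derivative (\<lambda>k. k $ j)) (at \<zeta>)"
      by (rule bounded_linear_imp_has_derivative) (rule bounded_linear_vec_nth)
    from diff_chain_at[OF 1 has_field_derivative_imp_has_derivative[OF has_field_derivative_moebius[OF wj[of j] \<zeta>]]]
    show "((\<lambda>\<zeta>. ?\<phi> \<zeta> $ j) has_derivative (\<lambda>k. (diag_matrix (a \<zeta>) *v k) $ j)) (at \<zeta>)"
      by (simp add: moebius_map_def diag_matrix_mult_vector a_def o_def)
  qed
  have \<phi>D: "?\<phi> \<zeta> \<in> ?D" if "\<zeta> \<in> ?D" for \<zeta>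
    using that wj by (simp add: polydisc_def moebius_map_def moebius_in_disc)
  have inv: "?\<phi> (?\<phi> \<zeta>) = \<zeta>" if "\<zeta> \<in> ?D" for \<zeta>
    using that wj by (simp add: polydisc_def moebius_map_def moebius_involution vec_eq_iff)
  have inj: "inj_on ?\<phi> ?D" by (rule inj_on_inverseI) (rule inv)
  have im: "?\<phi> ` ?D = ?D"
  proof
    show "?\<phi> ` ?D \<subseteq> ?D" using \<phi>D by blast
    show "?D \<subseteq> ?\<phi> ` ?D"
    proof
      fix z assume "z \<in> ?D"
      then have "z = ?\<phi> (?\<phi> z)" "?\<phi> z \<in> ?D" using inv \<phi>D by simp_all
      then show "z \<in> ?\<phi> ` ?D" by (rule image_eqI)
    qed
  qed
  define H where "H = (\<lambda>\<zeta>. h (?\<phi> \<zeta>) * polydisc_kernel lam \<zeta> w)"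
  have point: "real_jacobian (diag_matrix (a \<zeta>)) *\<^sub>R f (?\<phi> \<zeta>) = H \<zeta> * of_real (?w \<zeta>)" if "\<zeta> \<in> ?D" for \<zeta>
  proof -
    have \<zeta>: "cmod (\<zeta> $ j) < 1" for j using that by (simp add: polydisc_def)
    have "real_jacobian (diag_matrix (a \<zeta>)) *\<^sub>R f (?\<phi> \<zeta>)
      = h (?\<phi> \<zeta>) * (\<Prod>j\<in>UNIV. complex_of_real ((cmod (of_real (1 - (cmod (w $ j))\<^sup>2) / (1 - cnj (w $ j) * \<zeta> $ j)\<^sup>2))\<^sup>2)
          * cnj (power_kernel lam (moebius (w $ j) (\<zeta> $ j)) (w $ j))
          * of_real ((1 - (cmod (moebius (w $ j) (\<zeta> $ j)))\<^sup>2) powr (lam - 2)))"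
      unfolding real_jacobian_diag f_def a_def polydisc_kernel_def polydisc_weight_def moebius_map_def
        scaleR_conv_of_real prod.distrib of_real_prod cnj_prod vec_lambda_beta minus_divide_left[symmetric] norm_minus_cancel
      by (simp only: mult_ac)
    also have "\<dots> = h (?\<phi> \<zeta>) * (\<Prod>j\<in>UNIV. power_kernel lam (\<zeta> $ j) (w $ j) * of_real ((1 - (cmod (\<zeta> $ j))\<^sup>2) powr (lam - 2)))"
      by (intro arg_cong[where f="(*) _"] prod.cong refl moebius_kernel wj \<zeta>)
    finally show ?thesis
      by (simp add: H_def polydisc_kernel_def polydisc_weight_def prod.distrib mult_ac)
  qed
  have holH: "holomorphic_cn_on H ?D"
    unfolding holomorphic_cn_on_iff H_def
  proof (intro ballI complex_linear_deriv_mult)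
    fix \<zeta> assume \<zeta>: "\<zeta> \<in> ?D"
    show "complex_linear_deriv (\<lambda>\<zeta>. h (?\<phi> \<zeta>)) \<zeta>"
      using h \<phi>D[OF \<zeta>] by (intro complex_linear_deriv_compose[OF der[OF \<zeta>]]) (simp add: holomorphic_cn_on_iff)
    show "complex_linear_deriv (\<lambda>\<zeta>. polydisc_kernel lam \<zeta> w) \<zeta>"
      unfolding polydisc_kernel_def using \<zeta> wj
      by (intro complex_linear_deriv_prod complex_linear_deriv_field[OF complex_linear_deriv_component has_field_derivative_power_kernel])
        (auto simp: polydisc_def)
  qed
  have der': "(?\<phi> has_derivative (\<lambda>k. diag_matrix (a \<zeta>) *v k)) (at \<zeta> within ?D)" if "\<zeta> \<in> ?D" for \<zeta>
    using der[OF that] by (rule has_derivative_at_withinI)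
  note cv = has_absolute_integral_change_of_variables_complex[OF polydisc_sets(2) der' inj, of f "integral ?D f", unfolded im]
  have cv1: "(\<lambda>\<zeta>. real_jacobian (diag_matrix (a \<zeta>)) *\<^sub>R f (?\<phi> \<zeta>)) absolutely_integrable_on ?D"
    and cv2: "integral ?D (\<lambda>\<zeta>. real_jacobian (diag_matrix (a \<zeta>)) *\<^sub>R f (?\<phi> \<zeta>)) = integral ?D f"
    using cv intf by blast+
  have cv1': "(\<lambda>\<zeta>. H \<zeta> * of_real (?w \<zeta>)) absolutely_integrable_on ?D"
    using cv1 by (subst set_integrable_cong[OF refl refl point[symmetric]]) auto
  have "integral ?D f = integral ?D (\<lambda>\<zeta>. H \<zeta> * of_real (?w \<zeta>))"
    unfolding cv2[symmetric] by (rule integral_cong) (rule point)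
  also have "\<dots> = H 0 * of_real ((pi / (lam - 1)) ^ CARD('n))"
    by (rule weighted_mean_value[OF holH cv1' lam])
  also have "H 0 = h w"
    by (simp add: H_def moebius_map_def moebius_def polydisc_kernel_def power_kernel_def)
  finally show "integral ?D f = h w * of_real ((pi / (lam - 1)) ^ CARD('n))" .
qed

section \<open>Integration over the symmetrized polydisc\<close>

text \<open>
  A Borel linear order of the complex numbers, used to choose one representative of each orbit of the
  symmetric group.
\<close>
definition lex_less :: "complex \<Rightarrow> complex \<Rightarrow> bool" where
  "lex_less x y \<longleftrightarrow> Re x < Re y \<or> (Re x = Re y \<and> Im x < Im y)"

lemma lex_less_irrefl [simp]: "\<not> lex_less x x" by (simp add: lex_less_def)
lemma lex_less_trans: "lex_less x y \<Longrightarrow> lex_less y z \<Longrightarrow> lex_less x z" by (auto simp: lex_less_def)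
lemma lex_less_linear: "x = y \<or> lex_less x y \<or> lex_less y x" by (auto simp: lex_less_def complex_eq_iff)

definition lex_rank :: "complex set \<Rightarrow> complex \<Rightarrow> nat" where
  "lex_rank R x = card {y \<in> R. y = x \<or> lex_less y x}"

lemma lex_rank_less:
  assumes "finite R" "y \<in> R" "lex_less x y"
  shows "lex_rank R x < lex_rank R y"
  unfolding lex_rank_def
proof (rule psubset_card_mono)
  have "y \<noteq> x" "\<not> lex_less y x" using assms(3) lex_less_trans lex_less_irrefl by blast+
  then have "y \<notin> {v \<in> R. v = x \<or> lex_less v x}" by blast
  moreover have "y \<in> {v \<in> R. v = y \<or> lex_less v y}" using assms(2) by blast
  moreover have "{v \<in> R. v = x \<or> lex_less v x} \<subseteq> {v \<in> R. v = y \<or> lex_less v y}"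
    using assms(3) lex_less_trans by blast
  ultimately show "{v \<in> R. v = x \<or> lex_less v x} \<subset> {v \<in> R. v = y \<or> lex_less v y}" by blast
qed (use assms in auto)

lemma lex_rank_inj:
  assumes "finite R" "x \<in> R" "y \<in> R" "lex_rank R x = lex_rank R y"
  shows "x = y"
  using lex_less_linear[of x y] lex_rank_less[OF assms(1,3), of x] lex_rank_less[OF assms(1,2), of y] assms(4) by force

definition lex_sorted :: "complex^'d::{finite,wellorder} \<Rightarrow> bool" where
  "lex_sorted z \<longleftrightarrow> (\<forall>i j. i < j \<longrightarrow> lex_less (z $ i) (z $ j))"

lemma lex_sorted_iff:
  fixes z :: "complex^'d::{finite,wellorder}"
  shows "lex_sorted z \<Longrightarrow> lex_less (z $ i) (z $ j) \<longleftrightarrow> i < j"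
  unfolding lex_sorted_def using lex_less_trans lex_less_irrefl linorder_less_linear by metis

lemma lex_sorted_inj:
  fixes z :: "complex^'d::{finite,wellorder}"
  shows "lex_sorted z \<Longrightarrow> inj (\<lambda>i. z $ i)"
  unfolding lex_sorted_def inj_def using lex_less_irrefl linorder_less_linear by metis

lemma lex_sorted_rank:
  fixes z :: "complex^'d::{finite,wellorder}"
  assumes "lex_sorted z"
  shows "lex_rank (range (\<lambda>i. z $ i)) (z $ j) = index_rank j"
proof -
  have "{y \<in> range (\<lambda>i. z $ i). y = z $ j \<or> lex_less y (z $ j)} = (\<lambda>i. z $ i) ` {i. i \<le> j}"
    using lex_sorted_iff[OF assms] lex_sorted_inj[OF assms] by (auto simp: inj_eq le_less)
  then show ?thesis
    using lex_sorted_inj[OF assms] by (simp add: lex_rank_def index_rank_def card_image inj_on_subset)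
qed

text \<open>
  In a sorted tuple the position of an entry is its rank among all entries.
\<close>
lemma lex_sorted_unique:
  fixes z z' :: "complex^'d::{finite,wellorder}"
  assumes "lex_sorted z" "lex_sorted z'" "range (\<lambda>i. z $ i) = range (\<lambda>i. z' $ i)"
  shows "z = z'"
proof -
  have "z $ j = z' $ j" for j
  proof (rule lex_rank_inj)
    show "z' $ j \<in> range (\<lambda>i. z $ i)" unfolding assms(3) by blast
    show "lex_rank (range (\<lambda>i. z $ i)) (z $ j) = lex_rank (range (\<lambda>i. z $ i)) (z' $ j)"
      using lex_sorted_rank[OF assms(1), of j] lex_sorted_rank[OF assms(2), of j] by (simp add: assms(3))
  qed auto
  then show ?thesis by (simp add: vec_eq_iff)
qed

lemma ex1_sorting_permutation:
  fixes z :: "complex^'d::{finite,wellorder}"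
  assumes "inj (\<lambda>i. z $ i)"
  shows "\<exists>!p. p permutes UNIV \<and> lex_sorted (\<chi> i. z $ p i)"
proof (rule ex_ex1I)
  let ?R = "range (\<lambda>i. z $ i)"
  define r where "r = (\<lambda>i. lex_rank ?R (z $ i))"
  have injr: "inj r"
  proof (rule injI)
    fix i j assume "r i = r j"
    then have "z $ i = z $ j" unfolding r_def by (intro lex_rank_inj[of ?R]) auto
    with assms show "i = j" by (simp add: inj_eq)
  qed
  have "range r = {1..CARD('d)}"
  proof (rule card_subset_eq)
    show "range r \<subseteq> {1..CARD('d)}"
    proof
      fix n assume "n \<in> range r"
      then obtain i where n: "n = lex_rank ?R (z $ i)" by (auto simp: r_def)
      have "card {y \<in> ?R. y = z $ i \<or> lex_less y (z $ i)} \<le> card ?R" by (intro card_mono) auto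
      also have "\<dots> \<le> CARD('d)" by (rule card_image_le) simp
      finally have "n \<le> CARD('d)" by (simp add: n lex_rank_def)
      moreover have "n > 0" unfolding n lex_rank_def card_gt_0_iff by auto
      ultimately show "n \<in> {1..CARD('d)}" by simp
    qed
    show "card (range r) = card {1..CARD('d)}" using injr by (simp add: card_image)
  qed simp
  then have bijr: "bij_betw r UNIV {1..CARD('d)}" using injr by (simp add: bij_betw_def)
  \<comment> \<open>send each position to the index whose entry has the rank of that position\<close>
  define p :: "'d \<Rightarrow> 'd" where "p = (\<lambda>i. inv_into UNIV r (index_rank i))"
  have rp: "r (p i) = index_rank i" for i
  proof -
    have "index_rank i \<in> range r" unfolding \<open>range r = _\<close> using index_rank_bounds[of i] by simp
    then show ?thesis unfolding p_def by (rule f_inv_into_f)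
  qed
  have "inj p"
  proof (rule injI)
    fix i j assume "p i = p j"
    then have "r (p i) = r (p j)" by (rule arg_cong)
    then show "i = j" unfolding rp by (rule index_rank_eq_iff[THEN iffD1])
  qed
  then have "bij p" using finite_UNIV_inj_surj[of p] by (intro bijI) auto
  then have "p permutes UNIV" by (rule bij_imp_permutes) simp
  moreover have "lex_sorted (\<chi> i. z $ p i)"
    unfolding lex_sorted_def
  proof (intro allI impI)
    fix i j :: 'd assume "i < j"
    then have lt: "r (p i) < r (p j)" by (simp add: rp index_rank_less_iff)
    then have "z $ p i \<noteq> z $ p j" "\<not> lex_less (z $ p j) (z $ p i)"
      using lex_rank_less[of ?R "z $ p i" "z $ p j"] by (auto simp: r_def)
    then show "lex_less ((\<chi> i. z $ p i) $ i) ((\<chi> i. z $ p i) $ j)" using lex_less_linear by auto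
  qed
  ultimately show "\<exists>p. p permutes UNIV \<and> lex_sorted (\<chi> i. z $ p i)" by blast
next
  fix p q :: "'d \<Rightarrow> 'd"
  assume p: "p permutes UNIV \<and> lex_sorted (\<chi> i. z $ p i)" and q: "q permutes UNIV \<and> lex_sorted (\<chi> i. z $ q i)"
  have range_eq: "range (\<lambda>i. (\<chi> i. z $ s i) $ i) = range (\<lambda>i. z $ i)" if "s permutes UNIV" for s
  proof -
    have "range (\<lambda>i. (\<chi> i. z $ s i) $ i) = (\<lambda>i. z $ i) ` range s" by auto
    then show ?thesis using permutes_surj[OF that] by simp
  qed
  have "(\<chi> i. z $ p i) = (\<chi> i. z $ q i)"
    using p q range_eq[of p] range_eq[of q] by (intro lex_sorted_unique) auto
  then have "z $ p i = z $ q i" for i by (simp add: vec_eq_iff)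
  then show "p = q" using assms by (auto simp: fun_eq_iff inj_eq)
qed

definition sorted_polydisc :: "(complex^'d::{finite,wellorder}) set" where
  "sorted_polydisc = {z \<in> polydisc. lex_sorted z}"

lemma sorted_polydisc_sets: "(sorted_polydisc :: (complex^'d::{finite,wellorder}) set) \<in> sets borel"
proof -
  have "sorted_polydisc = polydisc \<inter> (\<Inter>i. \<Inter>j. {z :: complex^'d::{finite,wellorder}. i < j \<longrightarrow> lex_less (z $ i) (z $ j)})"
    by (auto simp: sorted_polydisc_def lex_sorted_def)
  also have "\<dots> \<in> sets borel"
  proof (intro sets.Int polydisc_sets sets.countable_INT'' )
    fix i j :: 'd
    have comp: "continuous_on UNIV (\<lambda>z :: complex^'d::{finite,wellorder}. Re (z $ k))" "continuous_on UNIV (\<lambda>z :: complex^'d::{finite,wellorder}. Im (z $ k))" for k :: 'd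
      by (intro continuous_intros)+
    have o1: "{z :: complex^'d::{finite,wellorder}. Re (z $ i) < Re (z $ j)} \<in> sets borel" "{z :: complex^'d::{finite,wellorder}. Im (z $ i) < Im (z $ j)} \<in> sets borel"
      by (intro borel_open open_Collect_less comp)+
    have o2: "{z :: complex^'d::{finite,wellorder}. Re (z $ i) = Re (z $ j)} \<in> sets borel"
      by (intro borel_closed closed_Collect_eq comp)
    have "{z :: complex^'d::{finite,wellorder}. lex_less (z $ i) (z $ j)} = {z. Re (z $ i) < Re (z $ j)} \<union> ({z. Re (z $ i) = Re (z $ j)} \<inter> {z. Im (z $ i) < Im (z $ j)})"
      by (auto simp: lex_less_def)
    then have "{z :: complex^'d::{finite,wellorder}. lex_less (z $ i) (z $ j)} \<in> sets borel" using o1 o2 by auto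
    then show "{z :: complex^'d::{finite,wellorder}. i < j \<longrightarrow> lex_less (z $ i) (z $ j)} \<in> sets borel"
      by (cases "i < j") auto
  qed auto
  finally show ?thesis .
qed

lemma inj_on_symmetrization_sorted: "inj_on symmetrization sorted_polydisc"
proof (rule inj_onI)
  fix z z' :: "complex^'d::{finite,wellorder}"
  assume *: "z \<in> sorted_polydisc" "z' \<in> sorted_polydisc" "symmetrization z = symmetrization z'"
  have "range (\<lambda>i. z $ i) = range (\<lambda>i. z' $ i)"
    using root_poly_symmetrization_eq_0[of z] root_poly_symmetrization_eq_0[of z'] unfolding *(3) by blast
  then show "z = z'" using * by (intro lex_sorted_unique) (auto simp: sorted_polydisc_def)
qed

text \<open>
  The set lies in a finite union of real hyperplanes.
\<close>
lemma negligible_vandermonde: "negligible {z :: complex^'d::{finite,wellorder}. vandermonde z = 0}"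
proof -
  have "{z :: complex^'d::{finite,wellorder}. vandermonde z = 0} \<subseteq> (\<Union>(i, j)\<in>{(i, j). i \<noteq> j}. {z. (axis i 1 - axis j 1) \<bullet> z = 0})"
  proof
    fix z :: "complex^'d::{finite,wellorder}" assume "z \<in> {z. vandermonde z = 0}"
    then have "\<not> inj (\<lambda>i. z $ i)" using vandermonde_nonzero_iff[of z] by simp
    then obtain i j where "z $ i = z $ j" "i \<noteq> j" by (auto simp: inj_def)
    then show "z \<in> (\<Union>(i, j)\<in>{(i, j). i \<noteq> j}. {z. (axis i 1 - axis j 1) \<bullet> z = 0})"
      by (intro UN_I[where a="(i, j)"]) (simp_all add: inner_diff_left inner_axis')
  qed
  moreover have "negligible (\<Union>(i, j)\<in>{(i, j). i \<noteq> j}. {z :: complex^'d::{finite,wellorder}. (axis i 1 - axis j 1) \<bullet> z = 0})"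
  proof (rule negligible_Union)
    fix T assume "T \<in> (\<lambda>(i, j). {z :: complex^'d::{finite,wellorder}. (axis i 1 - axis j 1) \<bullet> z = 0}) ` {(i, j). i \<noteq> j}"
    then obtain i j where "i \<noteq> j" and T: "T = {z :: complex^'d::{finite,wellorder}. (axis i 1 - axis j 1) \<bullet> z = 0}" by auto
    have "(axis i 1 - axis j 1 :: complex^'d::{finite,wellorder}) \<noteq> 0"
    proof
      assume *: "(axis i 1 - axis j 1 :: complex^'d::{finite,wellorder}) = 0"
      have "(axis i 1 - axis j 1 :: complex^'d::{finite,wellorder}) $ i = 1" using \<open>i \<noteq> j\<close> by (simp add: axis_def)
      then show False unfolding * by simp
    qed
    then show "negligible T" unfolding T by (intro negligible_hyperplane) simp
  qed simp
  ultimately show ?thesis by (rule negligible_subset[rotated])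
qed

lemma permutation_integral:
  fixes f :: "complex^'d::finite \<Rightarrow> complex"
  assumes p: "p permutes UNIV" and f: "f absolutely_integrable_on UNIV"
  shows "(\<lambda>z. f (\<chi> i. z $ p i)) absolutely_integrable_on UNIV"
    and "integral UNIV (\<lambda>z. f (\<chi> i. z $ p i)) = integral UNIV f"
proof -
  let ?A = "permutation_matrix p" and ?g = "\<lambda>z :: complex^'d. \<chi> i. z $ p i"
  have lin: "?g = (\<lambda>z. ?A *v z)" by (simp add: permutation_matrix_mult_vector)
  have der: "(?g has_derivative (\<lambda>h. ?A *v h)) (at z within S)" for z S
    unfolding lin by (rule bounded_linear_imp_has_derivative) (use linear_matrix_complex[of ?A] in \<open>simp add: linear_conv_bounded_linear\<close>)
  have inj: "inj ?g"
  proof (rule injI)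
    fix x y assume "?g x = ?g y"
    then have "x $ p i = y $ p i" for i by (simp add: vec_eq_iff)
    then have "x $ i = y $ i" for i using permutes_surj[OF p] by (metis surjD)
    then show "x = y" by (simp add: vec_eq_iff)
  qed
  have surj: "range ?g = UNIV"
  proof
    show "UNIV \<subseteq> range ?g"
    proof
      fix y :: "complex^'d"
      have "y = ?g (\<chi> i. y $ inv p i)" using permutes_inverses(2)[OF p] by (simp add: vec_eq_iff)
      then show "y \<in> range ?g" by (rule range_eqI)
    qed
  qed simp
  have jac: "real_jacobian ?A = 1" using permutes_bij[OF p] by (rule real_jacobian_permutation)
  have U: "(UNIV :: (complex^'d) set) \<in> sets lebesgue" by simp
  note cv = has_absolute_integral_change_of_variables_complex[OF U der inj, of f "integral UNIV f", unfolded jac scaleR_one surj]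
  show "(\<lambda>z. f (\<chi> i. z $ p i)) absolutely_integrable_on UNIV" "integral UNIV (\<lambda>z. f (\<chi> i. z $ p i)) = integral UNIV f"
    using cv f by blast+
qed

lemma polydisc_permute:
  fixes z :: "complex^'n"
  shows "p permutes UNIV \<Longrightarrow> (\<chi> i. z $ p i) \<in> polydisc \<longleftrightarrow> z \<in> polydisc"
proof -
  assume p: "p permutes UNIV"
  have "(\<forall>i. cmod (z $ p i) < 1) \<longleftrightarrow> (\<forall>i\<in>range p. cmod (z $ i) < 1)" by auto
  then show ?thesis using permutes_surj[OF p] by (simp add: polydisc_def)
qed

text \<open>
  Exactly one permutation sorts a tuple of distinct numbers, so exactly one summand is present.
\<close>
lemma sorted_polydisc_tiling:
  fixes z :: "complex^'d::{finite,wellorder}" and \<Phi> :: "complex^'d::{finite,wellorder} \<Rightarrow> complex"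
  assumes "vandermonde z \<noteq> 0" and sym: "\<And>p z. p permutes UNIV \<Longrightarrow> \<Phi> (\<chi> i. z $ p i) = \<Phi> z"
  shows "(\<Sum>p | p permutes UNIV. if (\<chi> i. z $ p i) \<in> sorted_polydisc then \<Phi> (\<chi> i. z $ p i) else 0) = (if z \<in> polydisc then \<Phi> z else 0)"
proof -
  have "inj (\<lambda>i. z $ i)" using assms(1) vandermonde_nonzero_iff[of z] by simp
  from ex1_sorting_permutation[OF this] obtain q where q: "q permutes UNIV" "lex_sorted (\<chi> i. z $ q i)"
    and uniq: "\<And>p. p permutes UNIV \<Longrightarrow> lex_sorted (\<chi> i. z $ p i) \<Longrightarrow> p = q" by blast
  have "(\<Sum>p | p permutes UNIV. if (\<chi> i. z $ p i) \<in> sorted_polydisc then \<Phi> (\<chi> i. z $ p i) else 0)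
     = (\<Sum>p | p permutes UNIV. if p = q then (if z \<in> polydisc then \<Phi> z else 0) else 0)"
  proof (rule sum.cong[OF refl])
    fix p assume "p \<in> {p. p permutes (UNIV :: 'd set)}"
    then have p: "p permutes UNIV" by simp
    have "(\<chi> i. z $ p i) \<in> sorted_polydisc \<longleftrightarrow> p = q \<and> z \<in> polydisc"
      unfolding sorted_polydisc_def mem_Collect_eq polydisc_permute[OF p] using uniq[OF p] q(2) by blast
    then show "(if (\<chi> i. z $ p i) \<in> sorted_polydisc then \<Phi> (\<chi> i. z $ p i) else 0) = (if p = q then (if z \<in> polydisc then \<Phi> z else 0) else 0)"
      unfolding sym[OF p] by simp
  qed
  also have "\<dots> = (if z \<in> polydisc then \<Phi> z else 0)" using q(1) by simp
  finally show ?thesis .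
qed

text \<open>
  Up to a null set the polydisc is the disjoint union of the \<open>d!\<close> images of the sorted part under
  permutations of the coordinates.
\<close>
lemma integral_polydisc_symmetric:
  fixes \<Phi> :: "complex^'d::{finite,wellorder} \<Rightarrow> complex"
  assumes sym: "\<And>p z. p permutes UNIV \<Longrightarrow> \<Phi> (\<chi> i. z $ p i) = \<Phi> z"
  shows "\<Phi> absolutely_integrable_on polydisc \<longleftrightarrow> \<Phi> absolutely_integrable_on sorted_polydisc"
    and "\<Phi> absolutely_integrable_on sorted_polydisc \<Longrightarrow> integral polydisc \<Phi> = fact CARD('d) * integral sorted_polydisc \<Phi>"
proof -
  let ?S = "sorted_polydisc :: (complex^'d::{finite,wellorder}) set"
  define \<Psi> where "\<Psi> = (\<lambda>z. if z \<in> ?S then \<Phi> z else 0)"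
  define \<Sigma> where "\<Sigma> = (\<lambda>z. \<Sum>p | p permutes UNIV. \<Psi> (\<chi> i. z $ p i))"
  let ?P = "\<lambda>z. if z \<in> polydisc then \<Phi> z else 0"
  have tile: "?P z = \<Sigma> z" if "z \<in> UNIV - {z. vandermonde z = 0}" for z
    using sorted_polydisc_tiling[of z \<Phi>] that sym unfolding \<Sigma>_def \<Psi>_def by simp
  have "finite {p. p permutes (UNIV :: 'd set)}" by simp
  note fin = this
  have fwd: "\<Phi> absolutely_integrable_on polydisc \<and> integral polydisc \<Phi> = fact CARD('d) * integral ?S \<Phi>"
    if "\<Phi> absolutely_integrable_on ?S"
  proof -
    have \<Psi>: "\<Psi> absolutely_integrable_on UNIV"
      unfolding \<Psi>_def absolutely_integrable_restrict_UNIV by (rule that)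
    have perm: "(\<lambda>z. \<Psi> (\<chi> i. z $ p i)) absolutely_integrable_on UNIV" "integral UNIV (\<lambda>z. \<Psi> (\<chi> i. z $ p i)) = integral UNIV \<Psi>"
      if "p permutes UNIV" for p using permutation_integral[OF that \<Psi>] by auto
    have \<Sigma>: "\<Sigma> absolutely_integrable_on UNIV"
      unfolding \<Sigma>_def by (intro absolutely_integrable_sum fin) (simp add: perm)
    have "integral UNIV \<Sigma> = (\<Sum>p | p permutes (UNIV :: 'd set). integral UNIV (\<lambda>z. \<Psi> (\<chi> i. z $ p i)))"
      unfolding \<Sigma>_def by (rule integral_sum[OF fin]) (use perm in \<open>auto simp: absolutely_integrable_on_def\<close>)
    also have "\<dots> = of_nat (card {p. p permutes (UNIV :: 'd set)}) * integral UNIV \<Psi>"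
      by (simp add: perm)
    also have "\<dots> = fact CARD('d) * integral ?S \<Phi>"
      using card_permutations[of "UNIV :: 'd set" "CARD('d)"] by (simp add: \<Psi>_def integral_restrict_UNIV)
    finally have I: "integral UNIV \<Sigma> = fact CARD('d) * integral ?S \<Phi>" .
    have "?P absolutely_integrable_on UNIV"
      by (rule absolutely_integrable_spike[OF \<Sigma> negligible_vandermonde tile])
    moreover have "integral UNIV \<Sigma> = integral UNIV ?P"
      by (rule integral_spike[OF negligible_vandermonde tile])
    ultimately show ?thesis
      using I by (simp add: absolutely_integrable_restrict_UNIV integral_restrict_UNIV)
  qed
  show "\<Phi> absolutely_integrable_on polydisc \<longleftrightarrow> \<Phi> absolutely_integrable_on ?S"
  proof
    assume "\<Phi> absolutely_integrable_on polydisc"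
    then show "\<Phi> absolutely_integrable_on ?S"
      by (rule set_integrable_subset) (use sorted_polydisc_sets in \<open>auto simp: sorted_polydisc_def\<close>)
  qed (use fwd in blast)
  show "\<Phi> absolutely_integrable_on ?S \<Longrightarrow> integral polydisc \<Phi> = fact CARD('d) * integral ?S \<Phi>"
    using fwd by blast
qed

text \<open>
  The symmetrization is injective on the sorted part of the polydisc, with real Jacobian
  \<open>|V|\<^sup>2\<close>, and its image misses only the image of the null set \<open>V = 0\<close>.
\<close>
theorem integral_symmetrized_polydisc:
  fixes F :: "complex^'d::{finite,wellorder} \<Rightarrow> complex"
  defines "\<Phi> \<equiv> \<lambda>z. (cmod (vandermonde z))\<^sup>2 *\<^sub>R F (symmetrization z)"
  shows "F absolutely_integrable_on symmetrized_polydisc \<longleftrightarrow> \<Phi> absolutely_integrable_on polydisc"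
    and "F absolutely_integrable_on symmetrized_polydisc \<Longrightarrow>
      integral polydisc \<Phi> = fact CARD('d) * integral symmetrized_polydisc F"
proof -
  let ?S = "sorted_polydisc :: (complex^'d::{finite,wellorder}) set" and ?s = "symmetrization :: complex^'d::{finite,wellorder} \<Rightarrow> _"
  let ?G = "symmetrized_polydisc :: (complex^'d::{finite,wellorder}) set"
  have sym: "\<Phi> (\<chi> i. z $ p i) = \<Phi> z" if p: "p permutes UNIV" for p z
    unfolding \<Phi>_def vandermonde_permute[OF p] symmetrization_permute[OF permutes_bij[OF p]]
    by (simp add: norm_mult sign_def)
  have S: "?S \<in> sets lebesgue" using sorted_polydisc_sets by (intro sets_completionI_sets) simp
  have nz: "vandermonde z \<noteq> 0" if "z \<in> ?S" for z
    using that lex_sorted_inj[of z] by (simp add: vandermonde_nonzero_iff sorted_polydisc_def)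
  have der: "(?s has_derivative (\<lambda>h. symmetrization_deriv z *v h)) (at z within ?S)" for z
    using has_derivative_symmetrization by (rule has_derivative_at_withinI)
  note cv = has_absolute_integral_change_of_variables_complex[OF S der inj_on_symmetrization_sorted, of F]
  have jac: "real_jacobian (symmetrization_deriv z) *\<^sub>R F (?s z) = \<Phi> z" if "z \<in> ?S" for z
    unfolding \<Phi>_def real_jacobian_symmetrization[OF nz[OF that]] ..
  have "(\<lambda>z. real_jacobian (symmetrization_deriv z) *\<^sub>R F (?s z)) absolutely_integrable_on ?S \<longleftrightarrow> \<Phi> absolutely_integrable_on ?S"
    by (rule set_integrable_cong[OF refl refl jac])
  moreover have "integral ?S (\<lambda>z. real_jacobian (symmetrization_deriv z) *\<^sub>R F (?s z)) = integral ?S \<Phi>"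
    by (rule integral_cong) (rule jac)
  ultimately have cv': "\<Phi> absolutely_integrable_on ?S \<and> integral ?S \<Phi> = b \<longleftrightarrow> F absolutely_integrable_on ?s ` ?S \<and> integral (?s ` ?S) F = b" for b
    using cv[of b] by simp
  have sub: "?s ` ?S \<subseteq> ?G" by (auto simp: symmetrized_polydisc_def sorted_polydisc_def)
  have neg: "negligible (?s ` {z. vandermonde z = 0})"
  proof (rule negligible_differentiable_image_negligible[OF order_refl negligible_vandermonde])
    show "?s differentiable_on {z. vandermonde z = 0}"
      unfolding differentiable_on_def differentiable_def
      using has_derivative_at_withinI[OF has_derivative_symmetrization] by blast
  qed
  have diff: "?G - ?s ` ?S \<subseteq> ?s ` {z. vandermonde z = 0}"
  proof
    fix u assume u: "u \<in> ?G - ?s ` ?S"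
    then obtain z where z: "z \<in> polydisc" "u = ?s z" by (auto simp: symmetrized_polydisc_def)
    show "u \<in> ?s ` {z. vandermonde z = 0}"
    proof (cases "vandermonde z = 0")
      case False
      then have "inj (\<lambda>i. z $ i)" using vandermonde_nonzero_iff[of z] by simp
      from ex1_sorting_permutation[OF this] obtain q where q: "q permutes UNIV" "lex_sorted (\<chi> i. z $ q i)" by blast
      then have "(\<chi> i. z $ q i) \<in> ?S" using z polydisc_permute[OF q(1), of z] by (simp add: sorted_polydisc_def)
      moreover have "?s (\<chi> i. z $ q i) = u" using z symmetrization_permute[OF permutes_bij[OF q(1)]] by simp
      ultimately have "u \<in> ?s ` ?S" by blast
      with u show ?thesis by blast
    qed (use z in blast)
  qed
  let ?E = "?s ` {z. vandermonde z = 0}"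
  have eqE: "(if u \<in> ?G then F u else 0) = (if u \<in> ?s ` ?S then F u else 0)" if "u \<in> UNIV - ?E" for u
    using that sub diff by auto
  have spike1: "F absolutely_integrable_on ?s ` ?S \<longleftrightarrow> F absolutely_integrable_on ?G"
    using absolutely_integrable_spike_eq[OF neg, of UNIV "\<lambda>u. if u \<in> ?G then F u else 0" "\<lambda>u. if u \<in> ?s ` ?S then F u else 0", OF eqE]
    unfolding absolutely_integrable_restrict_UNIV by simp
  have spike2: "integral (?s ` ?S) F = integral ?G F"
    using integral_spike[OF neg, of UNIV "\<lambda>u. if u \<in> ?G then F u else 0" "\<lambda>u. if u \<in> ?s ` ?S then F u else 0", OF eqE]
    unfolding integral_restrict_UNIV .
  show iff: "F absolutely_integrable_on ?G \<longleftrightarrow> \<Phi> absolutely_integrable_on polydisc"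
  proof -
    have "\<Phi> absolutely_integrable_on polydisc \<longleftrightarrow> \<Phi> absolutely_integrable_on ?S"
      by (rule integral_polydisc_symmetric(1)) (rule sym)
    then show ?thesis using spike1 cv'[of "integral ?S \<Phi>"] cv'[of "integral (?s ` ?S) F"] by blast
  qed
  show "integral polydisc \<Phi> = fact CARD('d) * integral ?G F" if "F absolutely_integrable_on ?G"
  proof -
    have "F absolutely_integrable_on ?s ` ?S" using that spike1 by blast
    then have *: "\<Phi> absolutely_integrable_on ?S \<and> integral ?S \<Phi> = integral (?s ` ?S) F" using cv' by blast
    then have "integral polydisc \<Phi> = fact CARD('d) * integral ?S \<Phi>"
      by (intro integral_polydisc_symmetric(2)) (auto intro: sym)
    with * show ?thesis unfolding spike2 by simp
  qed
qed

section \<open>The reproducing kernel of the symmetrized polydisc\<close>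

lemma weighted_volume_eq_density:
  assumes "0 < c" "\<nu> \<in> borel_measurable (lebesgue_on G)"
  shows "weighted_volume c G \<nu> = density (lebesgue_on G) (\<lambda>z. ennreal (c * \<nu> z))"
proof -
  have "scale_measure (ennreal c) (lebesgue_on G) = density (lebesgue_on G) (\<lambda>_. ennreal c)"
    by (rule measure_eqI) (simp_all add: emeasure_density_const)
  then have "weighted_volume c G \<nu> = density (density (lebesgue_on G) (\<lambda>_. ennreal c)) (\<lambda>z. ennreal (\<nu> z))"
    by (simp add: weighted_volume_def)
  also have "\<dots> = density (lebesgue_on G) (\<lambda>z. ennreal c * ennreal (\<nu> z))"
    using assms(2) by (intro density_density_eq) auto
  finally show ?thesis using assms(1) by (simp add: ennreal_mult')
qed

lemma weighted_volume_integral: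
  fixes f :: "complex^'n \<Rightarrow> 'b::euclidean_space"
  assumes c: "0 < c" and G: "open G" and \<nu>: "continuous_on G \<nu>" "\<forall>u\<in>G. 0 < \<nu> u" and f: "continuous_on G f"
  shows "integrable (weighted_volume c G \<nu>) f \<longleftrightarrow> (\<lambda>u. \<nu> u *\<^sub>R f u) absolutely_integrable_on G"
    and "(\<lambda>u. \<nu> u *\<^sub>R f u) absolutely_integrable_on G \<Longrightarrow>
      integral\<^sup>L (weighted_volume c G \<nu>) f = c *\<^sub>R integral G (\<lambda>u. \<nu> u *\<^sub>R f u)"
proof -
  have GS: "G \<in> sets lebesgue" using G by (intro sets_completionI_sets) (simp add: borel_open)
  have m\<nu>: "\<nu> \<in> borel_measurable (lebesgue_on G)" and mf: "f \<in> borel_measurable (lebesgue_on G)"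
    by (intro continuous_imp_measurable_on_sets_lebesgue \<nu> f GS)+
  have mc: "(\<lambda>u. c * \<nu> u) \<in> borel_measurable (lebesgue_on G)" using m\<nu> by simp
  have nn: "AE u in lebesgue_on G. 0 \<le> c * \<nu> u"
    using c \<nu>(2) by (intro AE_I2) (simp add: less_imp_le)
  have W: "weighted_volume c G \<nu> = density (lebesgue_on G) (\<lambda>z. ennreal (c * \<nu> z))"
    by (rule weighted_volume_eq_density[OF c m\<nu>])
  have R: "integrable (lebesgue_on G) g \<longleftrightarrow> g absolutely_integrable_on G" for g :: "complex^'n \<Rightarrow> 'b"
    unfolding set_integrable_def by (rule integrable_restrict_space) (use GS in simp)
  have assoc: "(\<lambda>u. (c * \<nu> u) *\<^sub>R f u) = (\<lambda>u. c *\<^sub>R (\<nu> u *\<^sub>R f u))" by simp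
  have sc: "(\<lambda>u. c *\<^sub>R (\<nu> u *\<^sub>R f u)) absolutely_integrable_on G \<longleftrightarrow> (\<lambda>u. \<nu> u *\<^sub>R f u) absolutely_integrable_on G"
  proof
    assume "(\<lambda>u. c *\<^sub>R (\<nu> u *\<^sub>R f u)) absolutely_integrable_on G"
    then have "(\<lambda>u. inverse c *\<^sub>R (c *\<^sub>R (\<nu> u *\<^sub>R f u))) absolutely_integrable_on G"
      by (rule absolutely_integrable_scaleR_left)
    moreover have "(\<lambda>u. inverse c *\<^sub>R (c *\<^sub>R (\<nu> u *\<^sub>R f u))) = (\<lambda>u. \<nu> u *\<^sub>R f u)"
      using c by (simp add: fun_eq_iff)
    ultimately show "(\<lambda>u. \<nu> u *\<^sub>R f u) absolutely_integrable_on G" by (simp only:)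
  qed (rule absolutely_integrable_scaleR_left)
  have I: "integrable (lebesgue_on G) (\<lambda>u. (c * \<nu> u) *\<^sub>R f u) \<longleftrightarrow> (\<lambda>u. \<nu> u *\<^sub>R f u) absolutely_integrable_on G"
    unfolding R assoc sc ..
  show "integrable (weighted_volume c G \<nu>) f \<longleftrightarrow> (\<lambda>u. \<nu> u *\<^sub>R f u) absolutely_integrable_on G"
    unfolding W integrable_density[OF mf mc nn] by (rule I)
  assume "(\<lambda>u. \<nu> u *\<^sub>R f u) absolutely_integrable_on G"
  then have "integrable (lebesgue_on G) (\<lambda>u. (c * \<nu> u) *\<^sub>R f u)" by (simp only: I)
  from lebesgue_integral_eq_integral[OF this GS]
  have "integral\<^sup>L (weighted_volume c G \<nu>) f = integral G (\<lambda>u. (c * \<nu> u) *\<^sub>R f u)"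
    unfolding W integral_density[OF mf mc nn] .
  also have "\<dots> = c *\<^sub>R integral G (\<lambda>u. \<nu> u *\<^sub>R f u)" unfolding assoc by (rule integral_cmul)
  finally show "integral\<^sup>L (weighted_volume c G \<nu>) f = c *\<^sub>R integral G (\<lambda>u. \<nu> u *\<^sub>R f u)" .
qed

lemma bergman_inner_cnj: "cnj (bergman_inner c \<Omega> \<nu> f g) = bergman_inner c \<Omega> \<nu> g f"
proof -
  have "cnj (bergman_inner c \<Omega> \<nu> f g) = (LINT z|weighted_volume c \<Omega> \<nu>. cnj (f z * cnj (g z)))"
    unfolding bergman_inner_def by (rule Bochner_Integration.integral_cnj[symmetric])
  then show ?thesis by (simp add: bergman_inner_def mult.commute)
qed

text \<open>
  Apply the reproducing property of each kernel to a section of the other one. For equal kernels this is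
  Hermitian symmetry; two applications give uniqueness.
\<close>
lemma reproducing_kernels_conjugate:
  assumes "is_reproducing_kernel c \<Omega> \<nu> K" "is_reproducing_kernel c \<Omega> \<nu> L" "z \<in> \<Omega>" "w \<in> \<Omega>"
  shows "K z w = cnj (L w z)"
proof -
  have "\<forall>f\<in>weighted_bergman_space c \<Omega> \<nu>. f z = bergman_inner c \<Omega> \<nu> f (\<lambda>u. L u z)"
    "(\<lambda>u. K u w) \<in> weighted_bergman_space c \<Omega> \<nu>"
    using assms by (simp_all add: is_reproducing_kernel_def)
  from bspec[OF this] have "K z w = bergman_inner c \<Omega> \<nu> (\<lambda>u. K u w) (\<lambda>u. L u z)" .
  moreover have "\<forall>f\<in>weighted_bergman_space c \<Omega> \<nu>. f w = bergman_inner c \<Omega> \<nu> f (\<lambda>u. K u w)"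
    "(\<lambda>u. L u z) \<in> weighted_bergman_space c \<Omega> \<nu>"
    using assms by (simp_all add: is_reproducing_kernel_def)
  from bspec[OF this] have "L w z = bergman_inner c \<Omega> \<nu> (\<lambda>u. L u z) (\<lambda>u. K u w)" .
  ultimately show ?thesis by (simp add: bergman_inner_cnj)
qed

lemma reproducing_kernel_unique:
  assumes "is_reproducing_kernel c \<Omega> \<nu> K" "is_reproducing_kernel c \<Omega> \<nu> L" "z \<in> \<Omega>" "w \<in> \<Omega>"
  shows "K z w = L z w"
  using reproducing_kernels_conjugate[OF assms] reproducing_kernels_conjugate[OF assms(2,2,4,3)] by simp

lemma space_weighted_volume: "space (weighted_volume c \<Omega> \<nu>) = \<Omega>"
  by (simp add: weighted_volume_def space_scale_measure)

lemma weighted_bergman_space_cong: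
  assumes "open \<Omega>" "\<And>z. z \<in> \<Omega> \<Longrightarrow> f z = g z" "f \<in> weighted_bergman_space c \<Omega> \<nu>"
  shows "g \<in> weighted_bergman_space c \<Omega> \<nu>"
proof -
  have "holomorphic_cn_on g \<Omega>"
    using assms complex_linear_deriv_transform[OF _ assms(1), of f _ g]
    by (simp add: weighted_bergman_space_def holomorphic_cn_on_iff)
  moreover have "integrable (weighted_volume c \<Omega> \<nu>) (\<lambda>z. (cmod (g z))\<^sup>2) \<longleftrightarrow> integrable (weighted_volume c \<Omega> \<nu>) (\<lambda>z. (cmod (f z))\<^sup>2)"
    by (rule Bochner_Integration.integrable_cong) (simp_all add: space_weighted_volume assms(2))
  ultimately show ?thesis using assms(3) by (simp add: weighted_bergman_space_def)
qed

text \<open>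
  Uniqueness makes the definite description meaningful once some reproducing kernel is known.
\<close>
lemma weighted_bergman_kernel_eq:
  assumes "open \<Omega>" "is_reproducing_kernel c \<Omega> \<nu> K"
  shows "is_reproducing_kernel c \<Omega> \<nu> (weighted_bergman_kernel c \<Omega> \<nu>)"
    and "z \<in> \<Omega> \<Longrightarrow> w \<in> \<Omega> \<Longrightarrow> weighted_bergman_kernel c \<Omega> \<nu> z w = K z w"
proof -
  define L where "L = (\<lambda>z w. if z \<in> \<Omega> \<and> w \<in> \<Omega> then K z w else 0)"
  have L: "is_reproducing_kernel c \<Omega> \<nu> L"
    unfolding is_reproducing_kernel_def
  proof (intro conjI ballI)
    fix w assume w: "w \<in> \<Omega>"
    show "(\<lambda>z. L z w) \<in> weighted_bergman_space c \<Omega> \<nu>"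
      by (rule weighted_bergman_space_cong[OF assms(1), of "\<lambda>z. K z w"])
        (use assms(2) w in \<open>auto simp: L_def is_reproducing_kernel_def\<close>)
    fix f assume f: "f \<in> weighted_bergman_space c \<Omega> \<nu>"
    have "bergman_inner c \<Omega> \<nu> f (\<lambda>z. L z w) = bergman_inner c \<Omega> \<nu> f (\<lambda>z. K z w)"
      unfolding bergman_inner_def using w
      by (intro Bochner_Integration.integral_cong refl) (simp add: space_weighted_volume L_def)
    then show "f w = bergman_inner c \<Omega> \<nu> f (\<lambda>z. L z w)"
      using assms(2) w f by (simp add: is_reproducing_kernel_def)
  qed
  have "weighted_bergman_kernel c \<Omega> \<nu> = L"
    unfolding weighted_bergman_kernel_def
  proof (rule the_equality)
    show "is_reproducing_kernel c \<Omega> \<nu> L \<and> (\<forall>z w. z \<notin> \<Omega> \<or> w \<notin> \<Omega> \<longrightarrow> L z w = 0)"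
      using L by (simp add: L_def)
    fix M assume M: "is_reproducing_kernel c \<Omega> \<nu> M \<and> (\<forall>z w. z \<notin> \<Omega> \<or> w \<notin> \<Omega> \<longrightarrow> M z w = 0)"
    show "M = L"
    proof (intro ext)
      fix z w
      show "M z w = L z w"
      proof (cases "z \<in> \<Omega> \<and> w \<in> \<Omega>")
        case True
        then show ?thesis using reproducing_kernel_unique[of c \<Omega> \<nu> M L z w] M L by blast
      next
        case False
        then show ?thesis using M by (auto simp: L_def)
      qed
    qed
  qed
  with L show "is_reproducing_kernel c \<Omega> \<nu> (weighted_bergman_kernel c \<Omega> \<nu>)"
    and "z \<in> \<Omega> \<Longrightarrow> w \<in> \<Omega> \<Longrightarrow> weighted_bergman_kernel c \<Omega> \<nu> z w = K z w"
    by (simp_all add: L_def)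
qed

lemma power_kernel_det_expansion:
  "power_kernel_det lam z w = (\<Sum>p | p permutes UNIV. of_int (sign p) * polydisc_kernel lam z (\<chi> i. w $ p i))"
  by (simp add: power_kernel_det_def det_def polydisc_kernel_def power_kernel_def)

lemma complex_linear_deriv_vandermonde: "complex_linear_deriv vandermonde z"
  unfolding vandermonde_def vandermonde_matrix_def
  by (intro complex_linear_deriv_det)
    (simp add: signed_power_def complex_linear_deriv_mult complex_linear_deriv_const
      complex_linear_deriv_field[OF complex_linear_deriv_component DERIV_power[OF DERIV_ident]])

lemma continuous_on_vandermonde: "continuous_on S vandermonde"
proof (rule continuous_at_imp_continuous_on, rule ballI)
  fix z :: "complex^'d::{finite,wellorder}"
  obtain a where "(vandermonde has_derivative (\<lambda>h. \<Sum>i\<in>UNIV. a i * h $ i)) (at z)"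
    using complex_linear_deriv_vandermonde by (rule complex_linear_derivE)
  then show "isCont vandermonde z" by (rule has_derivative_continuous)
qed

text \<open>
  Move \<open>w\<close> along the line in the direction of the vector of ranks. Its coordinates are distinct, so every
  pair of coordinates of \<open>w\<close> is separated for small positive times.
\<close>
lemma generic_approximation:
  fixes w :: "complex^'d::{finite,wellorder}"
  assumes "w \<in> polydisc"
  shows "\<exists>X. (\<forall>n. X n \<in> polydisc \<and> vandermonde (X n) \<noteq> 0) \<and> X \<longlonglongrightarrow> w"
proof -
  define W where "W = (\<lambda>t :: real. \<chi> i. w $ i + of_real (t * index_rank i))"
  have lim: "(W \<longlongrightarrow> w) (at_right 0)"
  proof -
    have "(W \<longlongrightarrow> (\<chi> i. w $ i + of_real (0 * real (index_rank i)))) (at_right 0)"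
      unfolding W_def by (intro tendsto_intros)
    then show ?thesis by simp
  qed
  have ev1: "\<forall>\<^sub>F t in at_right 0. W t \<in> polydisc"
    using lim open_polydisc assms by (rule topological_tendstoD)
  have ev2: "\<forall>\<^sub>F t in at_right 0. W t $ i \<noteq> W t $ j" if "i \<noteq> j" for i j
  proof (cases "w $ i = w $ j")
    case True
    have "W t $ i \<noteq> W t $ j" if "t > 0" for t
      using that \<open>i \<noteq> j\<close> True by (simp add: W_def)
    then show ?thesis by (auto simp: eventually_at_right_field intro!: exI[of _ 1])
  next
    case False
    have "((\<lambda>t. W t $ i - W t $ j) \<longlongrightarrow> w $ i - w $ j) (at_right 0)"
      by (intro tendsto_intros lim)
    moreover have "w $ i - w $ j \<noteq> 0" using False by simp
    ultimately have "\<forall>\<^sub>F t in at_right 0. W t $ i - W t $ j \<noteq> 0" by (rule tendsto_imp_eventually_ne)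
    then show ?thesis by (rule eventually_mono) auto
  qed
  have "\<forall>\<^sub>F t in at_right 0. \<forall>i j. i \<noteq> j \<longrightarrow> W t $ i \<noteq> W t $ j"
    using ev2 by (intro eventually_all_finite) (auto simp: eventually_frequently_simps)
  then have ev3: "\<forall>\<^sub>F t in at_right 0. vandermonde (W t) \<noteq> 0"
    by (rule eventually_mono) (auto simp: vandermonde_nonzero_iff inj_def)
  have ev: "\<forall>\<^sub>F t in at_right 0. W t \<in> polydisc \<and> vandermonde (W t) \<noteq> 0"
    using ev1 ev3 by (rule eventually_conj)
  \<comment> \<open>turn the one-sided limit into a limit along a sequence\<close>
  have seq: "filterlim (\<lambda>n. inverse (real (Suc n))) (at_right 0) sequentially"
    unfolding at_within_def by (intro filterlim_inf[THEN iffD2] conjI LIMSEQ_inverse_real_of_nat) (auto simp: filterlim_principal)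
  have lim': "(\<lambda>n. W (inverse (real (Suc n)))) \<longlonglongrightarrow> w" using filterlim_compose[OF lim seq] .
  from eventually_compose_filterlim[OF ev seq] obtain N where
    N: "\<And>n. n \<ge> N \<Longrightarrow> W (inverse (real (Suc n))) \<in> polydisc \<and> vandermonde (W (inverse (real (Suc n)))) \<noteq> 0"
    unfolding eventually_sequentially by blast
  show ?thesis
  proof (intro exI[of _ "\<lambda>n. W (inverse (real (Suc (n + N))))"] conjI allI)
    show "(\<lambda>n. W (inverse (real (Suc (n + N))))) \<longlonglongrightarrow> w" using LIMSEQ_ignore_initial_segment[OF lim', of N] .
    show "W (inverse (real (Suc (n + N)))) \<in> polydisc" "vandermonde (W (inverse (real (Suc (n + N))))) \<noteq> 0" for n
      using N[OF le_add2[of N n]] by blast+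
  qed
qed

context
  fixes lam :: real and \<nu> :: "complex^'d::{finite,wellorder} \<Rightarrow> real"
  assumes lam: "lam > 1" and cont\<nu>: "continuous_on symmetrized_polydisc \<nu>"
    and pos\<nu>: "\<forall>u\<in>symmetrized_polydisc. \<nu> u > 0"
    and pull: "\<forall>z\<in>polydisc. polydisc_weight lam z = \<nu> (symmetrization z)"
begin

lemma pullback_integral:
  fixes F :: "complex^'d::{finite,wellorder} \<Rightarrow> complex"
  shows "(\<lambda>u. \<nu> u *\<^sub>R F u) absolutely_integrable_on symmetrized_polydisc \<longleftrightarrow>
      (\<lambda>z. of_real ((cmod (vandermonde z))\<^sup>2 * polydisc_weight lam z) * F (symmetrization z)) absolutely_integrable_on polydisc"
    and "(\<lambda>u. \<nu> u *\<^sub>R F u) absolutely_integrable_on symmetrized_polydisc \<Longrightarrow>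
      integral polydisc (\<lambda>z. of_real ((cmod (vandermonde z))\<^sup>2 * polydisc_weight lam z) * F (symmetrization z))
        = fact CARD('d) * integral symmetrized_polydisc (\<lambda>u. \<nu> u *\<^sub>R F u)"
proof -
  have eq: "(cmod (vandermonde z))\<^sup>2 *\<^sub>R (\<nu> (symmetrization z) *\<^sub>R F (symmetrization z))
    = of_real ((cmod (vandermonde z))\<^sup>2 * polydisc_weight lam z) * F (symmetrization z)" if "z \<in> polydisc" for z
    using pull that by (simp add: scaleR_conv_of_real)
  have 1: "(\<lambda>z. (cmod (vandermonde z))\<^sup>2 *\<^sub>R (\<nu> (symmetrization z) *\<^sub>R F (symmetrization z))) absolutely_integrable_on polydisc \<longleftrightarrow>
    (\<lambda>z. of_real ((cmod (vandermonde z))\<^sup>2 * polydisc_weight lam z) * F (symmetrization z)) absolutely_integrable_on polydisc"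
    by (rule set_integrable_cong[OF refl refl eq])
  have 2: "integral polydisc (\<lambda>z. (cmod (vandermonde z))\<^sup>2 *\<^sub>R (\<nu> (symmetrization z) *\<^sub>R F (symmetrization z))) =
    integral polydisc (\<lambda>z. of_real ((cmod (vandermonde z))\<^sup>2 * polydisc_weight lam z) * F (symmetrization z))"
    by (rule integral_cong) (rule eq)
  show "(\<lambda>u. \<nu> u *\<^sub>R F u) absolutely_integrable_on symmetrized_polydisc \<longleftrightarrow>
      (\<lambda>z. of_real ((cmod (vandermonde z))\<^sup>2 * polydisc_weight lam z) * F (symmetrization z)) absolutely_integrable_on polydisc"
    unfolding 1[symmetric] by (rule integral_symmetrized_polydisc(1))
  show "(\<lambda>u. \<nu> u *\<^sub>R F u) absolutely_integrable_on symmetrized_polydisc \<Longrightarrow>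
      integral polydisc (\<lambda>z. of_real ((cmod (vandermonde z))\<^sup>2 * polydisc_weight lam z) * F (symmetrization z))
        = fact CARD('d) * integral symmetrized_polydisc (\<lambda>u. \<nu> u *\<^sub>R F u)"
    unfolding 2[symmetric] by (rule integral_symmetrized_polydisc(2))
qed

lemma polydisc_weight_integrable: "polydisc_weight lam integrable_on (polydisc :: (complex^'d::{finite,wellorder}) set)"
  using polydisc_weight_integral(1)[OF lam, where 'n='d] by (auto simp: absolutely_integrable_on_def)

text \<open>
  The weight has finite mass, so square integrable functions are integrable.
\<close>
lemma bergman_space_pullback:
  assumes "0 < c" and f: "f \<in> weighted_bergman_space c symmetrized_polydisc \<nu>"
  shows "holomorphic_cn_on (\<lambda>z. vandermonde z * f (symmetrization z)) polydisc"
    and "(\<lambda>z. vandermonde z * f (symmetrization z) * of_real (polydisc_weight lam z)) absolutely_integrable_on polydisc"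
proof -
  let ?h = "\<lambda>z. vandermonde z * f (symmetrization z)" and ?w = "polydisc_weight lam"
  have holf: "holomorphic_cn_on f symmetrized_polydisc" using f by (simp add: weighted_bergman_space_def)
  show hol: "holomorphic_cn_on ?h polydisc"
    unfolding holomorphic_cn_on_iff
  proof (intro ballI complex_linear_deriv_mult complex_linear_deriv_vandermonde)
    fix z :: "complex^'d::{finite,wellorder}" assume "z \<in> polydisc"
    then show "complex_linear_deriv (\<lambda>z. f (symmetrization z)) z"
      using holf by (intro complex_linear_deriv_compose[OF has_derivative_symmetrization])
        (auto simp: holomorphic_cn_on_iff symmetrized_polydisc_def)
  qed
  have contf: "continuous_on symmetrized_polydisc (\<lambda>u. (cmod (f u))\<^sup>2)"
    by (intro continuous_intros holomorphic_cn_on_imp_continuous_on[OF holf])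
  have "integrable (weighted_volume c symmetrized_polydisc \<nu>) (\<lambda>u. (cmod (f u))\<^sup>2)"
    using f by (simp add: weighted_bergman_space_def)
  then have "(\<lambda>u. \<nu> u *\<^sub>R (cmod (f u))\<^sup>2) absolutely_integrable_on symmetrized_polydisc"
    by (simp only: weighted_volume_integral(1)[OF assms(1) open_symmetrized_polydisc cont\<nu> pos\<nu> contf])
  from absolutely_integrable_linear[OF this bounded_linear_of_real[where 'a=complex]]
  have "(\<lambda>u. \<nu> u *\<^sub>R complex_of_real ((cmod (f u))\<^sup>2)) absolutely_integrable_on symmetrized_polydisc"
    by (simp add: o_def scaleR_conv_of_real)
  then have "(\<lambda>z. of_real ((cmod (vandermonde z))\<^sup>2 * ?w z) * complex_of_real ((cmod (f (symmetrization z)))\<^sup>2)) absolutely_integrable_on polydisc"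
    by (simp only: pullback_integral(1))
  then have "(\<lambda>z. norm (of_real ((cmod (vandermonde z))\<^sup>2 * ?w z) * complex_of_real ((cmod (f (symmetrization z)))\<^sup>2))) integrable_on polydisc"
    by (simp only: absolutely_integrable_on_def)
  then have sum: "(\<lambda>z. norm (of_real ((cmod (vandermonde z))\<^sup>2 * ?w z) * complex_of_real ((cmod (f (symmetrization z)))\<^sup>2)) + ?w z) integrable_on polydisc"
    by (rule integrable_add) (rule polydisc_weight_integrable)
  show "(\<lambda>z. ?h z * of_real (?w z)) absolutely_integrable_on polydisc"
  proof (rule continuous_imp_absolutely_integrable[OF _ polydisc_sets(2) sum])
    show "continuous_on polydisc (\<lambda>z. ?h z * of_real (?w z))"
      by (intro continuous_intros holomorphic_cn_on_imp_continuous_on[OF hol] continuous_on_polydisc_weight)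
    fix z :: "complex^'d::{finite,wellorder}" assume "z \<in> polydisc"
    then have w: "0 < ?w z" by (rule polydisc_weight_pos)
    \<comment> \<open>pointwise bound of \<open>|h|\<close> by \<open>|h|\<^sup>2 + 1\<close>; both summands are integrable against the weight\<close>
    have "x \<le> x\<^sup>2 + 1" if "0 \<le> x" for x :: real
      using zero_le_power2[of "x - 1"] that by (simp add: power2_eq_square algebra_simps)
    then have "cmod (?h z) \<le> (cmod (?h z))\<^sup>2 + 1" using norm_ge_zero by blast
    then have "cmod (?h z) * ?w z \<le> ((cmod (?h z))\<^sup>2 + 1) * ?w z" using w by (intro mult_right_mono) auto
    moreover have "norm (?h z * of_real (?w z)) = cmod (?h z) * ?w z"
      unfolding norm_mult[of "?h z"] norm_of_real abs_of_pos[OF w] ..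
    moreover have "norm (of_real ((cmod (vandermonde z))\<^sup>2 * ?w z) * complex_of_real ((cmod (f (symmetrization z)))\<^sup>2)) = (cmod (?h z))\<^sup>2 * ?w z"
      unfolding of_real_mult[symmetric] norm_of_real using w by (simp add: abs_mult norm_mult power_mult_distrib mult_ac)
    ultimately show "norm (?h z * of_real (?w z)) \<le> norm (of_real ((cmod (vandermonde z))\<^sup>2 * ?w z) * complex_of_real ((cmod (f (symmetrization z)))\<^sup>2)) + ?w z"
      by (simp only: distrib_right mult_1)
  qed
qed

lemma half_det_pairing_integrable:
  assumes h: "holomorphic_cn_on h polydisc"
    and int: "(\<lambda>z. h z * of_real (polydisc_weight lam z)) absolutely_integrable_on polydisc"
    and v: "v \<in> symmetrized_polydisc"
  shows "(\<lambda>z. h z * cnj (half_det lam z v) * of_real (polydisc_weight lam z)) absolutely_integrable_on polydisc"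
proof -
  have "lam > 0" using lam by simp
  obtain e C where "e > 0" "ball v e \<subseteq> symmetrized_polydisc" and bound: "\<forall>v'\<in>ball v e. \<forall>z\<in>polydisc. cmod (half_det lam z v') \<le> C"
    using half_det_locally_bounded[OF v \<open>lam > 0\<close>] by (elim exE conjE)
  then have C': "cmod (half_det lam z v) \<le> C" if "z \<in> polydisc" for z using that by simp
  show ?thesis
  proof (rule continuous_imp_absolutely_integrable[OF _ polydisc_sets(2)])
    show "continuous_on polydisc (\<lambda>z. h z * cnj (half_det lam z v) * of_real (polydisc_weight lam z))"
      by (intro continuous_intros holomorphic_cn_on_imp_continuous_on[OF h] continuous_on_half_det[OF v] continuous_on_polydisc_weight)
    show "(\<lambda>z. C * norm (h z * of_real (polydisc_weight lam z))) integrable_on polydisc"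
      using int by (intro integrable_on_mult_right) (auto simp: absolutely_integrable_on_def)
    show "norm (h z * cnj (half_det lam z v) * of_real (polydisc_weight lam z)) \<le> C * norm (h z * of_real (polydisc_weight lam z))"
      if "z \<in> polydisc" for z
      using mult_right_mono[OF C'[OF that], of "norm (h z * of_real (polydisc_weight lam z))"] by (simp add: norm_mult mult_ac)
  qed
qed

text \<open>
  Expand \<open>det = half_det \<cdot> cnj (V(w))\<close> over permutations. The product kernel at the permuted point
  \<open>w \<circ> p\<close> reproduces \<open>h(w \<circ> p) = sign p \<cdot> h(w)\<close>, and this sign cancels the one of the expansion.
\<close>
lemma half_det_pairing_generic:
  fixes w :: "complex^'d::{finite,wellorder}"
  assumes hol: "holomorphic_cn_on (\<lambda>z. vandermonde z * f (symmetrization z)) polydisc"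
    and int: "(\<lambda>z. vandermonde z * f (symmetrization z) * of_real (polydisc_weight lam z)) absolutely_integrable_on polydisc"
    and w: "w \<in> polydisc" "vandermonde w \<noteq> 0"
  shows "integral polydisc (\<lambda>z. vandermonde z * f (symmetrization z) * cnj (half_det lam z (symmetrization w)) * of_real (polydisc_weight lam z))
    = fact CARD('d) * of_real ((pi / (lam - 1)) ^ CARD('d)) * f (symmetrization w)"
proof -
  let ?h = "\<lambda>z. vandermonde z * f (symmetrization z)" and ?w = "polydisc_weight lam" and ?C = "complex_of_real ((pi / (lam - 1)) ^ CARD('d))"
  have wp: "(\<chi> i. w $ p i) \<in> polydisc" if "p permutes UNIV" for p using polydisc_permute[OF that] w(1) by simp
  note rep = polydisc_reproducing[OF hol wp lam int]
  have hp: "?h (\<chi> i. w $ p i) = of_int (sign p) * ?h w" if "p permutes UNIV" for p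
    using that by (simp add: vandermonde_permute symmetrization_permute permutes_bij)
  have ss: "of_int (sign p) * (of_int (sign p) * x) = (x :: complex)" for p :: "'d \<Rightarrow> 'd" and x
    by (simp add: sign_def)
  have "integral polydisc (\<lambda>z. ?h z * cnj (half_det lam z (symmetrization w)) * of_real (?w z)) * vandermonde w
    = integral polydisc (\<lambda>z. ?h z * cnj (half_det lam z (symmetrization w)) * of_real (?w z) * vandermonde w)"
    by simp
  also have "\<dots> = integral polydisc (\<lambda>z. \<Sum>p | p permutes UNIV. of_int (sign p) * (?h z * cnj (polydisc_kernel lam z (\<chi> i. w $ p i)) * of_real (?w z)))"
  proof (rule integral_cong)
    fix z :: "complex^'d::{finite,wellorder}" assume z: "z \<in> polydisc"
    have "cnj (half_det lam z (symmetrization w)) * vandermonde w = cnj (power_kernel_det lam z w)"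
      using power_kernel_det_eq[OF z w(1), of lam] by simp
    also have "\<dots> = (\<Sum>p | p permutes UNIV. of_int (sign p) * cnj (polydisc_kernel lam z (\<chi> i. w $ p i)))"
      by (simp add: power_kernel_det_expansion)
    finally have e: "cnj (half_det lam z (symmetrization w)) * vandermonde w = (\<Sum>p | p permutes UNIV. of_int (sign p) * cnj (polydisc_kernel lam z (\<chi> i. w $ p i)))" .
    have "?h z * cnj (half_det lam z (symmetrization w)) * of_real (?w z) * vandermonde w
      = (?h z * of_real (?w z)) * (cnj (half_det lam z (symmetrization w)) * vandermonde w)" by (simp only: mult_ac)
    also have "\<dots> = (\<Sum>p | p permutes UNIV. of_int (sign p) * (?h z * cnj (polydisc_kernel lam z (\<chi> i. w $ p i)) * of_real (?w z)))"
      unfolding e sum_distrib_left by (intro sum.cong refl) (simp only: mult_ac)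
    finally show "?h z * cnj (half_det lam z (symmetrization w)) * of_real (?w z) * vandermonde w
      = (\<Sum>p | p permutes UNIV. of_int (sign p) * (?h z * cnj (polydisc_kernel lam z (\<chi> i. w $ p i)) * of_real (?w z)))" .
  qed
  also have "\<dots> = (\<Sum>p | p permutes UNIV. integral polydisc (\<lambda>z. of_int (sign p) * (?h z * cnj (polydisc_kernel lam z (\<chi> i. w $ p i)) * of_real (?w z))))"
    by (rule integral_sum) (use rep(1) in \<open>auto simp: absolutely_integrable_on_def intro!: integrable_on_mult_right\<close>)
  also have "\<dots> = (\<Sum>p | p permutes (UNIV :: 'd set). ?h w * ?C)"
  proof (rule sum.cong[OF refl])
    fix p :: "'d \<Rightarrow> 'd" assume "p \<in> {p. p permutes UNIV}"
    then have p: "p permutes UNIV" by simp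
    show "integral polydisc (\<lambda>z. of_int (sign p) * (?h z * cnj (polydisc_kernel lam z (\<chi> i. w $ p i)) * of_real (?w z))) = ?h w * ?C"
      unfolding integral_mult_right rep(2)[OF p] hp[OF p] by (simp add: ss mult.assoc)
  qed
  also have "\<dots> = fact CARD('d) * (?h w * ?C)"
    using card_permutations[of "UNIV :: 'd set" "CARD('d)"] by simp
  also have "\<dots> = (fact CARD('d) * ?C * f (symmetrization w)) * vandermonde w" by (simp only: mult_ac)
  finally show ?thesis by (rule mult_right_cancel[OF w(2), THEN iffD1])
qed

text \<open>
  Both sides are continuous in \<open>v\<close>: the left side by dominated convergence, as \<open>half_det\<close> is locally
  bounded. Points \<open>symmetrization w\<close> with distinct coordinates of \<open>w\<close> are dense.
\<close>
lemma half_det_pairing: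
  assumes c: "0 < c" and f: "f \<in> weighted_bergman_space c symmetrized_polydisc \<nu>" and v: "v \<in> symmetrized_polydisc"
  shows "integral polydisc (\<lambda>z. vandermonde z * f (symmetrization z) * cnj (half_det lam z v) * of_real (polydisc_weight lam z))
    = fact CARD('d) * of_real ((pi / (lam - 1)) ^ CARD('d)) * f v"
proof -
  let ?h = "\<lambda>z. vandermonde z * f (symmetrization z)" and ?w = "polydisc_weight lam"
  let ?C = "fact CARD('d) * complex_of_real ((pi / (lam - 1)) ^ CARD('d))"
  note hol = bergman_space_pullback(1)[OF c f] and int = bergman_space_pullback(2)[OF c f]
  obtain w where w: "w \<in> polydisc" "v = symmetrization w" using v by (auto simp: symmetrized_polydisc_def)
  have "lam > 0" using lam by simp
  obtain e B where e: "e > 0" "ball v e \<subseteq> symmetrized_polydisc"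
    and bound: "\<forall>v'\<in>ball v e. \<forall>z\<in>polydisc. cmod (half_det lam z v') \<le> B"
    using half_det_locally_bounded[OF v \<open>lam > 0\<close>] by (elim exE conjE)
  from generic_approximation[OF w(1)] obtain X
    where "\<forall>n. X n \<in> polydisc \<and> vandermonde (X n) \<noteq> 0" "X \<longlonglongrightarrow> w" by (elim exE conjE)
  then have X: "\<And>n. X n \<in> polydisc" "\<And>n. vandermonde (X n) \<noteq> 0" "X \<longlonglongrightarrow> w" by blast+
  have lim: "(\<lambda>n. symmetrization (X n)) \<longlonglongrightarrow> v"
    unfolding w(2) by (rule isCont_tendsto_compose[OF has_derivative_continuous[OF has_derivative_symmetrization] X(3)])
  have "\<forall>\<^sub>F n in sequentially. symmetrization (X n) \<in> ball v e"
    by (rule topological_tendstoD[OF lim]) (use e in auto)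
  then obtain N where N: "\<And>n. n \<ge> N \<Longrightarrow> symmetrization (X n) \<in> ball v e"
    unfolding eventually_sequentially by blast
  \<comment> \<open>drop the first terms, so that the uniform bound holds along the whole sequence\<close>
  define Y where "Y = (\<lambda>n. symmetrization (X (n + N)))"
  have Y: "Y n \<in> ball v e" for n unfolding Y_def by (rule N) simp
  have limY: "Y \<longlonglongrightarrow> v" unfolding Y_def using LIMSEQ_ignore_initial_segment[OF lim, of N] .
  have YG: "Y n \<in> symmetrized_polydisc" for n using Y e(2) by blast
  let ?g = "\<lambda>v z. ?h z * cnj (half_det lam z v) * of_real (?w z)"
  have "(\<lambda>n. integral polydisc (?g (Y n))) \<longlonglongrightarrow> integral polydisc (?g v)"
  proof (rule dominated_convergence(2))
    show "?g (Y n) integrable_on polydisc" for n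
      using half_det_pairing_integrable[OF hol int YG] by (auto simp: absolutely_integrable_on_def)
    show "(\<lambda>z. B * norm (?h z * of_real (?w z))) integrable_on polydisc"
      using int by (intro integrable_on_mult_right) (auto simp: absolutely_integrable_on_def)
    show "norm (?g (Y n) z) \<le> B * norm (?h z * of_real (?w z))" if "z \<in> polydisc" for n z
      using mult_right_mono[OF bound[rule_format, OF Y that, of n], of "norm (?h z * of_real (?w z))"] by (simp add: norm_mult mult_ac)
    show "(\<lambda>n. ?g (Y n) z) \<longlonglongrightarrow> ?g v z" if "z \<in> polydisc" for z
      by (intro tendsto_intros isCont_tendsto_compose[OF isCont_half_det[OF v that] limY])
  qed
  moreover have "integral polydisc (?g (Y n)) = ?C * f (Y n)" for n
    unfolding Y_def by (rule half_det_pairing_generic[OF hol int X(1,2)])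
  moreover have "(\<lambda>n. ?C * f (Y n)) \<longlonglongrightarrow> ?C * f v"
  proof -
    have "holomorphic_cn_on f symmetrized_polydisc" using f by (simp add: weighted_bergman_space_def)
    then have "isCont f v" using v unfolding holomorphic_cn_on_def by (blast intro: has_derivative_continuous)
    then show ?thesis by (intro tendsto_intros isCont_tendsto_compose[OF _ limY])
  qed
  ultimately show ?thesis using LIMSEQ_unique by simp
qed

text \<open>
  Pull both integrals back to the polydisc, where \<open>V(z) \<cdot> sym_kernel (s(z)) v\<close> is \<open>half_det z v\<close>. The
  latter is bounded, which gives membership in the Bergman space; the pairing gives the reproducing
  formula.
\<close>
theorem sym_kernel_reproducing:
  assumes c: "0 < c"
  shows "is_reproducing_kernel c symmetrized_polydisc \<nu>
    (\<lambda>u v. of_real (polydisc_normalization lam TYPE('d) / c) * sym_kernel lam u v)"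
  unfolding is_reproducing_kernel_def
proof (intro conjI ballI)
  fix v :: "complex^'d::{finite,wellorder}" assume v: "v \<in> symmetrized_polydisc"
  let ?G = "symmetrized_polydisc :: (complex^'d::{finite,wellorder}) set"
  let ?k = "polydisc_normalization lam TYPE('d) / c" and ?w = "polydisc_weight lam"
  let ?K = "\<lambda>u. of_real ?k * sym_kernel lam u v"
  have "lam > 0" using lam by simp
  have c0: "polydisc_normalization lam TYPE('d) * (pi / (lam - 1)) ^ CARD('d) = 1"
    unfolding polydisc_normalization_def power_mult_distrib[symmetric] using lam by simp
  have holK: "holomorphic_cn_on ?K ?G"
    using holomorphic_sym_kernel[OF v, of lam] unfolding holomorphic_cn_on_iff
    by (intro ballI complex_linear_deriv_mult complex_linear_deriv_const) blast
  have contK: "continuous_on ?G (\<lambda>u. sym_kernel lam u v)"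
    by (rule holomorphic_cn_on_imp_continuous_on[OF holomorphic_sym_kernel[OF v]])
  obtain e B where "e > 0" "ball v e \<subseteq> symmetrized_polydisc" and bound: "\<forall>v'\<in>ball v e. \<forall>z\<in>polydisc. cmod (half_det lam z v') \<le> B"
    using half_det_locally_bounded[OF v \<open>lam > 0\<close>] by (elim exE conjE)
  then have B': "cmod (half_det lam z v) \<le> B" if "z \<in> polydisc" for z using that by simp
  have sg: "symmetrization z \<in> ?G" if "z \<in> polydisc" for z using that by (simp add: symmetrized_polydisc_def)
  show "?K \<in> weighted_bergman_space c ?G \<nu>"
  proof -
    have "(\<lambda>z. of_real ((cmod (vandermonde z))\<^sup>2 * ?w z) * complex_of_real ((cmod (sym_kernel lam (symmetrization z) v))\<^sup>2)) absolutely_integrable_on polydisc"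
    proof (rule continuous_imp_absolutely_integrable[OF _ polydisc_sets(2)])
      show "continuous_on polydisc (\<lambda>z. of_real ((cmod (vandermonde z))\<^sup>2 * ?w z) * complex_of_real ((cmod (sym_kernel lam (symmetrization z) v))\<^sup>2))"
        by (intro continuous_intros continuous_on_vandermonde continuous_on_polydisc_weight
          continuous_on_compose2[OF contK continuous_on_symmetrization]) (auto simp: sg)
      show "(\<lambda>z. B\<^sup>2 * ?w z) integrable_on (polydisc :: (complex^'d::{finite,wellorder}) set)"
        by (intro integrable_on_mult_right polydisc_weight_integrable)
      fix z :: "complex^'d::{finite,wellorder}" assume z: "z \<in> polydisc"
      have "norm (of_real ((cmod (vandermonde z))\<^sup>2 * ?w z) * complex_of_real ((cmod (sym_kernel lam (symmetrization z) v))\<^sup>2))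
        = (cmod (half_det lam z v))\<^sup>2 * ?w z"
        unfolding of_real_mult[symmetric] norm_of_real
        using polydisc_weight_pos[OF z, of lam] by (simp add: half_det_eq[OF z v] norm_mult power_mult_distrib abs_mult mult_ac)
      also have "\<dots> \<le> B\<^sup>2 * ?w z"
        using polydisc_weight_pos[OF z, of lam] B'[OF z] by (intro mult_right_mono power_mono) auto
      finally show "norm (of_real ((cmod (vandermonde z))\<^sup>2 * ?w z) * complex_of_real ((cmod (sym_kernel lam (symmetrization z) v))\<^sup>2)) \<le> B\<^sup>2 * ?w z" .
    qed
    then have "(\<lambda>u. \<nu> u *\<^sub>R complex_of_real ((cmod (sym_kernel lam u v))\<^sup>2)) absolutely_integrable_on ?G"
      by (simp only: pullback_integral(1))
    from absolutely_integrable_linear[OF this bounded_linear_Re]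
    have "(\<lambda>u. \<nu> u *\<^sub>R (cmod (sym_kernel lam u v))\<^sup>2) absolutely_integrable_on ?G"
      by (simp add: o_def scaleR_conv_of_real)
    then have "integrable (weighted_volume c ?G \<nu>) (\<lambda>u. (cmod (sym_kernel lam u v))\<^sup>2)"
      by (subst weighted_volume_integral(1)[OF c open_symmetrized_polydisc cont\<nu> pos\<nu>]) (auto intro!: continuous_intros contK)
    then have "integrable (weighted_volume c ?G \<nu>) (\<lambda>u. ?k\<^sup>2 * (cmod (sym_kernel lam u v))\<^sup>2)" by simp
    moreover have "(\<lambda>u. ?k\<^sup>2 * (cmod (sym_kernel lam u v))\<^sup>2) = (\<lambda>u. (cmod (?K u))\<^sup>2)"
      unfolding norm_mult power_mult_distrib norm_of_real power2_abs ..
    ultimately show ?thesis using holK unfolding weighted_bergman_space_def by simp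
  qed
  fix f assume f: "f \<in> weighted_bergman_space c ?G \<nu>"
  let ?F = "\<lambda>u. f u * cnj (sym_kernel lam u v)"
  note hol = bergman_space_pullback(1)[OF c f] and int = bergman_space_pullback(2)[OF c f]
  have contf: "continuous_on ?G f"
    using f by (auto simp: weighted_bergman_space_def intro: holomorphic_cn_on_imp_continuous_on)
  have eq: "of_real ((cmod (vandermonde z))\<^sup>2 * ?w z) * ?F (symmetrization z)
     = vandermonde z * f (symmetrization z) * cnj (half_det lam z v) * of_real (?w z)" if z: "z \<in> polydisc" for z
    using complex_norm_square[of "vandermonde z"] by (simp add: half_det_eq[OF z v] mult_ac)
  have "(\<lambda>z. of_real ((cmod (vandermonde z))\<^sup>2 * ?w z) * ?F (symmetrization z)) absolutely_integrable_on polydisc"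
    by (subst set_integrable_cong[OF refl refl eq]) (use half_det_pairing_integrable[OF hol int v] in auto)
  then have intF: "(\<lambda>u. \<nu> u *\<^sub>R ?F u) absolutely_integrable_on ?G" by (simp only: pullback_integral(1))
  have "fact CARD('d) * integral ?G (\<lambda>u. \<nu> u *\<^sub>R ?F u)
    = integral polydisc (\<lambda>z. of_real ((cmod (vandermonde z))\<^sup>2 * ?w z) * ?F (symmetrization z))"
    by (rule pullback_integral(2)[OF intF, symmetric])
  also have "\<dots> = integral polydisc (\<lambda>z. vandermonde z * f (symmetrization z) * cnj (half_det lam z v) * of_real (?w z))"
    by (rule integral_cong) (rule eq)
  also have "\<dots> = fact CARD('d) * (of_real ((pi / (lam - 1)) ^ CARD('d)) * f v)"
    unfolding half_det_pairing[OF c f v] by (simp only: mult.assoc)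
  finally have I: "integral ?G (\<lambda>u. \<nu> u *\<^sub>R ?F u) = of_real ((pi / (lam - 1)) ^ CARD('d)) * f v" by simp
  have J: "integral\<^sup>L (weighted_volume c ?G \<nu>) ?F = c *\<^sub>R integral ?G (\<lambda>u. \<nu> u *\<^sub>R ?F u)"
    by (rule weighted_volume_integral(2)[OF c open_symmetrized_polydisc cont\<nu> pos\<nu> _ intF]) (intro continuous_intros contf contK)
  have "bergman_inner c ?G \<nu> f ?K = (LINT u|weighted_volume c ?G \<nu>. of_real ?k * ?F u)"
    unfolding bergman_inner_def
    by (intro Bochner_Integration.integral_cong refl) (simp only: complex_cnj_mult complex_cnj_complex_of_real mult_ac)
  also have "\<dots> = of_real ?k * integral\<^sup>L (weighted_volume c ?G \<nu>) ?F"
    by (rule integral_mult_right_zero)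
  also have "\<dots> = of_real ?k * (of_real c * (of_real ((pi / (lam - 1)) ^ CARD('d)) * f v))"
    unfolding J I by (simp only: scaleR_conv_of_real)
  also have "\<dots> = of_real (?k * c * (pi / (lam - 1)) ^ CARD('d)) * f v" by (simp only: of_real_mult mult_ac)
  also have "?k * c * (pi / (lam - 1)) ^ CARD('d) = 1" using c0 c by simp
  finally show "f v = bergman_inner c ?G \<nu> f ?K" by simp
qed

lemma sym_kernel_hermitian:
  fixes u v :: "complex^'d::{finite,wellorder}"
  assumes "u \<in> symmetrized_polydisc" "v \<in> symmetrized_polydisc"
  shows "cnj (sym_kernel lam u v) = sym_kernel lam v u"
proof -
  have pos: "0 < polydisc_normalization lam TYPE('d)" using lam by (simp add: polydisc_normalization_def)
  have "is_reproducing_kernel (polydisc_normalization lam TYPE('d)) symmetrized_polydisc \<nu> (sym_kernel lam)"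
    using sym_kernel_reproducing[OF pos] pos by simp
  from reproducing_kernels_conjugate[OF this this assms(2,1)] show ?thesis by simp
qed

text \<open>
  Holomorphy in \<open>w\<close> of the conjugate is reduced to holomorphy in the first variable by Hermitian
  symmetry.
\<close>
lemma sym_kernel_quotient:
  "is_quotient_on polydisc (power_kernel_det lam) vandermonde_product
     (\<lambda>z w :: complex^'d::{finite,wellorder}. sym_kernel lam (symmetrization z) (symmetrization w))"
proof -
  have mem: "symmetrization z \<in> symmetrized_polydisc" if "z \<in> polydisc" for z :: "complex^'d::{finite,wellorder}"
    using that by (simp add: symmetrized_polydisc_def)
  have hol: "holomorphic_cn_on (\<lambda>z. sym_kernel lam (symmetrization z) (symmetrization w)) polydisc"
    if "w \<in> polydisc" for w :: "complex^'d::{finite,wellorder}"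
    unfolding holomorphic_cn_on_iff
  proof
    fix z :: "complex^'d::{finite,wellorder}" assume "z \<in> polydisc"
    then show "complex_linear_deriv (\<lambda>z. sym_kernel lam (symmetrization z) (symmetrization w)) z"
      using holomorphic_sym_kernel[OF mem[OF that], of lam] mem
      by (intro complex_linear_deriv_compose[OF has_derivative_symmetrization]) (simp add: holomorphic_cn_on_iff)
  qed
  have antihol: "holomorphic_cn_on (\<lambda>w. cnj (sym_kernel lam (symmetrization z) (symmetrization w))) polydisc"
    if z: "z \<in> polydisc" for z :: "complex^'d::{finite,wellorder}"
    unfolding holomorphic_cn_on_iff
  proof
    fix w :: "complex^'d::{finite,wellorder}" assume w: "w \<in> polydisc"
    show "complex_linear_deriv (\<lambda>w. cnj (sym_kernel lam (symmetrization z) (symmetrization w))) w"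
    proof (rule complex_linear_deriv_transform[OF _ open_polydisc w])
      show "complex_linear_deriv (\<lambda>w. sym_kernel lam (symmetrization w) (symmetrization z)) w"
        using hol[OF z] w by (simp add: holomorphic_cn_on_iff)
      show "sym_kernel lam (symmetrization x) (symmetrization z) = cnj (sym_kernel lam (symmetrization z) (symmetrization x))"
        if "x \<in> polydisc" for x
        using sym_kernel_hermitian[OF mem[OF z] mem[OF that]] by simp
    qed
  qed
  show ?thesis
    unfolding is_quotient_on_def sesquiholomorphic_on_def
    using hol antihol power_kernel_det_factorization by blast
qed

end

theorem proposition5p2:
  fixes lam :: real
    and \<omega>' :: "complex^'d::{finite,wellorder} \<Rightarrow> real"
  assumes "lam > 1"
    and "continuous_on symmetrized_polydisc \<omega>'"
    and "\<forall>u\<in>symmetrized_polydisc. \<omega>' u > 0"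
    and "\<forall>z\<in>polydisc. polydisc_weight lam z = \<omega>' (symmetrization z)"
  shows "\<exists>Q. is_quotient_on polydisc (power_kernel_det lam) vandermonde_product Q \<and>
    (\<forall>z\<in>polydisc. \<forall>w\<in>polydisc.
       weighted_bergman_kernel (polydisc_normalization lam TYPE('d)) symmetrized_polydisc \<omega>'
         (symmetrization z) (symmetrization w) = Q z w) \<and>
    (\<forall>c>0. is_reproducing_kernel c symmetrized_polydisc \<omega>'
             (weighted_bergman_kernel c symmetrized_polydisc \<omega>') \<and>
       (\<forall>z\<in>polydisc. \<forall>w\<in>polydisc.
          weighted_bergman_kernel c symmetrized_polydisc \<omega>' (symmetrization z) (symmetrization w)
            = complex_of_real (polydisc_normalization lam TYPE('d) / c) * Q z w))"
proof -
  let ?Q = "\<lambda>z w :: complex^'d::{finite,wellorder}. sym_kernel lam (symmetrization z) (symmetrization w)"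
  have mem: "symmetrization z \<in> symmetrized_polydisc" if "z \<in> polydisc" for z :: "complex^'d::{finite,wellorder}"
    using that by (simp add: symmetrized_polydisc_def)
  have kernel: "is_reproducing_kernel c symmetrized_polydisc \<omega>' (weighted_bergman_kernel c symmetrized_polydisc \<omega>')"
    "\<And>z w. z \<in> polydisc \<Longrightarrow> w \<in> polydisc \<Longrightarrow>
      weighted_bergman_kernel c symmetrized_polydisc \<omega>' (symmetrization z) (symmetrization w)
        = complex_of_real (polydisc_normalization lam TYPE('d) / c) * ?Q z w" if "c > 0" for c
    using weighted_bergman_kernel_eq[OF open_symmetrized_polydisc sym_kernel_reproducing[OF assms that]] mem by auto
  have pos: "0 < polydisc_normalization lam TYPE('d)" using assms(1) by (simp add: polydisc_normalization_def)
  show ?thesis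
  proof (intro exI[of _ ?Q] conjI allI impI ballI)
    show "is_quotient_on polydisc (power_kernel_det lam) vandermonde_product ?Q"
      by (rule sym_kernel_quotient[OF assms])
    show "weighted_bergman_kernel (polydisc_normalization lam TYPE('d)) symmetrized_polydisc \<omega>' (symmetrization z) (symmetrization w) = ?Q z w"
      if "z \<in> polydisc" "w \<in> polydisc" for z w
      using kernel(2)[OF pos that] pos by simp
  qed (use kernel in auto)
qed

end
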